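(* Let $K$ be an arbitrary commutative ring with $1$, let $n,m\ge1$ be integers, $V=K^n$, and let $$\phi:K[e_r(w)\mid w\in\mathcal{M},\ r=1,\ldots,n]\to K[V^m]^{S_n}$$ be the $K$-algebra surjection with $e_r(w)\mapsto\sigma_r(w)$. Then the ideal $\ker(\phi)$ is generated by the elements $$S^{\alpha}(w_1,\ldots,w_s)\qquad\text{and}\qquad Q_{r,k}(w),$$ where $s\ge 2$; $w,w_1,\ldots,w_s\in\mathcal{M}$; $\alpha=(\alpha_1,\ldots,\alpha_s)$ is a multidegree with $\sum_{i=1}^s\alpha_i>n$ and $\sum_{i\ne j}\alpha_i\le n$ for all $j=1,\ldots,s$; $r\in\{1,\ldots,n\}$; and $k\geq 2$ is an integer with $k<1+n/r$.
   Context: $K[V^m]$ is the polynomial ring over $K$ in the $mn$ variables $x(i)_j$ ($1\le i\le m$, $1\le j\le n$), and $S_n$ acts by simultaneously permuting the index $j$. $\mathcal{M}$ is the set of monomials $\neq1$ in commuting variables $x(1),\ldots,x(m)$. For $w=x(1)^{\alpha_1}\cdots x(m)^{\alpha_m}\in\mathcal{M}$ put $w_{\langle j\rangle}=x(1)_j^{\alpha_1}\cdots x(m)_j^{\alpha_m}$, and for $1\le l\le n$ put $\sigma_l(w)=\sum_{1\le i_1<\cdots<i_l\le n}w_{\langle i_1\rangle}\cdots w_{\langle i_l\rangle}\in K[V^m]^{S_n}$. The $e_r(w)$ ($w\in\mathcal{M}$, $1\le r\le n$) are independent commuting indeterminates; put $e_r(w)=0$ for $r>n$. Definition of $S^\alpha$.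 Let $\mathcal{M}_s$ be the set of monomials $\ne1$ in commuting variables $x(1),\ldots,x(s)$. Consider non-empty words in non-commuting variables $Y_1,\ldots,Y_s$. A word is reduced if it is not of the form $U_0^k$ with $k\ge2$ and $U_0$ a shorter word. Words $U_1U_2$ and $U_2U_1$ are called cyclically equivalent; let $\mathcal{W}_0$ be the set of cyclic equivalence classes of reduced words. For a multiset of pairs $\{(r_1,u_1),\ldots,(r_d,u_d)\}$ (repetitions allowed) with $r_i$ positive integers and $u_i\in\mathcal{M}_s$, let $C_{\{(r_1,u_1),\ldots,(r_d,u_d)\}}$ be the number of multisets of elements of $\mathcal{W}_0$ consisting of $d$ distinct elements $U_1,\ldots,U_d$ with respective multiplicities $r_1,\ldots,r_d$ such that the specialization $Y_i\mapsto x(i)$ ($i=1,\ldots,s$) sends $U_j$ to $u_j$ for $j=1,\ldots,d$ (equivalently, the number of finite sets of pairs $\{(r_1,U_1),\ldots,(r_d,U_d)\}$ with distinct $U_j\in\mathcal{W}_0$ that specialize to the given multiset of pairs). For $\alpha=(\alpha_1,\ldots,\alpha_s)\in\mathbb{N}_0^s$, $l=\alpha_1+\cdots+\alpha_s$, and $w_1,\ldots,w_s\in\mathcal{M}$, define $$S^{\alpha}(w_1,\ldots,w_s)=\sum(-1)^{l+r_1+\cdots+r_d}\,C_{\{(r_1,u_1),\ldots,(r_d,u_d)\}}\;e_{r_1}(u_1(w_1,\ldots,w_s))\cdots e_{r_d}(u_d(w_1,\ldots,w_s)),$$ where the sum is over all multisets of pairs $\{(r_1,u_1),\ldots,(r_d,u_d)\}$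 with $r_i$ positive integers, $u_i\in\mathcal{M}_s$, such that $u_1^{r_1}\cdots u_d^{r_d}=x(1)^{\alpha_1}\cdots x(s)^{\alpha_s}$, and $u_i(w_1,\ldots,w_s)\in\mathcal{M}$ is obtained from $u_i$ by substituting $x(j)\mapsto w_j$. Definition of $Q_{j,k}$. When $m=1$ write $x=x(1)$; $K[V]^{S_n}$ is a polynomial ring in $\sigma_1(x),\ldots,\sigma_n(x)$, and for each $k\ge2$ and $j\in\{1,\ldots,n\}$ there is a unique $n$-variable polynomial $f_{j,k}$ with integer coefficients such that $\sigma_j(x^k)=f_{j,k}(\sigma_1(x),\ldots,\sigma_n(x))$ (an identity over $\mathbb{Z}$). For $w\in\mathcal{M}$ put $Q_{j,k}(w)=e_j(w^k)-f_{j,k}(e_1(w),\ldots,e_n(w))$. *)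

theory Defs
  imports
    Complex_Main
    "HOL-Library.Multiset"
    "HOL-Library.Poly_Mapping"
    "HOL-Combinatorics.Permutations"
    "HOL-Algebra.RingHom"
begin

text \<open>
  A monomial is a multiset of variables, so multiplication of monomials is multiset sum, the trivial
  monomial is the empty multiset and \<open>w\<^sup>k\<close> is \<open>repeat_mset k w\<close>. A polynomial is a finitely supported
  function from monomials to coefficients.
\<close>

type_synonym ('v, 'k) mpoly = "'v multiset \<Rightarrow>\<^sub>0 'k"

definition pmon :: "'v multiset \<Rightarrow> ('v, 'k::comm_ring_1) mpoly" where
  "pmon t = Poly_Mapping.single t 1"

definition pvar :: "'v \<Rightarrow> ('v, 'k::comm_ring_1) mpoly" where
  "pvar v = pmon {#v#}"

definition pconst :: "'k \<Rightarrow> ('v, 'k::comm_ring_1) mpoly" where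
  "pconst c = Poly_Mapping.single {#} c"

definition pvars :: "('v, 'k::comm_ring_1) mpoly \<Rightarrow> 'v set" where
  "pvars p = (\<Union>t\<in>Poly_Mapping.keys p. set_mset t)"

text \<open>Substitute \<open>f v\<close> for each variable \<open>v\<close>, the coefficients being mapped by \<open>h\<close>.\<close>

definition peval :: "('k \<Rightarrow> 'b) \<Rightarrow> ('v \<Rightarrow> 'b) \<Rightarrow> ('v, 'k::comm_ring_1) mpoly \<Rightarrow> 'b::comm_ring_1" where
  "peval h f p = (\<Sum>t\<in>Poly_Mapping.keys p. h (Poly_Mapping.lookup p t) * (\<Prod>v\<in>#t. f v))"

definition poly_ring :: "'v set \<Rightarrow> ('v, 'k::comm_ring_1) mpoly ring" where
  "poly_ring X =
    \<lparr>carrier = {p. pvars p \<subseteq> X}, mult = (*), one = 1, zero = 0, add = (+)\<rparr>"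


text \<open>
  The variable \<open>x(i)\<close> is the number \<open>i\<close>, and \<open>x(i)\<^sub>j\<close> is the pair \<open>(i, j)\<close>. \<open>Mon m\<close> is the set of
  monomials other than 1 in \<open>x(1), \<dots>, x(m)\<close>; it serves both for \<open>\<M>\<close> and for \<open>\<M>\<^sub>s\<close>.
\<close>

definition Mon :: "nat \<Rightarrow> nat multiset set" where
  "Mon m = {w. w \<noteq> {#} \<and> set_mset w \<subseteq> {1..m}}"

definition place :: "nat \<Rightarrow> nat multiset \<Rightarrow> (nat \<times> nat) multiset" where
  "place j w = image_mset (\<lambda>i. (i, j)) w"

definition sigma :: "nat \<Rightarrow> nat \<Rightarrow> nat multiset \<Rightarrow> (nat \<times> nat, 'k::comm_ring_1) mpoly" where
  "sigma n l w = (\<Sum>J | J \<subseteq> {1..n} \<and> card J = l. \<Prod>j\<in>J. pmon (place j w))"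

definition perm_act ::
  "(nat \<Rightarrow> nat) \<Rightarrow> (nat \<times> nat, 'k::comm_ring_1) mpoly \<Rightarrow> (nat \<times> nat, 'k) mpoly" where
  "perm_act \<pi> = peval pconst (\<lambda>(i, j). pvar (i, \<pi> j))"

text \<open>The ring \<open>K[V\<^sup>m]\<^bsup>S\<^sub>n\<^esup>\<close>.\<close>

definition inv_ring :: "nat \<Rightarrow> nat \<Rightarrow> (nat \<times> nat, 'k::comm_ring_1) mpoly ring" where
  "inv_ring n m = (poly_ring ({1..m} \<times> {1..n}))
    \<lparr>carrier := {p \<in> carrier (poly_ring ({1..m} \<times> {1..n})).
                 \<forall>\<pi>. \<pi> permutes {1..n} \<longrightarrow> perm_act \<pi> p = p}\<rparr>"

text \<open>The indeterminate \<open>e\<^sub>r(w)\<close> is the variable \<open>(r, w)\<close>.\<close>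

type_synonym 'k epoly = "(nat \<times> nat multiset, 'k) mpoly"

definition e_ring :: "nat \<Rightarrow> nat \<Rightarrow> 'k::comm_ring_1 epoly ring" where
  "e_ring n m = poly_ring ({1..n} \<times> Mon m)"

definition e :: "nat \<Rightarrow> nat \<Rightarrow> nat multiset \<Rightarrow> 'k::comm_ring_1 epoly" where
  "e n r w = (if r \<le> n then pvar (r, w) else 0)"

definition phi :: "nat \<Rightarrow> 'k::comm_ring_1 epoly \<Rightarrow> (nat \<times> nat, 'k) mpoly" where
  "phi n = peval pconst (\<lambda>(r, w). sigma n r w)"


text \<open>\<open>phi n\<close> is a homomorphism of \<open>K\<close>-algebras with values in the invariants.\<close>

lemma peval_superset:
  assumes "finite A" "Poly_Mapping.keys p \<subseteq> A" "h 0 = 0"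
  shows "peval h f p = (\<Sum>t\<in>A. h (Poly_Mapping.lookup p t) * (\<Prod>v\<in>#t. f v))"
  unfolding peval_def using assms
  by (intro sum.mono_neutral_left) (auto simp: in_keys_iff)

lemma peval_single: "h 0 = 0 \<Longrightarrow> peval h f (Poly_Mapping.single t c) = h c * (\<Prod>v\<in>#t. f v)"
  by (subst peval_superset[where A = "{t}"]) auto

lemma peval_add:
  assumes "h 0 = 0" "\<And>a b. h (a + b) = h a + h b"
  shows "peval h f (p + q) = peval h f p + peval h f q"
proof -
  let ?A = "Poly_Mapping.keys p \<union> Poly_Mapping.keys q"
  have "peval h f r = (\<Sum>t\<in>?A. h (Poly_Mapping.lookup r t) * (\<Prod>v\<in>#t. f v))"
    if "r \<in> {p, q, p + q}" for r
    using that keys_add[of p q] assms(1) by (intro peval_superset) auto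
  then show ?thesis
    by (simp add: lookup_add assms(2) sum.distrib distrib_right)
qed

lemma peval_sum:
  assumes "h 0 = 0" "\<And>a b. h (a + b) = h a + h b"
  shows "peval h f (sum g A) = (\<Sum>x\<in>A. peval h f (g x))"
proof -
  have "peval h f 0 = 0" by (simp add: peval_def)
  then show ?thesis
    by (induction A rule: infinite_finite_induct) (simp_all add: peval_add[of h, OF assms])
qed

lemma mpoly_sum_single:
  "(\<Sum>t\<in>Poly_Mapping.keys p. Poly_Mapping.single t (Poly_Mapping.lookup p t)) = p"
  by (rule poly_mapping_eqI) (simp add: lookup_sum lookup_single when_def in_keys_iff)

lemma peval_mult:
  assumes "h 0 = 0" "\<And>a b. h (a + b) = h a + h b" "\<And>a b. h (a * b) = h a * h b"
  shows "peval h f (p * q) = peval h f p * peval h f q"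
proof -
  let ?p = "\<lambda>t. Poly_Mapping.single t (Poly_Mapping.lookup p t)"
  let ?q = "\<lambda>t. Poly_Mapping.single t (Poly_Mapping.lookup q t)"
  have "p * q = (\<Sum>t\<in>Poly_Mapping.keys p. ?p t) * (\<Sum>t\<in>Poly_Mapping.keys q. ?q t)"
    by (simp only: mpoly_sum_single)
  also have "peval h f \<dots> =
    (\<Sum>t\<in>Poly_Mapping.keys p. \<Sum>t'\<in>Poly_Mapping.keys q. peval h f (?p t) * peval h f (?q t'))"
    unfolding sum_product peval_sum[of h, OF assms(1,2)]
    by (simp add: mult_single peval_single assms mult_ac)
  also have "\<dots> = peval h f (\<Sum>t\<in>Poly_Mapping.keys p. ?p t) * peval h f (\<Sum>t\<in>Poly_Mapping.keys q. ?q t)"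
    unfolding peval_sum[of h, OF assms(1,2)] sum_product ..
  finally show ?thesis by (simp only: mpoly_sum_single)
qed

lemma pconst_simps [simp]:
  "pconst 0 = 0" "pconst 1 = 1" "pconst (a + b) = pconst a + pconst b"
  "pconst (a * b) = pconst a * pconst b"
  by (simp_all add: pconst_def single_add mult_single flip: single_one)

lemma peval_pconst: "peval pconst f (pconst c) = pconst c"
  by (simp add: pconst_def peval_single)

lemma phi_simps:
  "phi n (p + q) = phi n p + phi n q" "phi n (p * q) = phi n p * phi n q"
  "phi n (pconst c) = pconst c"
  by (simp_all add: phi_def peval_add peval_mult peval_pconst)

lemma phi_e: "r \<le> n \<Longrightarrow> phi n (e n r w) = sigma n r w"
  by (simp add: phi_def e_def pvar_def pmon_def peval_single)

lemma prod_mset_pvar: "(\<Prod>v\<in>#t. pvar (g v)) = pmon (image_mset g t)"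
  by (induction t) (simp_all add: pvar_def pmon_def mult_single flip: single_one)

lemma perm_act_sigma:
  assumes "\<pi> permutes {1..n}"
  shows "perm_act \<pi> (sigma n l w) = (sigma n l w :: (nat \<times> nat, 'k::comm_ring_1) mpoly)"
proof -
  have mon: "perm_act \<pi> (pmon (place j w)) = pmon (place (\<pi> j) w)" for j
    using prod_mset_pvar[of "\<lambda>i. (i, \<pi> j)" w]
    by (simp add: perm_act_def pmon_def peval_single place_def image_mset.compositionality comp_def)
  have one: "perm_act \<pi> 1 = 1"
    unfolding perm_act_def using peval_pconst[of _ 1] by simp
  have prod: "perm_act \<pi> (prod g J) = (\<Prod>j\<in>J. perm_act \<pi> (g j))" for J :: "nat set" and g
    by (induction J rule: infinite_finite_induct)
      (simp_all add: one, simp add: perm_act_def peval_mult)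
  have inj: "inj \<pi>" using assms by (rule permutes_inj)
  have img: "\<pi> ` {1..n} = {1..n}" using assms by (rule permutes_image)
  let ?\<J> = "{J. J \<subseteq> {1..n} \<and> card J = l}"
  have "bij_betw ((`) \<pi>) ?\<J> ?\<J>"
  proof (rule bij_betwI[where g = "(`) (inv_into UNIV \<pi>)"])
    show "(`) \<pi> \<in> ?\<J> \<rightarrow> ?\<J>"
      using img inj by (auto simp: card_image inj_on_subset dest: rev_subsetD)
    show "(`) (inv_into UNIV \<pi>) \<in> ?\<J> \<rightarrow> ?\<J>"
      using permutes_image[OF permutes_inv[OF assms]] permutes_inj[OF permutes_inv[OF assms]]
      by (auto simp: card_image inj_on_subset dest: rev_subsetD)
  qed (use assms in \<open>auto simp: image_image permutes_inverses\<close>)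
  then have "(\<Sum>J\<in>?\<J>. \<Prod>j\<in>\<pi> ` J. pmon (place j w)) = (sigma n l w :: (nat \<times> nat, 'k) mpoly)"
    unfolding sigma_def by (rule sum.reindex_bij_betw)
  moreover have "(\<Prod>j\<in>\<pi> ` J. pmon (place j w)) = (\<Prod>j\<in>J. pmon (place (\<pi> j) w) :: (nat \<times> nat, 'k) mpoly)" for J
    using inj_on_subset[OF inj subset_UNIV] by (subst prod.reindex) auto
  moreover have "perm_act \<pi> (sigma n l w) =
      (\<Sum>J\<in>?\<J>. \<Prod>j\<in>J. pmon (place (\<pi> j) w) :: (nat \<times> nat, 'k) mpoly)"
    unfolding sigma_def perm_act_def
    by (subst peval_sum) (simp_all add: prod mon flip: perm_act_def)
  ultimately show ?thesis by simp
qed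

lemma pvars_add: "pvars (p + q) \<subseteq> pvars p \<union> pvars q"
  using keys_add[of p q] by (fastforce simp: pvars_def)

lemma pvars_mult: "pvars (p * q) \<subseteq> pvars p \<union> pvars q"
  using keys_mult[of p q] by (fastforce simp: pvars_def)

lemma pvars_single: "pvars (Poly_Mapping.single t c) \<subseteq> set_mset t"
  by (auto simp: pvars_def)

lemma inv_ring_closed:
  "pconst c \<in> carrier (inv_ring n m)"
  "p \<in> carrier (inv_ring n m) \<Longrightarrow> q \<in> carrier (inv_ring n m) \<Longrightarrow> p + q \<in> carrier (inv_ring n m)"
  "p \<in> carrier (inv_ring n m) \<Longrightarrow> q \<in> carrier (inv_ring n m) \<Longrightarrow> p * q \<in> carrier (inv_ring n m)"
proof -
  show "pconst c \<in> carrier (inv_ring n m)"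
    using pvars_single[of "{#}" c]
    by (auto simp: inv_ring_def poly_ring_def perm_act_def peval_pconst pconst_def[symmetric])
next
  assume "p \<in> carrier (inv_ring n m)" "q \<in> carrier (inv_ring n m)"
  then show "p + q \<in> carrier (inv_ring n m)" "p * q \<in> carrier (inv_ring n m)"
    using pvars_add[of p q] pvars_mult[of p q]
    by (auto simp: inv_ring_def poly_ring_def perm_act_def peval_add peval_mult)
qed

lemma inv_ring_sum:
  "(\<And>x. x \<in> A \<Longrightarrow> g x \<in> carrier (inv_ring n m)) \<Longrightarrow> sum g A \<in> carrier (inv_ring n m)"
  using inv_ring_closed(1)[of 0 n m]
  by (induction A rule: infinite_finite_induct) (auto intro: inv_ring_closed)

lemma sigma_closed:
  assumes "w \<in> Mon m"
  shows "(sigma n l w :: (nat \<times> nat, 'k::comm_ring_1) mpoly) \<in> carrier (inv_ring n m)"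
proof -
  have one: "pvars (1 :: (nat \<times> nat, 'k) mpoly) = {}"
    using pvars_single[of "{#}" "1 :: 'k"] by (simp flip: single_one)
  have "pvars (\<Prod>j\<in>J. pmon (place j w) :: (nat \<times> nat, 'k) mpoly) \<subseteq> {1..m} \<times> J"
    if "finite J" for J
    using that
  proof (induction J)
    case empty
    then show ?case by (simp add: one)
  next
    case (insert j J)
    have "pvars (pmon (place j w) :: (nat \<times> nat, 'k) mpoly) \<subseteq> {1..m} \<times> {j}"
      using pvars_single[of "place j w" "1 :: 'k"] assms
      by (fastforce simp: pmon_def place_def Mon_def)
    then show ?case
      using insert pvars_mult[of "pmon (place j w) :: (nat \<times> nat, 'k) mpoly" "\<Prod>j\<in>J. pmon (place j w)"]
      by auto
  qed
  then have *: "pvars (\<Prod>j\<in>J. pmon (place j w) :: (nat \<times> nat, 'k) mpoly) \<subseteq> {1..m} \<times> {1..n}"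
    if "J \<subseteq> {1..n}" for J
    using that by (meson Sigma_mono finite_atLeastAtMost finite_subset subset_refl subset_trans)
  have sum: "pvars (sum g A) \<subseteq> X" if "\<And>x. x \<in> A \<Longrightarrow> pvars (g x) \<subseteq> X"
    for g :: "nat set \<Rightarrow> (nat \<times> nat, 'k) mpoly" and A X
    using that
  proof (induction A rule: infinite_finite_induct)
    case (insert x F)
    then show ?case using pvars_add[of "g x" "sum g F"] by auto
  qed (auto simp: pvars_def)
  have "pvars (sigma n l w :: (nat \<times> nat, 'k) mpoly) \<subseteq> {1..m} \<times> {1..n}"
    unfolding sigma_def by (rule sum) (use * in auto)
  then show ?thesis
    by (simp add: inv_ring_def poly_ring_def perm_act_sigma)
qed

lemma phi_ring_hom:
  "phi n \<in> ring_hom (e_ring n m :: 'k::comm_ring_1 epoly ring) (inv_ring n m)"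
proof (rule ring_hom_memI)
  fix p :: "'k epoly"
  assume p: "p \<in> carrier (e_ring n m)"
  have "pconst c * (\<Prod>(r, w)\<in>#t. sigma n r w) \<in> carrier (inv_ring n m)"
    if "set_mset t \<subseteq> {1..n} \<times> Mon m" for t and c :: 'k
    using that
  proof (induction t)
    case empty
    then show ?case by (simp add: inv_ring_closed)
  next
    case (add v t)
    then have "sigma n (fst v) (snd v) * (pconst c * (\<Prod>(r, w)\<in>#t. sigma n r w)) \<in> carrier (inv_ring n m)"
      by (intro inv_ring_closed(3)[OF sigma_closed]) auto
    then show ?case by (cases v) (simp add: mult_ac)
  qed
  then show "phi n p \<in> carrier (inv_ring n m)"
    unfolding phi_def peval_def using p
    by (intro inv_ring_sum) (auto simp: e_ring_def poly_ring_def pvars_def)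
qed (use phi_simps(3)[of n 1] in \<open>simp_all add: e_ring_def inv_ring_def poly_ring_def phi_simps\<close>)



text \<open>Words in \<open>Y\<^sub>1, \<dots>, Y\<^sub>s\<close> are lists over \<open>{1..s}\<close>.\<close>

definition reduced :: "nat list \<Rightarrow> bool" where
  "reduced U \<longleftrightarrow>
    \<not> (\<exists>U0 k. 2 \<le> k \<and> length U0 < length U \<and> U = concat (replicate k U0))"

definition cyc_rel :: "(nat list \<times> nat list) set" where
  "cyc_rel = {(U, V). \<exists>A B. U = A @ B \<and> V = B @ A}"

definition W0 :: "nat \<Rightarrow> nat list set set" where
  "W0 s = {U. U \<noteq> [] \<and> set U \<subseteq> {1..s} \<and> reduced U} // cyc_rel"

text \<open>
  The specialization \<open>Y\<^sub>i \<mapsto> x(i)\<close> sends a word \<open>U\<close> to \<open>mset U\<close>, which is constant on cyclic classes.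
\<close>

definition spec :: "nat list set \<Rightarrow> nat multiset" where
  "spec c = the_elem (mset ` c)"

text \<open>
  \<open>C s P\<close> is the number of multisets \<open>N\<close> over \<open>W0 s\<close> such that the pairs (multiplicity of \<open>U\<close> in \<open>N\<close>,
  specialization of \<open>U\<close>), one for each distinct element \<open>U\<close> of \<open>N\<close>, form the multiset \<open>P\<close>.
\<close>

definition C :: "nat \<Rightarrow> (nat \<times> nat multiset) multiset \<Rightarrow> nat" where
  "C s P = card {N. set_mset N \<subseteq> W0 s \<and>
                    image_mset (\<lambda>U. (count N U, spec U)) (mset_set (set_mset N)) = P}"

text \<open>The multisets of pairs \<open>(r, u)\<close> with \<open>\<Prod> u\<^sup>r = x(1)\<^bsup>\<alpha> 1\<^esup> \<cdots> x(s)\<^bsup>\<alpha> s\<^esup>\<close>.\<close>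

definition decomps :: "nat \<Rightarrow> (nat \<Rightarrow> nat) \<Rightarrow> (nat \<times> nat multiset) multiset set" where
  "decomps s \<alpha> = {P. (\<forall>(r, u)\<in>#P. 1 \<le> r \<and> u \<in> Mon s) \<and>
                     (\<Sum>(r, u)\<in>#P. repeat_mset r u) = (\<Sum>i=1..s. replicate_mset (\<alpha> i) i)}"

definition subst_mon :: "(nat \<Rightarrow> nat multiset) \<Rightarrow> nat multiset \<Rightarrow> nat multiset" where
  "subst_mon w u = (\<Sum>i\<in>#u. w i)"

text \<open>Only the values of \<open>\<alpha>\<close> and \<open>w\<close> on \<open>{1..s}\<close> matter.\<close>

definition S :: "nat \<Rightarrow> nat \<Rightarrow> (nat \<Rightarrow> nat) \<Rightarrow> (nat \<Rightarrow> nat multiset) \<Rightarrow> 'k::comm_ring_1 epoly" where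
  "S n s \<alpha> w = (\<Sum>P\<in>decomps s \<alpha>.
      (-1) ^ ((\<Sum>i=1..s. \<alpha> i) + (\<Sum>(r, u)\<in>#P. r)) * of_nat (C s P) *
      (\<Prod>(r, u)\<in>#P. e n r (subst_mon w u)))"

text \<open>
  The integer polynomial \<open>f\<^sub>j\<^sub>,\<^sub>k\<close> in the variables \<open>1, \<dots>, n\<close>; \<open>{#1#}\<close> is the monomial \<open>x = x(1)\<close>.
\<close>

definition f_poly :: "nat \<Rightarrow> nat \<Rightarrow> nat \<Rightarrow> (nat, int) mpoly" where
  "f_poly n j k = (THE f. f \<in> carrier (poly_ring {1..n}) \<and>
      sigma n j (repeat_mset k {#1#}) = peval pconst (\<lambda>r. sigma n r {#1#}) f)"

definition Q :: "nat \<Rightarrow> nat \<Rightarrow> nat \<Rightarrow> nat multiset \<Rightarrow> 'k::comm_ring_1 epoly" where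
  "Q n j k w = e n j (repeat_mset k w) - peval of_int (\<lambda>r. e n r w) (f_poly n j k)"

end

theory Submission
  imports Defs
begin

text \<open>
  Let \<open>I\<close> be the ideal generated by the relations. The cyclotomic identity
  \<open>\<Prod>\<^sub>U (1 - z\<^sup>U) = 1 - (z\<^sub>1 + \<dots> + z\<^sub>s)\<close>, the product being over the primitive necklaces, shows that
  \<open>\<phi>(S\<^sup>\<alpha>(w\<^sub>1, \<dots>, w\<^sub>s))\<close> is the coefficient of \<open>t\<^sup>\<alpha>\<close> in \<open>\<Prod>\<^sub>j (1 + \<Sum>\<^sub>i t\<^sub>i w\<^sub>i\<^sub>\<langle>\<^sub>j\<^sub>\<rangle>)\<close>. It vanishes for
  \<open>|\<alpha>| > n\<close>, so \<open>I\<close> lies in the kernel.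

  Conversely, modulo \<open>I\<close> every \<open>e\<^sub>r(w\<^sup>k)\<close> is a polynomial in \<open>e\<^sub>1(w), \<dots>, e\<^sub>n(w)\<close>: for small \<open>k\<close> by the
  generators \<open>Q\<close>, otherwise because it is the leading term of some \<open>S\<^bsup>(a, r)\<^esup>(w, w\<^sup>d)\<close>. As \<open>\<phi>\<close> is injective
  on \<open>K[e\<^sub>1(w), \<dots>, e\<^sub>n(w)]\<close>, this gives
  \<open>S\<^bsup>(a, b)\<^esup>(w, w) \<equiv> (a + b choose a) e\<^bsub>a+b\<^esub>(w)\<close>. Since \<open>S\<^sup>\<alpha>(w\<^sub>1, \<dots>, w\<^sub>s)\<close> is
  \<open>\<Prod>\<^sub>i e\<^bsub>\<alpha>\<^sub>i\<^esub>(w\<^sub>i)\<close> plus products of smaller total index, every element is congruent to a linear combination of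
  products \<open>\<Prod> e\<^bsub>r\<^sub>i\<^esub>(w\<^sub>i)\<close> with distinct \<open>w\<^sub>i\<close> and \<open>\<Sum> r\<^sub>i \<le> n\<close>. Their images under \<open>\<phi>\<close> are
  linearly independent.
\<close>

section \<open>Words, primitive roots and necklaces\<close>

text \<open>As K is arbitrary, nothing may be divided by an integer, and each independence argument
  has to exhibit a monomial whose coefficient is exactly 1. Only the cyclotomic identity cancels an
  integer, and it lives over the integers: the Euler operator, applied to the product, gives a
  recursion for the size of B times the coefficient at B.

  The obstacle is a product e_a(w) e_b(w) with a + b <= n. Every generator S has total index above
  n, so none has such a product as its main term. It is for the sake of these products that the
  powers w^k and the generators Q enter.

  The two inequalities on \<alpha> describe a product whose total index exceeds n but falls to at
  most n when any one factor is dropped; every product of total index above n contains one of this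
  kind. The reduction ends because each step lowers the total index, or keeps it and lowers the
  number of factors.\<close>

lemma length_concat_replicate: "length (concat (replicate k V)) = k * length V"
  by (induction k) auto

lemma mset_concat_replicate: "mset (concat (replicate k V)) = repeat_mset k (mset V)"
  by (induction k) auto

lemma concat_replicate_commute: "concat (replicate k V) @ V = V @ concat (replicate k V)"
  by (induction k) auto

lemma concat_replicate_mult: "concat (replicate k (concat (replicate l V))) = concat (replicate (k * l) V)"
  by (induction k) (auto simp: replicate_add)

lemma reduced_power_le_1:
  assumes "reduced (concat (replicate k V))" "V \<noteq> []"
  shows "k \<le> 1"
proof (rule ccontr)
  assume "\<not> k \<le> 1"
  then have "2 \<le> k" by simp
  moreover have "length V < length (concat (replicate k V))"
    using \<open>2 \<le> k\<close> assms(2) by (simp add: length_concat_replicate)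
  ultimately show False using assms(1) unfolding reduced_def by blast
qed

text \<open>Commuting words are powers of a common word, and reducedness leaves only the exponent 1
  for each.\<close>

lemma reduced_commute_eq:
  assumes "reduced V" "reduced V'" "V \<noteq> []" "V' \<noteq> []" "V @ V' = V' @ V"
  shows "V = V'"
proof -
  obtain a b Z where Z: "concat (replicate a Z) = V" "concat (replicate b Z) = V'"
    using comm_append_are_replicate[OF assms(5)] by blast
  with assms have "Z \<noteq> []" "a \<noteq> 0" "b \<noteq> 0" by (auto intro: ccontr)
  with Z assms reduced_power_le_1[of a Z] reduced_power_le_1[of b Z] have "a = 1" "b = 1" by auto
  with Z show ?thesis by simp
qed

text \<open>Let W be the common power. Both V V' and V' V are prefixes of W W, and they have the
  same length.\<close>

lemma append_commute_of_power_eq: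
  assumes "concat (replicate k V) = concat (replicate l V')" "k \<ge> 1" "l \<ge> 1"
  shows "V @ V' = V' @ V"
proof -
  define W where "W = concat (replicate k V)"
  have W': "W = concat (replicate l V')" using assms by (simp add: W_def)
  have take_power: "\<exists>R. X @ Y @ R = W @ W"
    if "W = concat (replicate i X)" "W = concat (replicate j Y)" "i \<ge> 1" "j \<ge> 1" for X Y i j
  proof -
    obtain i' j' where ij: "i = Suc i'" "j = Suc j'" using \<open>i \<ge> 1\<close> \<open>j \<ge> 1\<close> by (metis Suc_le_D One_nat_def)
    have 1: "W = concat (replicate i' X) @ X"
      using that(1) ij concat_replicate_commute[of i' X] by simp
    have 2: "W = Y @ concat (replicate j' Y)" using that(2) ij by simp
    have "W @ W = W @ concat (replicate i' X) @ X" using 1 by simp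
    have "W @ X = X @ W" using that(1) concat_replicate_commute by metis
    have "W = X @ concat (replicate i' X)" using that(1) ij by simp
    then have "W @ W = W @ X @ concat (replicate i' X)" by simp
    also have "\<dots> = X @ W @ concat (replicate i' X)" using \<open>W @ X = X @ W\<close> by (metis append.assoc)
    also have "\<dots> = X @ Y @ concat (replicate j' Y) @ concat (replicate i' X)"
      by (subst 2) simp
    finally show ?thesis by metis
  qed
  obtain R R' where "V @ V' @ R = W @ W" "V' @ V @ R' = W @ W"
    using take_power[OF W_def W'] take_power[OF W' W_def] assms by metis
  then have "(V @ V') @ R = (V' @ V) @ R'" by (metis append.assoc)
  then show ?thesis by (subst (asm) append_eq_append_conv) auto
qed

text \<open>Makes the splitting of a word into base and exponent unambiguous, so that words can be
  counted by their roots in \<open>sum_words_by_root\<close>.\<close>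

lemma primitive_root_unique:
  assumes "reduced V" "reduced V'" "V \<noteq> []" "V' \<noteq> []" "k \<ge> 1" "l \<ge> 1"
    and "concat (replicate k V) = concat (replicate l V')"
  shows "V = V' \<and> k = l"
proof -
  have "V = V'"
    by (rule reduced_commute_eq[OF assms(1-4) append_commute_of_power_eq[OF assms(7,5,6)]])
  moreover have "k * length V = l * length V'"
    using assms(7) by (metis length_concat_replicate)
  ultimately show ?thesis using assms(3) by simp
qed

lemma primitive_root_exists:
  assumes "W \<noteq> []"
  shows "\<exists>V k. reduced V \<and> V \<noteq> [] \<and> k \<ge> 1 \<and> W = concat (replicate k V)"
  using assms
proof (induction "length W" arbitrary: W rule: less_induct)
  case less
  show ?case
  proof (cases "reduced W")
    case True
    then show ?thesis using less.prems by (intro exI[of _ W] exI[of _ 1]) auto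
  next
    case False
    then obtain U k where U: "k \<ge> 2" "length U < length W" "W = concat (replicate k U)"
      unfolding reduced_def by blast
    with less.prems have "U \<noteq> []" by auto
    then obtain V l where "reduced V" "V \<noteq> []" "l \<ge> 1" "U = concat (replicate l V)"
      using less.hyps U(2) by metis
    then show ?thesis using U
      by (intro exI[of _ V] exI[of _ "k * l"]) (auto simp: concat_replicate_mult)
  qed
qed

lemma cyc_rel_iff: "(U, V) \<in> cyc_rel \<longleftrightarrow> (\<exists>i. V = rotate i U)"
proof
  assume "(U, V) \<in> cyc_rel"
  then obtain A B where "U = A @ B" "V = B @ A" by (auto simp: cyc_rel_def)
  then show "\<exists>i. V = rotate i U" by (metis rotate_append)
next
  assume "\<exists>i. V = rotate i U"
  then obtain i where "V = rotate i U" by blast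
  then have "V = drop (i mod length U) U @ take (i mod length U) U" by (simp add: rotate_drop_take)
  then show "(U, V) \<in> cyc_rel" unfolding cyc_rel_def
    by (metis (mono_tags, lifting) append_take_drop_id case_prodI mem_Collect_eq)
qed

lemma cyc_class: "cyc_rel `` {U} = range (\<lambda>i. rotate i U)"
  by (auto simp: cyc_rel_iff)

lemma rotate_class_eq:
  "cyc_rel `` {rotate i U} = cyc_rel `` {U}"
proof -
  have "\<exists>j. rotate k U = rotate j (rotate i U)" for k
  proof -
    \<comment> \<open>Rotating by i and then by i * (length U - 1) makes i full turns, so this
      amount undoes \<open>rotate i\<close> before rotating by k.\<close>
    have "rotate (k + i * (length U - 1)) (rotate i U) = rotate (k + i * length U) U"
      by (cases "length U") (auto simp: rotate_rotate algebra_simps)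
    also have "\<dots> = rotate k U"
      by (metis add.commute mod_mult_self2 rotate_conv_mod mult.commute)
    finally show ?thesis by metis
  qed
  then show ?thesis unfolding cyc_class by (auto simp: rotate_rotate)
qed

text \<open>Rotating a power by one letter rotates its base by one letter. This is why reducedness
  depends only on the cyclic class.\<close>

lemma rotate_concat_replicate:
  "\<exists>U'. length U' = length U \<and> rotate i (concat (replicate k U)) = concat (replicate k U')"
proof (induction i)
  case 0
  then show ?case by auto
next
  case (Suc i)
  then obtain U' where U': "length U' = length U" "rotate i (concat (replicate k U)) = concat (replicate k U')"
    by blast
  have "rotate1 (concat (replicate k U')) = concat (replicate k (rotate1 U'))"
  proof (cases U')
    case (Cons x xs)
    have "concat (replicate l (x # xs)) @ [x] = x # concat (replicate l (xs @ [x]))" for l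
      by (induction l) auto
    then show ?thesis using Cons by (cases k) auto
  qed (simp add: concat_replicate_trivial)
  then show ?case using U' by (intro exI[of _ "rotate1 U'"]) simp
qed

lemma reduced_rotate: 
  assumes "reduced U" shows "reduced (rotate i U)"
proof (rule ccontr)
  assume "\<not> reduced (rotate i U)"
  then obtain U0 k where U0: "2 \<le> k" "length U0 < length U" "rotate i U = concat (replicate k U0)"
    unfolding reduced_def by auto
  obtain j where "U = rotate j (rotate i U)"
    using rotate_class_eq[of i U] cyc_class by (metis rangeE rangeI rotate0 id_apply)
  moreover obtain U' where "length U' = length U0" "rotate j (concat (replicate k U0)) = concat (replicate k U')"
    using rotate_concat_replicate by blast
  ultimately have "U = concat (replicate k U')" "length U' < length U" using U0 by auto
  with assms U0(1) show False unfolding reduced_def by blast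
qed

text \<open>Two equal rotations would split U into commuting non-empty pieces and make it a proper
  power. The class size is the factor |U| that the logarithmic derivative of 1 - z^U
  produces.\<close>

lemma card_cyc_class:
  assumes "reduced U" "U \<noteq> []"
  shows "finite (cyc_rel `` {U})" "card (cyc_rel `` {U}) = length U"
proof -
  have eq: "cyc_rel `` {U} = (\<lambda>i. rotate i U) ` {..<length U}"
    unfolding cyc_class using assms(2)
    by (auto simp: image_iff) (metis length_greater_0_conv lessThan_iff mod_less_divisor rotate_conv_mod)
  have neq: "rotate i U \<noteq> U" if "0 < i" "i < length U" for i
  proof
    assume "rotate i U = U"
    then have "drop i U @ take i U = take i U @ drop i U"
      using that by (simp add: rotate_drop_take)
    moreover have "take i U \<noteq> []" "drop i U \<noteq> []" using that by auto
    ultimately obtain k Z where "k > 1" "concat (replicate k Z) = U"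
      using comm_append_is_replicate[of "take i U" "drop i U"] by auto
    with assms reduced_power_le_1[of k Z] show False by (cases "Z = []") auto
  qed
  have "inj_on (\<lambda>i. rotate i U) {..<length U}"
  proof (rule linorder_inj_onI)
    fix i j assume ij: "i < j" "i \<in> {..<length U}" "j \<in> {..<length U}"
    show "rotate i U \<noteq> rotate j U"
    proof
      assume "rotate i U = rotate j U"
      then have "rotate (length U - i) (rotate i U) = rotate (length U - i) (rotate j U)" by simp
      then have "U = rotate (length U + (j - i)) U"
        using ij by (simp add: rotate_rotate)
      then have "U = rotate (j - i) U" by (metis mod_add_self1 rotate_conv_mod)
      moreover have "0 < j - i" "j - i < length U" using ij by auto
      ultimately show False using neq by metis
    qed
  qed auto
  then show "finite (cyc_rel `` {U})" "card (cyc_rel `` {U}) = length U"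
    unfolding eq by (auto simp: card_image)
qed

lemma spec_class [simp]: "spec (cyc_rel `` {U}) = mset U"
proof -
  have "mset (rotate i U) = mset U" for i
    by (metis append_take_drop_id mset_append rotate_drop_take union_commute)
  then have "mset ` (cyc_rel `` {U}) = {mset U}" unfolding cyc_class by (auto simp: image_image)
  then show ?thesis by (simp add: spec_def)
qed

lemma W0_E:
  assumes "c \<in> W0 s"
  obtains U where "c = cyc_rel `` {U}" "U \<noteq> []" "set U \<subseteq> {1..s}" "reduced U"
  using assms by (auto simp: W0_def quotient_def)

lemma W0_I: "U \<noteq> [] \<Longrightarrow> set U \<subseteq> {1..s} \<Longrightarrow> reduced U \<Longrightarrow> cyc_rel `` {U} \<in> W0 s"
  by (auto simp: W0_def quotient_def)

lemma W0_member:
  assumes "c \<in> W0 s" "V \<in> c"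
  shows "c = cyc_rel `` {V}" "V \<noteq> []" "set V \<subseteq> {1..s}" "reduced V"
proof -
  obtain U where U: "c = cyc_rel `` {U}" "U \<noteq> []" "set U \<subseteq> {1..s}" "reduced U"
    using assms(1) by (rule W0_E)
  then obtain i where V: "V = rotate i U" using assms(2) by (auto simp: cyc_class)
  show "c = cyc_rel `` {V}" "V \<noteq> []" "set V \<subseteq> {1..s}" "reduced V"
    using U V by (auto simp: rotate_class_eq reduced_rotate)
qed

lemma W0_card: "c \<in> W0 s \<Longrightarrow> finite c \<and> card c = size (spec c)"
  by (elim W0_E) (simp add: card_cyc_class)

lemma W0_spec: "c \<in> W0 s \<Longrightarrow> spec c \<in> Mon s"
  by (elim W0_E) (auto simp: Mon_def)

lemma spec_member: "c \<in> W0 s \<Longrightarrow> V \<in> c \<Longrightarrow> spec c = mset V"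
  using W0_member(1) spec_class by metis

text \<open>For s >= 2 there are infinitely many necklaces. Those whose content divides A are
  finitely many, and no others affect the coefficients at divisors of A, so all products can be
  taken finite.\<close>

definition W0_below :: "nat \<Rightarrow> nat multiset \<Rightarrow> nat list set set" where
  "W0_below s A = {U \<in> W0 s. spec U \<subseteq># A}"

lemma finite_words_below: "finite {W. mset W \<subseteq># A}"
proof -
  have "{W. mset W \<subseteq># A} \<subseteq> {W. set W \<subseteq> set_mset A \<and> length W \<le> size A}"
    by (auto dest: size_mset_mono mset_subset_eqD)
  then show ?thesis by (rule finite_subset) (simp add: finite_lists_length_le)
qed

lemma finite_W0_below: "finite (W0_below s A)"
proof -
  have "W0_below s A \<subseteq> (\<lambda>U. cyc_rel `` {U}) ` {W. mset W \<subseteq># A}"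
    by (auto simp: W0_below_def elim!: W0_E)
  then show ?thesis by (rule finite_subset) (intro finite_imageI finite_words_below)
qed

lemma finite_repeat_below:
  assumes "u \<noteq> {#}"
  shows "finite {k. repeat_mset k u \<subseteq># B}"
proof (rule finite_subset)
  show "{k. repeat_mset k u \<subseteq># B} \<subseteq> {..size B}"
  proof
    fix k assume "k \<in> {k. repeat_mset k u \<subseteq># B}"
    then have "k * size u \<le> size B" using size_mset_mono by fastforce
    moreover have "size u \<ge> 1" using assms by (cases u) auto
    ultimately show "k \<in> {..size B}"
      by (metis atMost_iff le_trans mult.right_neutral mult_le_mono2)
  qed
qed simp

text \<open>Each non-empty word is V^k for exactly one reduced V and one k >= 1, and the class U of
  V holds \<open>size (spec U)\<close> such V, all with the same content. This matches the sum over
  all words with the logarithmic derivatives of the factors 1 - z^U.\<close>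

lemma sum_words_by_root:
  fixes g :: "nat multiset \<Rightarrow> int"
  assumes "set_mset A \<subseteq> {1..s}" "B \<subseteq># A"
  shows "(\<Sum>W | W \<noteq> [] \<and> mset W \<subseteq># B. g (mset W)) =
    (\<Sum>U\<in>W0_below s A. \<Sum>k | 1 \<le> k \<and> repeat_mset k (spec U) \<subseteq># B.
       int (size (spec U)) * g (repeat_mset k (spec U)))"
proof -
  let ?K = "\<lambda>u. {k. 1 \<le> k \<and> repeat_mset k u \<subseteq># B}"
  have finK: "finite (?K u)" if "u \<noteq> {#}" for u
    using finite_repeat_below[OF that, of B] by (rule rev_finite_subset) auto
  have ne: "spec U \<noteq> {#}" if "U \<in> W0_below s A" for U
    using that W0_spec by (auto simp: W0_below_def Mon_def)
  have finU: "finite U" if "U \<in> W0_below s A" for U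
    using that W0_card by (auto simp: W0_below_def)
  have disj: "U = U'" if "U \<in> W0_below s A" "U' \<in> W0_below s A" "V \<in> U" "V \<in> U'" for U U' V
    using that W0_member(1) by (metis (no_types, lifting) W0_below_def mem_Collect_eq)
  have sub: "mset V \<subseteq># B" if "repeat_mset k (mset V) \<subseteq># B" "1 \<le> k" for k V
  proof -
    have "repeat_mset k (mset V) = mset V + repeat_mset (k - 1) (mset V)"
      using that(2) by (cases k) auto
    with that(1) show ?thesis by (metis mset_subset_eq_add_left subset_mset.trans)
  qed
  have mem: "cyc_rel `` {V} \<in> W0_below s A \<and> V \<in> cyc_rel `` {V}"
    if "reduced V" "V \<noteq> []" "mset V \<subseteq># B" for V
  proof -
    have "mset V \<subseteq># A" using that(3) assms(2) by (rule subset_mset.trans)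
    then have "set V \<subseteq> {1..s}" using assms(1) set_mset_mono by fastforce
    then have "cyc_rel `` {V} \<in> W0_below s A"
      using that \<open>mset V \<subseteq># A\<close> by (simp add: W0_below_def W0_I)
    moreover have "(V, V) \<in> cyc_rel" unfolding cyc_rel_iff by (rule exI[of _ 0]) simp
    ultimately show ?thesis by simp
  qed
  \<comment> \<open>Triples of a class, a representative in it and an exponent; V^k identifies them
    with the non-empty words.\<close>
  define T where "T = (SIGMA x : (SIGMA U : W0_below s A. U). ?K (mset (snd x)))"
  have "(\<Sum>U\<in>W0_below s A. \<Sum>k\<in>?K (spec U). int (size (spec U)) * g (repeat_mset k (spec U)))
      = (\<Sum>U\<in>W0_below s A. \<Sum>V\<in>U. \<Sum>k\<in>?K (mset V). g (repeat_mset k (mset V)))"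
  proof (rule sum.cong[OF refl])
    fix U assume U: "U \<in> W0_below s A"
    then have "U \<in> W0 s" by (simp add: W0_below_def)
    then have "(\<Sum>V\<in>U. \<Sum>k\<in>?K (mset V). g (repeat_mset k (mset V))) =
        (\<Sum>V\<in>U. \<Sum>k\<in>?K (spec U). g (repeat_mset k (spec U)))"
      by (intro sum.cong) (auto simp: spec_member)
    also have "\<dots> = (\<Sum>k\<in>?K (spec U). int (size (spec U)) * g (repeat_mset k (spec U)))"
      using W0_card[OF \<open>U \<in> W0 s\<close>] by (simp add: sum_distrib_left)
    finally show "(\<Sum>k\<in>?K (spec U). int (size (spec U)) * g (repeat_mset k (spec U))) =
      (\<Sum>V\<in>U. \<Sum>k\<in>?K (mset V). g (repeat_mset k (mset V)))" by simp
  qed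
  also have "\<dots> = (\<Sum>((U, V), k)\<in>T. g (repeat_mset k (mset V)))"
  proof -
    have "(\<Sum>U\<in>W0_below s A. \<Sum>V\<in>U. \<Sum>k\<in>?K (mset V). g (repeat_mset k (mset V))) =
        (\<Sum>(U, V)\<in>(SIGMA U : W0_below s A. U). \<Sum>k\<in>?K (mset V). g (repeat_mset k (mset V)))"
      using finite_W0_below finU by (intro sum.Sigma) auto
    also have "\<dots> = (\<Sum>x\<in>(SIGMA U : W0_below s A. U). \<Sum>k\<in>?K (mset (snd x)). g (repeat_mset k (mset (snd x))))"
      by (simp add: split_beta)
    also have "\<dots> = (\<Sum>(x, k)\<in>T. g (repeat_mset k (mset (snd x))))"
      unfolding T_def
    proof (rule sum.Sigma)
      show "finite (SIGMA U : W0_below s A. U)" using finite_W0_below finU by (intro finite_SigmaI)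
      show "\<forall>x\<in>(SIGMA U : W0_below s A. U). finite (?K (mset (snd x)))"
      proof
        fix x assume "x \<in> (SIGMA U : W0_below s A. U)"
        then have "snd x \<noteq> []" using W0_member(2) by (auto simp: W0_below_def)
        then show "finite (?K (mset (snd x)))" by (intro finK) simp
      qed
    qed
    finally show ?thesis by (simp add: split_beta)
  qed
  also have "\<dots> = (\<Sum>W | W \<noteq> [] \<and> mset W \<subseteq># B. g (mset W))"
  proof -
    let ?h = "\<lambda>x :: (nat list set \<times> nat list) \<times> nat. concat (replicate (snd x) (snd (fst x)))"
    have "bij_betw ?h T {W. W \<noteq> [] \<and> mset W \<subseteq># B}"
      unfolding bij_betw_def
    proof
      show "inj_on ?h T"
      proof (rule inj_onI)
        fix x y assume xy: "x \<in> T" "y \<in> T" "?h x = ?h y"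
        obtain U V k U' V' k' where [simp]: "x = ((U, V), k)" "y = ((U', V'), k')"
          by (metis surj_pair)
        have "U \<in> W0 s" "U' \<in> W0 s" "V \<in> U" "V' \<in> U'" "1 \<le> k" "1 \<le> k'"
          using xy by (auto simp: T_def W0_below_def)
        then have "V = V' \<and> k = k'"
          using xy(3) W0_member by (intro primitive_root_unique) auto
        moreover from this have "U = U'"
          using disj[of U U' V] xy by (auto simp: T_def)
        ultimately show "x = y" by simp
      qed
    next
      show "?h ` T = {W. W \<noteq> [] \<and> mset W \<subseteq># B}"
      proof safe
        fix W assume W: "W \<noteq> []" "mset W \<subseteq># B"
        obtain V k where V: "reduced V" "V \<noteq> []" "k \<ge> 1" "W = concat (replicate k V)"
          using primitive_root_exists[OF W(1)] by blast
        then have k: "repeat_mset k (mset V) \<subseteq># B" using W(2) by (simp add: mset_concat_replicate)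
        then have "((cyc_rel `` {V}, V), k) \<in> T"
          using mem[OF V(1,2) sub[OF k V(3)]] V(3) unfolding T_def by simp
        then show "W \<in> ?h ` T" by (rule rev_image_eqI) (simp add: V(4))
      next
        fix U V k assume "((U, V), k) \<in> T" "?h ((U, V), k) = []"
        then show False using W0_member(2)[of U s V] by (auto simp: T_def W0_below_def)
      next
        fix U V k assume "((U, V), k) \<in> T"
        then show "mset (?h ((U, V), k)) \<subseteq># B"
          by (auto simp: T_def mset_concat_replicate)
      qed
    qed
    from sum.reindex_bij_betw[OF this, of "\<lambda>W. g (mset W)"] show ?thesis
      by (simp add: mset_concat_replicate split_beta)
  qed
  finally show ?thesis by simp
qed

section \<open>The cyclotomic identity\<close>

definition content :: "nat list set set \<Rightarrow> nat multiset" where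
  "content F = (\<Sum>U\<in>F. spec U)"

text \<open>The coefficient of \<open>z\<^sup>B\<close> in the product of the \<open>1 - z\<^sup>U\<close> over the necklaces \<open>U\<close> outside \<open>X\<close>.\<close>

definition necklace_coeff :: "nat \<Rightarrow> nat multiset \<Rightarrow> nat list set set \<Rightarrow> nat multiset \<Rightarrow> int" where
  "necklace_coeff s A X B = (\<Sum>F | F \<subseteq> W0_below s A - X \<and> content F = B. (-1) ^ card F)"

lemma finite_subsets_W0_below: "finite {F. F \<subseteq> W0_below s A - X \<and> P F}"
  by (rule finite_subset[of _ "Pow (W0_below s A)"]) (auto simp: finite_W0_below)

lemma W0_below_spec_nonempty: "U \<in> W0_below s A \<Longrightarrow> spec U \<noteq> {#}"
  using W0_spec by (auto simp: W0_below_def Mon_def)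

text \<open>Deleting U from F lowers the content by \<open>spec U\<close> and flips the
  sign.\<close>

lemma necklace_sum_containing:
  assumes U: "U \<in> W0_below s A"
  shows "(\<Sum>F | F \<subseteq> W0_below s A \<and> content F = B \<and> U \<in> F. (-1) ^ card F) =
    (if spec U \<subseteq># B then - necklace_coeff s A {U} (B - spec U) else 0)"
proof -
  let ?L = "{F. F \<subseteq> W0_below s A \<and> content F = B \<and> U \<in> F}"
  have fin: "finite F" if "F \<subseteq> W0_below s A" for F using that finite_W0_below finite_subset by blast
  have content_insert: "content (insert U F) = spec U + content F" if "F \<subseteq> W0_below s A - {U}" for F
  proof -
    have "finite F" "U \<notin> F" using that fin[of F] by auto
    then show ?thesis by (simp add: content_def)
  qed
  show ?thesis
  proof (cases "spec U \<subseteq># B")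
    case True
    let ?R = "{F. F \<subseteq> W0_below s A - {U} \<and> content F = B - spec U}"
    have "bij_betw (insert U) ?R ?L"
    proof (rule bij_betw_byWitness[where f' = "\<lambda>F. F - {U}"])
      show "insert U ` ?R \<subseteq> ?L" using content_insert True U by auto
      show "(\<lambda>F. F - {U}) ` ?L \<subseteq> ?R"
      proof safe
        fix F assume F: "F \<subseteq> W0_below s A" "U \<in> F" "B = content F"
        then have "content (insert U (F - {U})) = spec U + content (F - {U})"
          by (intro content_insert) auto
        then show "content (F - {U}) = content F - spec U" using F by (simp add: insert_absorb)
      qed auto
    qed auto
    then have "(\<Sum>F\<in>?L. (-1) ^ card F) = (\<Sum>F\<in>?R. (-1 :: int) ^ card (insert U F))"
      by (rule sum.reindex_bij_betw[symmetric])
    also have "\<dots> = (\<Sum>F\<in>?R. - ((-1) ^ card F))"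
    proof (rule sum.cong[OF refl])
      fix F assume "F \<in> ?R"
      then have "finite F" "U \<notin> F" using fin[of F] by auto
      then show "(-1 :: int) ^ card (insert U F) = - ((-1) ^ card F)" by simp
    qed
    finally show ?thesis using True by (simp add: necklace_coeff_def sum_negf)
  next
    case False
    have "?L = {}"
    proof safe
      fix F assume "F \<subseteq> W0_below s A" "U \<in> F" "B = content F"
      then have "spec U \<subseteq># B" using fin[of F] by (auto simp: content_def sum.remove)
      with False show "F \<in> {}" by simp
    qed
    then have "(\<Sum>F\<in>?L. (-1 :: int) ^ card F) = 0" by (metis sum.empty)
    then show ?thesis using False by simp
  qed
qed

text \<open>Multiplication of the product without U by the factor 1 - z^U, read off at z^B.\<close>

lemma necklace_coeff_split:
  assumes "U \<in> W0_below s A"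
  shows "necklace_coeff s A {} B = necklace_coeff s A {U} B +
    (if spec U \<subseteq># B then - necklace_coeff s A {U} (B - spec U) else 0)"
proof -
  have "{F. F \<subseteq> W0_below s A - {} \<and> content F = B} =
     {F. F \<subseteq> W0_below s A - {U} \<and> content F = B} \<union> {F. F \<subseteq> W0_below s A \<and> content F = B \<and> U \<in> F}"
    by auto
  then have "necklace_coeff s A {} B = necklace_coeff s A {U} B +
     (\<Sum>F | F \<subseteq> W0_below s A \<and> content F = B \<and> U \<in> F. (-1) ^ card F)"
    unfolding necklace_coeff_def
    by (simp only:, subst sum.union_disjoint)
      (use finite_subsets_W0_below[of s A "{}"] finite_subsets_W0_below[of s A "{U}"] in auto)
  then show ?thesis using necklace_sum_containing[OF assms] by simp
qed

text \<open>Division by the factor of \<open>U\<close>, expanded as a geometric series.\<close>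

lemma necklace_coeff_remove:
  assumes U: "U \<in> W0_below s A"
  shows "necklace_coeff s A {U} B =
    (\<Sum>k | repeat_mset k (spec U) \<subseteq># B. necklace_coeff s A {} (B - repeat_mset k (spec U)))"
proof (induction "size B" arbitrary: B rule: less_induct)
  case less
  let ?K = "\<lambda>B. {k. repeat_mset k (spec U) \<subseteq># B}"
  let ?a = "necklace_coeff s A {}"
  have fin: "finite (?K B)" for B using finite_repeat_below[OF W0_below_spec_nonempty[OF U]] .
  show ?case
  proof (cases "spec U \<subseteq># B")
    case True
    have "size (B - spec U) < size B"
      using True W0_below_spec_nonempty[OF U] size_Diff_submset[OF True] size_mset_mono[OF True]
      by (cases "size (spec U)") auto
    note IH = less.hyps[OF this]
    have K: "?K B = insert 0 (Suc ` ?K (B - spec U))"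
    proof -
      have Suc_iff: "Suc k \<in> ?K B \<longleftrightarrow> k \<in> ?K (B - spec U)" for k
      proof -
        have "B = spec U + (B - spec U)" using True by simp
        then have "repeat_mset (Suc k) (spec U) \<subseteq># B \<longleftrightarrow> spec U + repeat_mset k (spec U) \<subseteq># spec U + (B - spec U)"
          by simp
        then show ?thesis by (simp only: mem_Collect_eq subset_mset.add_le_cancel_left)
      qed
      show ?thesis
      proof (rule Set.set_eqI)
        fix k show "k \<in> ?K B \<longleftrightarrow> k \<in> insert 0 (Suc ` ?K (B - spec U))"
        proof (cases k)
          case 0
          then show ?thesis by simp
        next
          case (Suc l)
          then show ?thesis
            by (simp only: Suc_iff insert_iff inj_image_mem_iff[OF inj_Suc] nat.distinct simp_thms)
        qed
      qed
    qed
    have "(\<Sum>k\<in>?K B. ?a (B - repeat_mset k (spec U))) =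
        ?a B + (\<Sum>k\<in>?K (B - spec U). ?a (B - repeat_mset (Suc k) (spec U)))"
      unfolding K using fin by (subst sum.insert) (auto simp: sum.reindex)
    also have "\<dots> = ?a B + necklace_coeff s A {U} (B - spec U)"
      unfolding IH by (simp add: diff_diff_add_mset)
    also have "\<dots> = necklace_coeff s A {U} B"
      using necklace_coeff_split[OF U, of B] True by simp
    finally show ?thesis by simp
  next
    case False
    have "?K B = {0}"
    proof -
      have "k = 0" if "k \<in> ?K B" for k
      proof (cases k)
        case (Suc l)
        then have "spec U \<subseteq># B" using that by (auto intro: subset_mset.trans[OF mset_subset_eq_add_left])
        with False show ?thesis by simp
      qed
      then show ?thesis by auto
    qed
    then show ?thesis using necklace_coeff_split[OF U, of B] False by simp
  qed
qed

text \<open>The Euler operator multiplies the coefficient at B by \<open>size B\<close>. Applied to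
  the product of the 1 - z^U it gives minus that product times the sum over U of |U| z^U / (1 -
  z^U), which by \<open>sum_words_by_root\<close> is the sum over all non-empty words.\<close>

lemma necklace_recursion:
  assumes A: "set_mset A \<subseteq> {1..s}" and B: "B \<subseteq># A"
  shows "int (size B) * necklace_coeff s A {} B =
    - (\<Sum>W | W \<noteq> [] \<and> mset W \<subseteq># B. necklace_coeff s A {} (B - mset W))"
proof -
  let ?a = "necklace_coeff s A {}"
  let ?\<F> = "{F. F \<subseteq> W0_below s A \<and> content F = B}"
  have fin: "finite ?\<F>" using finite_subsets_W0_below[of s A "{}"] by simp
  have "int (size B) * ?a B = (\<Sum>F\<in>?\<F>. int (size B) * (-1) ^ card F)"
    by (simp add: necklace_coeff_def sum_distrib_left)
  \<comment> \<open>The size of B is spread over the necklaces in F, whose contents add up to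
    B.\<close>
  also have "\<dots> = (\<Sum>F\<in>?\<F>. \<Sum>U\<in>{U \<in> W0_below s A. U \<in> F}. int (size (spec U)) * (-1) ^ card F)"
  proof (rule sum.cong[OF refl])
    fix F assume F: "F \<in> ?\<F>"
    then have "{U \<in> W0_below s A. U \<in> F} = F" by auto
    moreover have "int (size B) = (\<Sum>U\<in>F. int (size (spec U)))"
      using F by (auto simp: content_def size_multiset_sum)
    ultimately show "int (size B) * (-1) ^ card F =
        (\<Sum>U\<in>{U \<in> W0_below s A. U \<in> F}. int (size (spec U)) * (-1) ^ card F)"
      by (simp add: sum_distrib_right)
  qed
  also have "\<dots> = (\<Sum>U\<in>W0_below s A. \<Sum>F\<in>{F \<in> ?\<F>. U \<in> F}. int (size (spec U)) * (-1) ^ card F)"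
    by (rule sum.swap_restrict[OF fin finite_W0_below])
  also have "\<dots> = (\<Sum>U\<in>W0_below s A. int (size (spec U)) *
      (\<Sum>F | F \<subseteq> W0_below s A \<and> content F = B \<and> U \<in> F. (-1) ^ card F))"
    by (simp add: sum_distrib_left conj_assoc)
  \<comment> \<open>By the split, the inner sum is the full coefficient at B minus the one without
    U. Expanding the latter as a geometric series, its term k = 0 cancels the former.\<close>
  also have "\<dots> = - (\<Sum>U\<in>W0_below s A. \<Sum>k | 1 \<le> k \<and> repeat_mset k (spec U) \<subseteq># B.
      int (size (spec U)) * ?a (B - repeat_mset k (spec U)))"
    unfolding sum_negf[symmetric]
  proof (rule sum.cong[OF refl])
    fix U assume U: "U \<in> W0_below s A"
    let ?K = "{k. 1 \<le> k \<and> repeat_mset k (spec U) \<subseteq># B}"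
    have "(if spec U \<subseteq># B then - necklace_coeff s A {U} (B - spec U) else 0) =
      - (\<Sum>k\<in>?K. ?a (B - repeat_mset k (spec U)))"
    proof -
      have split: "{k. repeat_mset k (spec U) \<subseteq># B} = insert 0 ?K" by auto
      have "finite ?K" using finite_repeat_below[OF W0_below_spec_nonempty[OF U], of B]
        by (rule rev_finite_subset) auto
      then have "necklace_coeff s A {U} B = ?a B + (\<Sum>k\<in>?K. ?a (B - repeat_mset k (spec U)))"
        unfolding necklace_coeff_remove[OF U] split by (subst sum.insert) auto
      then show ?thesis using necklace_coeff_split[OF U, of B] by simp
    qed
    then show "int (size (spec U)) * (\<Sum>F | F \<subseteq> W0_below s A \<and> content F = B \<and> U \<in> F. (-1) ^ card F) =
       (\<Sum>k\<in>?K. - (int (size (spec U)) * ?a (B - repeat_mset k (spec U))))"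
      unfolding necklace_sum_containing[OF U] by (simp add: sum_distrib_left sum_negf)
  qed
  also have "\<dots> = - (\<Sum>W | W \<noteq> [] \<and> mset W \<subseteq># B. ?a (B - mset W))"
    using sum_words_by_root[OF A B, of "\<lambda>t. ?a (B - t)"] by simp
  finally show ?thesis .
qed

lemma necklace_coeff_empty: "necklace_coeff s A {} {#} = 1"
proof -
  have "F = {}" if "F \<subseteq> W0_below s A" "content F = {#}" for F
  proof (rule ccontr)
    assume "F \<noteq> {}"
    then obtain U where "U \<in> F" by blast
    moreover have "finite F" using that finite_W0_below finite_subset by blast
    ultimately have "content F = spec U + content (F - {U})" by (simp add: content_def sum.remove)
    then have "spec U = {#}" using that(2) by simp
    with that \<open>U \<in> F\<close> W0_below_spec_nonempty show False by auto
  qed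
  then have "{F. F \<subseteq> W0_below s A - {} \<and> content F = {#}} = {{}}" by (auto simp: content_def)
  then show ?thesis by (simp add: necklace_coeff_def)
qed

text \<open>The cyclotomic identity \<open>\<Prod>\<^sub>U (1 - z\<^sup>U) = 1 - (z\<^sub>1 + \<dots> + z\<^sub>s)\<close>, coefficient by coefficient.\<close>

lemma cyclotomic_identity:
  assumes A: "set_mset A \<subseteq> {1..s}" and B: "B \<subseteq># A"
  shows "necklace_coeff s A {} B = (if B = {#} then 1 else if size B = 1 then -1 else 0)"
  using B
proof (induction "size B" arbitrary: B rule: less_induct)
  case less
  let ?a = "necklace_coeff s A {}"
  let ?W = "{W. W \<noteq> [] \<and> mset W \<subseteq># B}"
  \<comment> \<open>By induction a word W contributes only if it uses all of B, with value 1, or all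
    but one letter of B, with value -1. The second kind must still be non-empty.\<close>
  let ?W1 = "{W. mset W = B}"
  let ?W2 = "{W. W \<noteq> [] \<and> mset W \<subseteq># B \<and> size B = Suc (length W)}"
  have fin: "finite ?W" using finite_words_below[of B] by (rule rev_finite_subset) auto
  show ?case
  proof (cases "B = {#}")
    case True
    then show ?thesis by (simp add: necklace_coeff_empty)
  next
    case False
    have sz: "size (B - mset W) = size B - length W" if "mset W \<subseteq># B" for W
      using size_Diff_submset[OF that] by simp
    have IH: "?a (B - mset W) = (if W \<in> ?W1 then 1 else 0) + (if W \<in> ?W2 then -1 else 0)"
      if "W \<in> ?W" for W
    proof -
      have W: "W \<noteq> []" "mset W \<subseteq># B" using that by auto
      have len: "length W \<le> size B" using size_mset_mono[OF W(2)] by simp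
      have "size (B - mset W) < size B" using sz[OF W(2)] W(1) False by (cases W) (auto simp: nonempty_has_size)
      then have "?a (B - mset W) = (if B - mset W = {#} then 1 else if size (B - mset W) = 1 then -1 else 0)"
        using less.prems W(2) by (intro less.hyps) (auto intro: subset_mset.trans diff_subset_eq_self)
      moreover have "B - mset W = {#} \<longleftrightarrow> mset W = B"
        using W(2) by (metis Diff_eq_empty_iff_mset subset_mset.antisym subset_mset.order_refl)
      moreover have "size (B - mset W) = 1 \<longleftrightarrow> size B = Suc (length W)" using sz[OF W(2)] len by auto
      moreover have "size B \<noteq> Suc (length W)" if "mset W = B" using that by auto
      ultimately show ?thesis using W by auto
    qed
    have "(\<Sum>W\<in>?W. ?a (B - mset W)) = (\<Sum>W\<in>?W. if W \<in> ?W1 then 1 else 0) + (\<Sum>W\<in>?W. if W \<in> ?W2 then -1 else 0)"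
      unfolding sum.distrib[symmetric] by (rule sum.cong[OF refl IH])
    also have "\<dots> = int (card (?W \<inter> ?W1)) - int (card (?W \<inter> ?W2))"
      using fin by (subst (1 2) sum.inter_restrict[symmetric]) auto
    also have "?W \<inter> ?W1 = ?W1" using False by auto
    also have "?W \<inter> ?W2 = ?W2" by auto
    finally have "int (size B) * ?a B = int (card ?W2) - int (card ?W1)"
      using necklace_recursion[OF A less.prems] by simp
    \<comment> \<open>Deleting the first letter is reversible, since the missing letter can be read
      off from B. For size 1 the shortened word would be empty and is not counted, which leaves the
      value -1.\<close>
    moreover have "card ?W1 = card ?W2" if "size B \<noteq> 1"
    proof (rule bij_betw_same_card[of tl], rule bij_betw_byWitness[where f' = "\<lambda>W. (THE b. B - mset W = {#b#}) # W"])
      have sz2: "size B \<ge> 2" using that False by (cases "size B") auto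
      show "\<forall>W\<in>?W1. (THE b. B - mset (tl W) = {#b#}) # tl W = W"
      proof
        fix W assume "W \<in> ?W1"
        with False obtain x V where "W = x # V" by (cases W) auto
        with \<open>W \<in> ?W1\<close> show "(THE b. B - mset (tl W) = {#b#}) # tl W = W" by auto
      qed
      show "\<forall>W\<in>?W2. tl ((THE b. B - mset W = {#b#}) # W) = W" by simp
      show "tl ` ?W1 \<subseteq> ?W2"
      proof safe
        fix W assume W: "B = mset W"
        with False obtain x V where "W = x # V" by (cases W) auto
        with W sz2 show "tl W = [] \<Longrightarrow> False" "mset (tl W) \<subseteq># mset W" "size (mset W) = Suc (length (tl W))"
          by auto
      qed
      show "(\<lambda>W. (THE b. B - mset W = {#b#}) # W) ` ?W2 \<subseteq> ?W1"
      proof safe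
        fix W assume W: "mset W \<subseteq># B" "size B = Suc (length W)"
        then have "size (B - mset W) = 1" using sz by simp
        then obtain b where b: "B - mset W = {#b#}" using size_1_singleton_mset by blast
        then have "B = add_mset b (mset W)" using subset_mset.diff_add[OF W(1)] by simp
        with b show "mset ((THE b. B - mset W = {#b#}) # W) = B" by simp
      qed
    qed
    moreover have "int (card ?W2) - int (card ?W1) = -1" if "size B = 1"
    proof -
      obtain b where b: "B = {#b#}" using \<open>size B = 1\<close> size_1_singleton_mset by blast
      have "?W1 = {[b]}" using b by auto
      moreover have "?W2 = {}" using b by auto
      ultimately show ?thesis by (simp only: card.empty) simp
    qed
    ultimately show ?thesis using False by (cases "size B = 1") auto
  qed
qed

section \<open>The image of the necklace relations\<close>

definition neck_msets :: "nat \<Rightarrow> nat multiset \<Rightarrow> nat list set multiset set" where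
  "neck_msets s A = {N. set_mset N \<subseteq> W0 s \<and> (\<Sum>U\<in>#N. spec U) = A}"

definition neck_term :: "nat \<Rightarrow> (nat \<Rightarrow> nat multiset) \<Rightarrow> nat list set multiset \<Rightarrow> 'k::comm_ring_1 epoly" where
  "neck_term n w N = (\<Prod>U\<in>set_mset N. e n (count N U) (subst_mon w (spec U)))"

text \<open>
  The sum defining \<open>S\<close>, indexed by multisets of necklaces instead of multisets of pairs; this
  absorbs the multiplicities \<open>C\<close>.
\<close>

definition neck_S :: "nat \<Rightarrow> nat \<Rightarrow> nat multiset \<Rightarrow> (nat \<Rightarrow> nat multiset) \<Rightarrow> 'k::comm_ring_1 epoly" where
  "neck_S n s A w = (\<Sum>N\<in>neck_msets s A. (-1) ^ (size A + size N) * neck_term n w N)"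

lemma sum_mset_eq_sum_repeat:
  assumes "finite X" "set_mset N \<subseteq> X"
  shows "(\<Sum>U\<in>#N. f U) = (\<Sum>U\<in>X. repeat_mset (count N U) (f U :: 'a multiset))"
  using assms(2)
proof (induction N)
  case (add x N)
  have "(\<Sum>U\<in>X. repeat_mset (count (add_mset x N) U) (f U)) =
      (\<Sum>U\<in>X. repeat_mset (count N U) (f U) + (if U = x then f x else {#}))"
    by (rule sum.cong) auto
  also have "\<dots> = (\<Sum>U\<in>X. repeat_mset (count N U) (f U)) + f x"
    using add.prems assms(1) by (simp add: sum.distrib)
  finally show ?case using add by simp
qed simp

lemma finite_submultisets: "finite {u. u \<subseteq># A}"
proof -
  have "{u. u \<subseteq># A} \<subseteq> mset ` {W. mset W \<subseteq># A}"
    by (metis (mono_tags, lifting) ex_mset image_eqI mem_Collect_eq subsetI)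
  then show ?thesis by (rule finite_subset) (intro finite_imageI finite_words_below)
qed

lemma finite_bounded_multisets:
  assumes "finite X"
  shows "finite {N. set_mset N \<subseteq> X \<and> size N \<le> k}"
proof -
  have "{N. set_mset N \<subseteq> X \<and> size N \<le> k} \<subseteq> mset ` {xs. set xs \<subseteq> X \<and> length xs \<le> k}"
  proof
    fix N assume N: "N \<in> {N. set_mset N \<subseteq> X \<and> size N \<le> k}"
    obtain xs where "mset xs = N" using ex_mset by blast
    with N show "N \<in> mset ` {xs. set xs \<subseteq> X \<and> length xs \<le> k}" by auto
  qed
  then show ?thesis by (rule finite_subset) (intro finite_imageI finite_lists_length_le assms)
qed

lemma size_le_size_sum_mset:
  assumes "\<And>x. x \<in># N \<Longrightarrow> f x \<noteq> {#}"
  shows "size N \<le> size (\<Sum>x\<in>#N. f x)"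
  using assms
proof (induction N)
  case (add x N)
  then have "1 \<le> size (f x)" by (simp add: Suc_le_eq nonempty_has_size)
  with add show ?case by simp
qed simp

lemma mem_subset_sum_mset: "x \<in># N \<Longrightarrow> f x \<subseteq># (\<Sum>x\<in>#N. f x :: 'a multiset)"
  by (induction N) (auto intro: subset_mset.order_trans mset_subset_eq_add_right)

lemma W0_spec_nonempty: "U \<in> W0 s \<Longrightarrow> spec U \<noteq> {#}"
  using W0_spec by (auto simp: Mon_def)

lemma neck_msets_size: "N \<in> neck_msets s A \<Longrightarrow> size N \<le> size A"
  using size_le_size_sum_mset[of N spec] W0_spec_nonempty by (auto simp: neck_msets_def)

lemma neck_msets_below: "N \<in> neck_msets s A \<Longrightarrow> set_mset N \<subseteq> W0_below s A"
  using mem_subset_sum_mset[of _ N spec] by (auto simp: neck_msets_def W0_below_def)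

lemma finite_neck_msets: "finite (neck_msets s A)"
  using finite_bounded_multisets[OF finite_W0_below[of s A], of "size A"]
  by (rule rev_finite_subset) (use neck_msets_size neck_msets_below in blast)

lemma finite_decomps: "finite (decomps s \<alpha>)"
proof -
  let ?A = "\<Sum>i=1..s. replicate_mset (\<alpha> i) i"
  have "P \<in> {P. set_mset P \<subseteq> {..size ?A} \<times> {u. u \<subseteq># ?A} \<and> size P \<le> size ?A}"
    if P: "P \<in> decomps s \<alpha>" for P
  proof -
    let ?f = "\<lambda>(r, u). repeat_mset r (u :: nat multiset)"
    have A: "?A = (\<Sum>x\<in>#P. ?f x)" using P by (simp add: decomps_def)
    have ne: "1 \<le> fst x \<and> snd x \<noteq> {#}" if "x \<in># P" for x
      using P that by (auto simp: decomps_def Mon_def)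
    have "x \<in> {..size ?A} \<times> {u. u \<subseteq># ?A}" if x: "x \<in># P" for x
    proof -
      obtain r u where ru: "x = (r, u)" by (cases x)
      have sub: "repeat_mset r u \<subseteq># ?A" using mem_subset_sum_mset[OF x, of ?f] A ru by simp
      have r: "1 \<le> r" "1 \<le> size u" using ne[OF x] ru by (auto simp: Suc_le_eq nonempty_has_size)
      have "r * 1 \<le> r * size u" using r by (intro mult_le_mono) auto
      also have "r * size u \<le> size ?A" using size_mset_mono[OF sub] by simp
      finally have "r \<le> size ?A" by simp
      moreover have "u \<subseteq># repeat_mset r u" using r(1) by (cases r) auto
      then have "u \<subseteq># ?A" using sub by (rule subset_mset.order_trans)
      ultimately show ?thesis using ru by simp
    qed
    moreover have "size P \<le> size ?A"
      unfolding A using ne by (intro size_le_size_sum_mset) (fastforce simp: repeat_mset_eq_empty_iff split_beta)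
    ultimately show ?thesis by auto
  qed
  then have "decomps s \<alpha> \<subseteq> {P. set_mset P \<subseteq> {..size ?A} \<times> {u. u \<subseteq># ?A} \<and> size P \<le> size ?A}" by blast
  then show ?thesis
    by (rule finite_subset) (intro finite_bounded_multisets finite_cartesian_product finite_submultisets finite_atMost)
qed

text \<open>\<open>C s P\<close> is the size of the fibre over P of the map from N to its multiset
  of pairs (multiplicity, specialization), and the summand depends on N only through this
  multiset.\<close>

lemma S_eq_neck_S:
  "(S n s \<alpha> w :: 'k::comm_ring_1 epoly) = neck_S n s (\<Sum>i=1..s. replicate_mset (\<alpha> i) i) w"
proof -
  let ?A = "\<Sum>i=1..s. replicate_mset (\<alpha> i) i"
  let ?f = "\<lambda>N :: nat list set multiset. image_mset (\<lambda>U. (count N U, spec U)) (mset_set (set_mset N))"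
  let ?t = "\<lambda>P. (-1) ^ (size ?A + (\<Sum>(r, u)\<in>#P. r)) * (\<Prod>(r, u)\<in>#P. e n r (subst_mon w u)) :: 'k epoly"
  have sum_f: "(\<Sum>(r, u)\<in>#?f N. repeat_mset r u) = (\<Sum>U\<in>#N. spec U)" for N
    by (subst sum_mset_eq_sum_repeat[of "set_mset N"])
      (simp_all add: image_mset.compositionality comp_def sum_unfold_sum_mset)
  have f_decomps: "?f N \<in> decomps s \<alpha>" if "N \<in> neck_msets s ?A" for N
    using that sum_f[of N] W0_spec by (auto simp: decomps_def neck_msets_def Suc_le_eq)
  have fibre: "{N. set_mset N \<subseteq> W0 s \<and> ?f N = P} = {N \<in> neck_msets s ?A. ?f N = P}"
    if "P \<in> decomps s \<alpha>" for P
    using that sum_f by (auto simp: decomps_def neck_msets_def)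
  have size_A: "size ?A = (\<Sum>i=1..s. \<alpha> i)" by (simp add: size_multiset_sum)
  have "S n s \<alpha> w = (\<Sum>P\<in>decomps s \<alpha>. of_nat (C s P) * ?t P)"
    unfolding S_def size_A by (rule sum.cong) (auto simp: mult_ac)
  also have "\<dots> = (\<Sum>P\<in>decomps s \<alpha>. \<Sum>N\<in>{N \<in> neck_msets s ?A. ?f N = P}. ?t (?f N))"
    by (rule sum.cong[OF refl]) (simp add: C_def fibre)
  also have "\<dots> = (\<Sum>N\<in>neck_msets s ?A. ?t (?f N))"
    using f_decomps by (intro sum.group finite_neck_msets finite_decomps) auto
  also have "\<dots> = neck_S n s ?A w"
    unfolding neck_S_def
  proof (rule sum.cong[OF refl])
    fix N
    have "(\<Sum>(r, u)\<in>#?f N. r) = size N"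
      by (simp add: image_mset.compositionality comp_def size_multiset_overloaded_eq sum_unfold_sum_mset)
    moreover have "(\<Prod>(r, u)\<in>#?f N. e n r (subst_mon w u)) = (neck_term n w N :: 'k epoly)"
      by (simp add: image_mset.compositionality comp_def neck_term_def prod_unfold_prod_mset)
    ultimately show "?t (?f N) = (-1) ^ (size ?A + size N) * neck_term n w N" by simp
  qed
  finally show ?thesis .
qed

text \<open>Congruence modulo the ideal of the monomials not dividing A. Put in terms of the keys of
  the difference, its compatibility with products is the ideal property.\<close>

definition agree_below :: "'v multiset \<Rightarrow> ('v multiset \<Rightarrow>\<^sub>0 'b::comm_ring_1) \<Rightarrow> ('v multiset \<Rightarrow>\<^sub>0 'b) \<Rightarrow> bool" where
  "agree_below A p q \<longleftrightarrow> (\<forall>t\<in>Poly_Mapping.keys (p - q). \<not> t \<subseteq># A)"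

lemma agree_below_iff:
  "agree_below A p q \<longleftrightarrow> (\<forall>B. B \<subseteq># A \<longrightarrow> Poly_Mapping.lookup p B = Poly_Mapping.lookup q B)"
  unfolding agree_below_def by (auto simp: in_keys_iff lookup_minus)

lemma agree_below_mult:
  assumes "agree_below A p p'" "agree_below A q q'"
  shows "agree_below A (p * q) (p' * q')"
  unfolding agree_below_def
proof
  fix t assume "t \<in> Poly_Mapping.keys (p * q - p' * q')"
  also have "p * q - p' * q' = (p - p') * q + p' * (q - q')" by (simp add: algebra_simps)
  finally have "t \<in> Poly_Mapping.keys ((p - p') * q) \<union> Poly_Mapping.keys (p' * (q - q'))"
    by (rule subsetD[OF keys_add])
  then obtain a b where ab: "t = a + b" "a \<in> Poly_Mapping.keys (p - p') \<or> b \<in> Poly_Mapping.keys (q - q')"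
    using keys_mult[of "p - p'" q] keys_mult[of p' "q - q'"] by blast
  have "a \<subseteq># A \<and> b \<subseteq># A" if "t \<subseteq># A"
    using that unfolding ab(1) by (blast intro: subset_mset.order_trans mset_subset_eq_add_left mset_subset_eq_add_right)
  with assms ab(2) show "\<not> t \<subseteq># A" unfolding agree_below_def by blast
qed

lemma agree_below_prod:
  "(\<And>x. x \<in> X \<Longrightarrow> agree_below A (f x) (g x)) \<Longrightarrow> agree_below A (prod f X) (prod g X)"
proof (induction X rule: infinite_finite_induct)
  case (insert x X)
  then show ?case by (simp add: agree_below_mult)
qed (simp_all add: agree_below_iff)

lemma prod_single:
  "(\<Prod>x\<in>X. Poly_Mapping.single (t x) (c x)) =
    Poly_Mapping.single (\<Sum>x\<in>X. t x :: 'v multiset) (\<Prod>x\<in>X. c x :: 'b::comm_ring_1)"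
  by (induction X rule: infinite_finite_induct) (auto simp: mult_single simp flip: single_one)

lemma lookup_times_const:
  "Poly_Mapping.lookup (Poly_Mapping.single {#} c * p) t = c * Poly_Mapping.lookup p t"
  for p :: "'v multiset \<Rightarrow>\<^sub>0 'b::comm_ring_1"
proof -
  have "Poly_Mapping.lookup (Poly_Mapping.single {#} c * p) t = Poly_Mapping.lookup (Poly_Mapping.map ((*) c) p) t"
    by (simp add: mult_map_scale_conv_mult)
  then show ?thesis by (simp add: map.rep_eq when_def)
qed

text \<open>The cyclotomic identity under z_i = - t_i y_i, with t_i the monomial
  \<open>{#i#}\<close>: the factor 1 - z^U becomes 1 + (-1)^(|U|+1) t^U y^U.\<close>

lemma necklace_product:
  fixes y :: "nat \<Rightarrow> 'b::comm_ring_1"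
  assumes A: "set_mset A \<subseteq> {1..s}"
  shows "agree_below A
    (\<Prod>U\<in>W0_below s A. 1 + Poly_Mapping.single (spec U) ((-1) ^ (size (spec U) + 1) * (\<Prod>i\<in>#spec U. y i)))
    (1 + (\<Sum>i=1..s. Poly_Mapping.single {#i#} (y i)))"
proof -
  let ?c = "\<lambda>U. (-1) ^ (size (spec U) + 1) * (\<Prod>i\<in>#spec U. y i)"
  let ?y = "\<lambda>B. \<Prod>i\<in>#B. y i"
  have c: "(\<Prod>U\<in>F. ?c U) = (-1) ^ (size (content F) + card F) * ?y (content F)" for F
    by (induction F rule: infinite_finite_induct)
      (auto simp: content_def power_add mult_ac)
  have "(\<Prod>U\<in>W0_below s A. 1 + Poly_Mapping.single (spec U) (?c U)) =
    (\<Sum>F\<in>Pow (W0_below s A). Poly_Mapping.single (content F) ((-1) ^ (size (content F) + card F) * ?y (content F)))"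
    by (subst add.commute, subst prod_add[OF finite_W0_below])
      (simp add: prod_single c[simplified] content_def[symmetric])
  also have "agree_below A \<dots> (1 + (\<Sum>i=1..s. Poly_Mapping.single {#i#} (y i)))"
    unfolding agree_below_iff
  proof safe
    fix B assume B: "B \<subseteq># A"
    have "Poly_Mapping.lookup (\<Sum>F\<in>Pow (W0_below s A).
        Poly_Mapping.single (content F) ((-1) ^ (size (content F) + card F) * ?y (content F))) B =
      (\<Sum>F\<in>Pow (W0_below s A). if content F = B then (-1) ^ (size B + card F) * ?y B else 0)"
      by (simp add: lookup_sum lookup_single when_def) (rule sum.cong, auto)
    also have "\<dots> = (\<Sum>F\<in>{F \<in> Pow (W0_below s A). content F = B}. (-1) ^ (size B + card F) * ?y B)"
      using finite_W0_below by (subst sum.inter_filter) auto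
    also have "\<dots> = (-1) ^ size B * ?y B * of_int (necklace_coeff s A {} B)"
      by (simp add: necklace_coeff_def sum_distrib_left power_add mult_ac)
    also have "\<dots> = Poly_Mapping.lookup (1 + (\<Sum>i=1..s. Poly_Mapping.single {#i#} (y i))) B"
    proof -
      consider "B = {#}" | b where "B = {#b#}" | "size B \<noteq> 1" "B \<noteq> {#}"
        using size_1_singleton_mset by metis
      then show ?thesis
      proof cases
        case 1
        then show ?thesis using cyclotomic_identity[OF A B]
          by (simp add: lookup_add lookup_one lookup_sum lookup_single)
      next
        case 2
        then have "b \<in> {1..s}" using A B by auto
        then show ?thesis using cyclotomic_identity[OF A B] 2
          by (simp add: lookup_add lookup_one lookup_sum lookup_single when_def)
      next
        case 3
        then have "{#i#} \<noteq> B" for i by auto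
        with 3 show ?thesis using cyclotomic_identity[OF A B]
          by (simp add: lookup_add lookup_one lookup_sum lookup_single when_def)
      qed
    qed
    finally show "Poly_Mapping.lookup (\<Sum>F\<in>Pow (W0_below s A).
        Poly_Mapping.single (content F) ((-1) ^ (size (content F) + card F) * ?y (content F))) B =
       Poly_Mapping.lookup (1 + (\<Sum>i=1..s. Poly_Mapping.single {#i#} (y i))) B" .
  qed
  finally show ?thesis .
qed

lemma sigma_gt: "r > n \<Longrightarrow> sigma n r w = 0"
proof -
  assume "r > n"
  have "card J \<noteq> r" if "J \<subseteq> {1..n}" for J using that \<open>r > n\<close> card_mono[of "{1..n}" J] by simp
  then have "{J. J \<subseteq> {1..n} \<and> card J = r} = {}" by blast
  then show ?thesis unfolding sigma_def by (metis sum.empty)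
qed

lemma sigma_0: "sigma n 0 w = 1"
proof -
  have "{J. J \<subseteq> {1..n} \<and> card J = 0} = {{}}" by (auto dest: finite_subset)
  then show ?thesis by (simp add: sigma_def)
qed

lemma phi_e_all: "phi n (e n r w) = (sigma n r w :: (nat \<times> nat, 'k::comm_ring_1) mpoly)"
proof (cases "r \<le> n")
  case False
  have "phi n (0 :: 'k epoly) = 0" by (simp add: phi_def peval_def)
  with False show ?thesis by (simp add: e_def sigma_gt)
qed (simp add: phi_e)

lemma phi_hom:
  fixes p q :: "'k::comm_ring_1 epoly" and f :: "'x \<Rightarrow> 'k epoly"
  shows "phi n 0 = (0 :: (nat \<times> nat, 'k) mpoly)" "phi n 1 = (1 :: (nat \<times> nat, 'k) mpoly)"
    "phi n (- p) = - phi n p"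
    "phi n (p ^ k) = phi n p ^ k" "phi n (of_nat k) = (of_nat k :: (nat \<times> nat, 'k) mpoly)"
    "phi n (sum f X) = (\<Sum>x\<in>X. phi n (f x))" "phi n (prod f X) = (\<Prod>x\<in>X. phi n (f x))"
    "phi n (\<Prod>x\<in>#N. f x) = (\<Prod>x\<in>#N. phi n (f x))"
proof -
  show 0: "phi n 0 = (0 :: (nat \<times> nat, 'k) mpoly)" by (simp add: phi_def peval_def)
  show 1: "phi n 1 = (1 :: (nat \<times> nat, 'k) mpoly)" using phi_simps(3)[of n 1] by simp
  have "phi n p + phi n (- p) = 0" unfolding phi_simps(1)[symmetric] by (simp add: 0)
  then show "phi n (- p) = - phi n p" by (simp add: add_eq_0_iff)
  show "phi n (p ^ k) = phi n p ^ k" by (induction k) (auto simp: 1 phi_simps)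
  show "phi n (of_nat k) = (of_nat k :: (nat \<times> nat, 'k) mpoly)" by (induction k) (auto simp: 0 1 phi_simps)
  show "phi n (sum f X) = (\<Sum>x\<in>X. phi n (f x))"
    by (induction X rule: infinite_finite_induct) (auto simp: 0 phi_simps)
  show "phi n (prod f X) = (\<Prod>x\<in>X. phi n (f x))"
    by (induction X rule: infinite_finite_induct) (auto simp: 1 phi_simps)
  show "phi n (\<Prod>x\<in>#N. f x) = (\<Prod>x\<in>#N. phi n (f x))"
    by (induction N) (auto simp: 1 phi_simps)
qed

lemma place_simps [simp]: "place j {#} = {#}" "place j (u + v) = place j u + place j v"
  by (simp_all add: place_def)

lemma pmon_simps [simp]: "pmon {#} = 1" "pmon (u + v) = pmon u * pmon v"
  by (simp_all add: pmon_def mult_single flip: single_one)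

lemma subst_mon_simps [simp]: "subst_mon w {#} = {#}" "subst_mon w (u + v) = subst_mon w u + subst_mon w v"
  "subst_mon w {#i#} = w i"
  by (simp_all add: subst_mon_def)

lemma pmon_place_subst:
  "pmon (place j (subst_mon w u)) = (\<Prod>i\<in>#u. pmon (place j (w i)))"
  by (induction u) (auto simp: subst_mon_def)

text \<open>Terms with r > n vanish. A bound M beyond n lets one range of exponents cover all
  multiplicities that occur in \<open>neck_msets\<close>.\<close>

lemma prod_one_plus_single:
  fixes v :: "nat multiset" and u :: "nat multiset" and c :: "(nat \<times> nat, 'k::comm_ring_1) mpoly"
  assumes "n \<le> M"
  shows "(\<Prod>j=1..n. 1 + Poly_Mapping.single u (c * pmon (place j v))) =
    (\<Sum>r\<le>M. Poly_Mapping.single (repeat_mset r u) (c ^ r * sigma n r v))"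
proof -
  have "(\<Prod>j=1..n. 1 + Poly_Mapping.single u (c * pmon (place j v))) =
    (\<Sum>J\<in>Pow {1..n}. Poly_Mapping.single (repeat_mset (card J) u) (c ^ card J * (\<Prod>j\<in>J. pmon (place j v))))"
  proof -
    have rep: "(\<Sum>j\<in>J. u) = repeat_mset (card J) u" for J :: "nat set"
      by (induction J rule: infinite_finite_induct) auto
    show ?thesis
      by (subst add.commute, subst prod_add) (simp_all add: prod_single rep prod.distrib)
  qed
  also have "\<dots> = (\<Sum>r\<le>M. \<Sum>J\<in>{J \<in> Pow {1..n}. card J = r}.
      Poly_Mapping.single (repeat_mset (card J) u) (c ^ card J * (\<Prod>j\<in>J. pmon (place j v))))"
  proof (rule sum.group[symmetric])
    show "card ` Pow {1..n} \<subseteq> {..M}"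
    proof safe
      fix J assume "J \<subseteq> {1..n}"
      then have "card J \<le> n" using card_mono[of "{1..n}" J] by simp
      then show "card J \<le> M" using assms by simp
    qed
  qed auto
  also have "\<dots> = (\<Sum>r\<le>M. Poly_Mapping.single (repeat_mset r u) (c ^ r * sigma n r v))"
  proof (rule sum.cong[OF refl])
    fix r
    have single_sum: "Poly_Mapping.single t (\<Sum>x\<in>X. f x) = (\<Sum>x\<in>X. Poly_Mapping.single t (f x))"
      for t :: "nat multiset" and f :: "nat set \<Rightarrow> (nat \<times> nat, 'k) mpoly" and X
      by (induction X rule: infinite_finite_induct) (auto simp: single_add)
    show "(\<Sum>J\<in>{J \<in> Pow {1..n}. card J = r}.
        Poly_Mapping.single (repeat_mset (card J) u) (c ^ card J * (\<Prod>j\<in>J. pmon (place j v)))) =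
      Poly_Mapping.single (repeat_mset r u) (c ^ r * sigma n r v)"
      by (simp add: sigma_def sum_distrib_left single_sum Pow_def)
  qed
  finally show ?thesis .
qed

text \<open>At a fixed place j the necklace product collapses to 1 plus the sum of the t_i times w_i
  at j. After exchanging the products over j and U, the necklace U contributes the sum over r of +-
  t^(rU) sigma_r(u(w)), with u = \<open>spec U\<close>. The two readings are compared at
  t^A.\<close>

lemma phi_neck_S:
  assumes A: "set_mset A \<subseteq> {1..s}"
  shows "phi n (neck_S n s A w :: 'k::comm_ring_1 epoly) =
    Poly_Mapping.lookup (\<Prod>j=1..n. 1 + (\<Sum>i=1..s. Poly_Mapping.single {#i#} (pmon (place j (w i))))) A"
    (is "_ = Poly_Mapping.lookup ?R A")
proof -
  let ?WF = "W0_below s A"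
  let ?M = "n + size A"
  let ?sg = "\<lambda>U. (-1) ^ (size (spec U) + 1) :: (nat \<times> nat, 'k) mpoly"
  let ?v = "\<lambda>U. subst_mon w (spec U)"
  let ?L = "\<Prod>j=1..n. \<Prod>U\<in>?WF. 1 + Poly_Mapping.single (spec U) (?sg U * pmon (place j (?v U)))"
  have "agree_below A ?L ?R"
    using necklace_product[OF A, of "\<lambda>i. pmon (place _ (w i))"]
    by (intro agree_below_prod) (simp add: pmon_place_subst)
  then have "Poly_Mapping.lookup ?R A = Poly_Mapping.lookup ?L A" by (simp add: agree_below_iff)
  also have "?L = (\<Prod>U\<in>?WF. \<Prod>j=1..n. 1 + Poly_Mapping.single (spec U) (?sg U * pmon (place j (?v U))))"
    by (rule prod.swap)
  also have "\<dots> = (\<Prod>U\<in>?WF. \<Sum>r\<in>{..?M}. Poly_Mapping.single (repeat_mset r (spec U)) (?sg U ^ r * sigma n r (?v U)))"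
    by (intro prod.cong refl prod_one_plus_single) simp
  also have "\<dots> = (\<Sum>\<rho>\<in>PiE ?WF (\<lambda>_. {..?M}). \<Prod>U\<in>?WF.
      Poly_Mapping.single (repeat_mset (\<rho> U) (spec U)) (?sg U ^ \<rho> U * sigma n (\<rho> U) (?v U)))"
    by (rule prod_sum_PiE) (auto simp: finite_W0_below)
  also have "Poly_Mapping.lookup \<dots> A =
     (\<Sum>\<rho>\<in>PiE ?WF (\<lambda>_. {..?M}). if (\<Sum>U\<in>?WF. repeat_mset (\<rho> U) (spec U)) = A
        then \<Prod>U\<in>?WF. ?sg U ^ \<rho> U * sigma n (\<rho> U) (?v U) else 0)"
    by (simp only: lookup_sum prod_single lookup_single when_def)
  also have "\<dots> = (\<Sum>\<rho>\<in>{\<rho> \<in> PiE ?WF (\<lambda>_. {..?M}). (\<Sum>U\<in>?WF. repeat_mset (\<rho> U) (spec U)) = A}.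
      \<Prod>U\<in>?WF. ?sg U ^ \<rho> U * sigma n (\<rho> U) (?v U))"
    by (subst sum.inter_filter) (auto simp: finite_W0_below intro: finite_PiE)
  \<comment> \<open>A choice of one exponent per necklace is a multiset of necklaces with these
    multiplicities.\<close>
  also have "\<dots> = (\<Sum>N\<in>neck_msets s A. \<Prod>U\<in>?WF. ?sg U ^ count N U * sigma n (count N U) (?v U))"
  proof (rule sum.reindex_bij_witness[where i = "\<lambda>N. restrict (count N) ?WF"
        and j = "\<lambda>\<rho>. \<Sum>U\<in>?WF. replicate_mset (\<rho> U) U"])
    fix N assume N: "N \<in> neck_msets s A"
    then have sub: "set_mset N \<subseteq> ?WF" by (rule neck_msets_below)
    have "(\<Sum>U\<in>?WF. replicate_mset (count N U) U) = (\<Sum>U\<in>#N. {#U#})"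
      using sum_mset_eq_sum_repeat[OF finite_W0_below sub, of "\<lambda>U. {#U#}"] by simp
    then show "(\<Sum>U\<in>?WF. replicate_mset (restrict (count N) ?WF U) U) = N" by simp
    have "count N U \<le> ?M" for U
      using neck_msets_size[OF N] count_le_size[of N U] by simp
    then show "restrict (count N) ?WF \<in> {\<rho> \<in> PiE ?WF (\<lambda>_. {..?M}). (\<Sum>U\<in>?WF. repeat_mset (\<rho> U) (spec U)) = A}"
      using N sum_mset_eq_sum_repeat[OF finite_W0_below sub, of spec]
      by (auto simp: neck_msets_def)
  next
    fix \<rho> assume \<rho>: "\<rho> \<in> {\<rho> \<in> PiE ?WF (\<lambda>_. {..?M}). (\<Sum>U\<in>?WF. repeat_mset (\<rho> U) (spec U)) = A}"
    let ?N = "\<Sum>U\<in>?WF. replicate_mset (\<rho> U) U"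
    have cnt: "count ?N U = (if U \<in> ?WF then \<rho> U else 0)" for U
      by (simp add: count_sum finite_W0_below)
    have sub: "set_mset ?N \<subseteq> ?WF"
    proof
      fix U assume "U \<in># ?N"
      then have "count ?N U \<noteq> 0" by (simp only: count_eq_zero_iff not_not)
      then show "U \<in> ?WF" unfolding cnt by metis
    qed
    have "\<rho> \<in> extensional ?WF" using \<rho> by (simp add: PiE_def)
    then show "restrict (count ?N) ?WF = \<rho>"
      by (rule extensionalityI[OF restrict_extensional]) (simp only: restrict_apply cnt if_True)
    have "(\<Sum>U\<in>#?N. spec U) = (\<Sum>U\<in>?WF. repeat_mset (count ?N U) (spec U))"
      by (rule sum_mset_eq_sum_repeat[OF finite_W0_below sub])
    also have "\<dots> = (\<Sum>U\<in>?WF. repeat_mset (\<rho> U) (spec U))"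
      by (rule sum.cong) (simp_all only: cnt if_True)
    finally have "(\<Sum>U\<in>#?N. spec U) = (\<Sum>U\<in>?WF. repeat_mset (\<rho> U) (spec U))" .
    moreover have "set_mset ?N \<subseteq> W0 s" using sub unfolding W0_below_def by blast
    ultimately show "?N \<in> neck_msets s A" using \<rho> by (simp add: neck_msets_def)
    show "(\<Prod>U\<in>?WF. ?sg U ^ count ?N U * sigma n (count ?N U) (?v U)) = (\<Prod>U\<in>?WF. ?sg U ^ \<rho> U * sigma n (\<rho> U) (?v U))"
      by (rule prod.cong) (simp_all only: cnt if_True)
  qed
  also have "\<dots> = (\<Sum>N\<in>neck_msets s A. (-1) ^ (size A + size N) * (\<Prod>U\<in>set_mset N. sigma n (count N U) (?v U)))"
  proof (rule sum.cong[OF refl])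
    fix N assume N: "N \<in> neck_msets s A"
    then have sub: "set_mset N \<subseteq> ?WF" by (rule neck_msets_below)
    have "(\<Prod>U\<in>?WF. ?sg U ^ count N U) = (-1) ^ (\<Sum>U\<in>?WF. (size (spec U) + 1) * count N U)"
      by (simp only: power_mult[symmetric] power_sum)
    \<comment> \<open>The lengths add up to \<open>size A\<close> and the summands 1 to
      \<open>size N\<close>, which is the sign in \<open>neck_S\<close>.\<close>
    also have "(\<Sum>U\<in>?WF. (size (spec U) + 1) * count N U) = size A + size N"
    proof -
      have "size A = (\<Sum>U\<in>?WF. count N U * size (spec U))"
      proof -
        have "A = (\<Sum>U\<in>?WF. repeat_mset (count N U) (spec U))"
          using N sum_mset_eq_sum_repeat[OF finite_W0_below sub, of spec] by (simp add: neck_msets_def)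
        then have "size A = size (\<Sum>U\<in>?WF. repeat_mset (count N U) (spec U))" by (rule arg_cong)
        then show ?thesis by simp
      qed
      moreover have "size N = (\<Sum>U\<in>?WF. count N U)"
        unfolding size_multiset_overloaded_eq using sub
        by (intro sum.mono_neutral_left) (auto simp: finite_W0_below count_eq_zero_iff)
      ultimately show ?thesis by (simp add: sum.distrib algebra_simps)
    qed
    finally have sg: "(\<Prod>U\<in>?WF. ?sg U ^ count N U) = (-1) ^ (size A + size N)" .
    have "(\<Prod>U\<in>?WF. sigma n (count N U) (?v U)) =
        (\<Prod>U\<in>set_mset N. sigma n (count N U) (?v U) :: (nat \<times> nat, 'k) mpoly)"
      using sub by (intro prod.mono_neutral_right) (auto simp: finite_W0_below not_in_iff sigma_0)
    with sg show "(\<Prod>U\<in>?WF. ?sg U ^ count N U * sigma n (count N U) (?v U)) =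
        (-1) ^ (size A + size N) * (\<Prod>U\<in>set_mset N. sigma n (count N U) (?v U))"
      by (simp add: prod.distrib)
  qed
  also have "\<dots> = phi n (neck_S n s A w)"
    by (simp add: neck_S_def neck_term_def phi_hom phi_simps phi_e_all)
  finally show ?thesis by simp
qed


text \<open>The generating product has n factors, each of degree at most 1 in the t_i.\<close>

lemma phi_neck_S_eq_0:
  assumes A: "set_mset A \<subseteq> {1..s}" and "size A > n"
  shows "phi n (neck_S n s A w) = (0 :: (nat \<times> nat, 'k::comm_ring_1) mpoly)"
proof -
  let ?P = "\<lambda>j. 1 + (\<Sum>i=1..s. Poly_Mapping.single {#i#} (pmon (place j (w i)))) :: nat multiset \<Rightarrow>\<^sub>0 (nat \<times> nat, 'k) mpoly"
  have 1: "size t \<le> 1" if "t \<in> Poly_Mapping.keys (?P j)" for t j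
  proof (rule ccontr)
    assume "\<not> size t \<le> 1"
    then have "t \<noteq> {#}" "{#i#} \<noteq> t" for i by auto
    then have "Poly_Mapping.lookup (?P j) t = 0"
      by (simp add: lookup_add lookup_one lookup_sum lookup_single when_def)
    with that show False by (simp add: in_keys_iff)
  qed
  have keys: "\<forall>t\<in>Poly_Mapping.keys (\<Prod>j\<in>J. ?P j). size t \<le> card J" if "finite J" for J
    using that
  proof (induction J)
    case (insert j J)
    show ?case
    proof
      fix t assume "t \<in> Poly_Mapping.keys (\<Prod>j\<in>insert j J. ?P j)"
      then have "t \<in> Poly_Mapping.keys (?P j * (\<Prod>j\<in>J. ?P j))"
        unfolding prod.insert[OF insert.hyps] .
      then obtain a b where "t = a + b" "a \<in> Poly_Mapping.keys (?P j)" "b \<in> Poly_Mapping.keys (\<Prod>j\<in>J. ?P j)"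
        by (rule subsetD[OF keys_mult, THEN CollectE]) blast
      moreover from this have "size a \<le> 1" "size b \<le> card J" using 1 insert.IH by blast+
      ultimately show "size t \<le> card (insert j J)" using insert.hyps by simp
    qed
  qed simp
  have "A \<notin> Poly_Mapping.keys (\<Prod>j=1..n. ?P j)" using keys[of "{1..n}"] assms(2) by auto
  then show ?thesis unfolding phi_neck_S[OF A] by (simp only: in_keys_iff not_not)
qed

text \<open>With equal monomials the generating product is that of the 1 + (t_1 + t_2) v_j, i.e. the
  sum of the (t_1 + t_2)^r sigma_r(v); the binomial theorem extracts the coefficient.\<close>

lemma phi_neck_S_same:
  "phi n (neck_S n 2 (replicate_mset a 1 + replicate_mset b 2) (\<lambda>_. v)) =
    of_nat ((a + b) choose a) * (sigma n (a + b) v :: (nat \<times> nat, 'k::comm_ring_1) mpoly)"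
proof -
  let ?A = "replicate_mset a 1 + replicate_mset b (2 :: nat)"
  define T :: "nat \<Rightarrow> nat multiset \<Rightarrow>\<^sub>0 (nat \<times> nat, 'k) mpoly" where "T i = Poly_Mapping.single {#i#} 1" for i
  define X where "X = T 1 + T 2"
  let ?y = "\<lambda>j. pmon (place j v) :: (nat \<times> nat, 'k) mpoly"
  have fac: "(\<Sum>i=1..2. Poly_Mapping.single {#i#} (?y j)) = Poly_Mapping.single {#} (?y j) * X" for j
    by (simp add: X_def T_def mult_single distrib_left numeral_2_eq_2)
  have T_pow: "T i ^ k = Poly_Mapping.single (replicate_mset k i) 1" for i k
    by (induction k) (auto simp: T_def mult_single)
  have lookup_X: "Poly_Mapping.lookup (X ^ r) ?A = (if r = a + b then of_nat ((a + b) choose a) else 0)" for r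
  proof -
    have sgl: "of_nat c * Poly_Mapping.single t 1 = Poly_Mapping.single t (of_nat c :: (nat \<times> nat, 'k) mpoly)"
      for c and t :: "nat multiset"
      by (simp add: mult_single flip: single_of_nat)
    have eqA: "replicate_mset k 1 + replicate_mset (r - k) 2 = ?A \<longleftrightarrow> k = a \<and> r - k = b" for k
    proof
      assume "replicate_mset k 1 + replicate_mset (r - k) 2 = ?A"
      from arg_cong[OF this, of "\<lambda>M. count M 1"] arg_cong[OF this, of "\<lambda>M. count M 2"]
      show "k = a \<and> r - k = b" by simp
    qed auto
    have "X ^ r = (\<Sum>k\<le>r. Poly_Mapping.single (replicate_mset k 1 + replicate_mset (r - k) 2) (of_nat (r choose k)))"
      unfolding X_def binomial_ring T_pow by (simp add: mult_single sgl mult.assoc)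
    then have "Poly_Mapping.lookup (X ^ r) ?A = (\<Sum>k\<le>r. if k = a \<and> r - k = b then of_nat (r choose k) else 0)"
      by (simp add: lookup_sum lookup_single when_def eqA[unfolded One_nat_def])
    also have "\<dots> = (\<Sum>k\<le>r. if k = a then (if r - a = b then of_nat (r choose a) else 0) else 0)"
      by (rule sum.cong) auto
    also have "\<dots> = (if r = a + b then of_nat ((a + b) choose a) else 0)"
      by auto
    finally show ?thesis .
  qed
  have "phi n (neck_S n 2 ?A (\<lambda>_. v)) = Poly_Mapping.lookup (\<Prod>j=1..n. 1 + Poly_Mapping.single {#} (?y j) * X) ?A"
    by (subst phi_neck_S) (auto simp only: fac, auto split: if_splits)
  also have "(\<Prod>j=1..n. 1 + Poly_Mapping.single {#} (?y j) * X) =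
    (\<Sum>J\<in>Pow {1..n}. Poly_Mapping.single {#} (\<Prod>j\<in>J. ?y j) * X ^ card J)"
    by (subst add.commute, subst prod_add) (simp_all add: prod.distrib prod_single)
  also have "Poly_Mapping.lookup \<dots> ?A =
     (\<Sum>J\<in>Pow {1..n}. if card J = a + b then of_nat ((a + b) choose a) * (\<Prod>j\<in>J. ?y j) else 0)"
    by (simp only: lookup_sum lookup_times_const lookup_X) (rule sum.cong, auto)
  also have "\<dots> = (\<Sum>J\<in>{J \<in> Pow {1..n}. card J = a + b}. of_nat ((a + b) choose a) * (\<Prod>j\<in>J. ?y j))"
    by (subst sum.inter_filter) auto
  also have "\<dots> = of_nat ((a + b) choose a) * sigma n (a + b) v"
    by (simp add: sigma_def sum_distrib_left Pow_def)
  finally show ?thesis .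
qed

section \<open>Symmetric polynomials in the values of one monomial\<close>

lemma pvars_simps: "pvars 0 = {}" "pvars 1 = {}" "pvars (- p) = pvars p" "pvars (pconst c) = {}"
  "pvars (pmon t :: ('v, 'k::comm_ring_1) mpoly) \<subseteq> set_mset t"
  using pvars_single[of t "1 :: 'k"] by (auto simp: pvars_def pconst_def pmon_def)

lemma pvars_sum_le: "(\<And>x. x \<in> X \<Longrightarrow> pvars (f x) \<subseteq> V) \<Longrightarrow> pvars (sum f X) \<subseteq> V"
proof (induction X rule: infinite_finite_induct)
  case (insert x X)
  then show ?case using pvars_add[of "f x" "sum f X"] by auto
qed (auto simp: pvars_simps)

text \<open>A linear grading takes the place of a monomial order. The weight n + 1 - j is positive
  on the places 1..n and decreases with j, so sigma_r(w) has a single heaviest monomial, the one on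
  the places 1..r.\<close>

definition place_wt :: "nat \<Rightarrow> (nat \<times> nat) multiset \<Rightarrow> nat" where
  "place_wt n t = (\<Sum>(i, j)\<in>#t. n + 1 - j)"

lemma place_wt_simps [simp]: "place_wt n {#} = 0" "place_wt n (s + t) = place_wt n s + place_wt n t"
  "place_wt n (add_mset x t) = n + 1 - snd x + place_wt n t"
  by (simp_all add: place_wt_def split_beta)

lemma place_wt_sum: "place_wt n (\<Sum>x\<in>X. f x) = (\<Sum>x\<in>X. place_wt n (f x))"
  by (induction X rule: infinite_finite_induct) auto

lemma place_wt_place: "place_wt n (place j w) = size w * (n + 1 - j)"
  by (induction w) (auto simp: place_def)

text \<open>Leading coefficient 1, with all other monomials strictly lighter: such leading terms
  multiply over any commutative ring, zero divisors included.\<close>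

definition leads :: "nat \<Rightarrow> (nat \<times> nat, 'k::comm_ring_1) mpoly \<Rightarrow> (nat \<times> nat) multiset \<Rightarrow> bool" where
  "leads n p t \<longleftrightarrow> (\<exists>q. p = pmon t + q \<and> (\<forall>u\<in>Poly_Mapping.keys q. place_wt n u < place_wt n t))"

lemma leads_one: "leads n 1 {#}"
  unfolding leads_def by (intro exI[of _ 0]) simp

lemma keys_pmon: "Poly_Mapping.keys (pmon t :: ('v, 'k::comm_ring_1) mpoly) \<subseteq> {t}"
  by (simp add: pmon_def)

lemma leads_mult:
  fixes p q :: "(nat \<times> nat, 'k::comm_ring_1) mpoly"
  assumes "leads n p t" "leads n q u"
  shows "leads n (p * q) (t + u)"
proof -
  obtain p' q' where p': "p = pmon t + p'" "\<And>v. v \<in> Poly_Mapping.keys p' \<Longrightarrow> place_wt n v < place_wt n t"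
    and q': "q = pmon u + q'" "\<And>v. v \<in> Poly_Mapping.keys q' \<Longrightarrow> place_wt n v < place_wt n u"
    using assms unfolding leads_def by blast
  have "place_wt n v < place_wt n (t + u)" if "v \<in> Poly_Mapping.keys (pmon t * q' + p' * q)" for v
  proof -
    have "v \<in> Poly_Mapping.keys (pmon t * q') \<union> Poly_Mapping.keys (p' * q)"
      using that by (rule subsetD[OF keys_add])
    then show ?thesis
    proof
      assume "v \<in> Poly_Mapping.keys (pmon t * q')"
      then obtain b where "v = t + b" "b \<in> Poly_Mapping.keys q'"
        using keys_mult[of "pmon t" q'] keys_pmon[of t, where 'k = 'k] by blast
      then show ?thesis using q'(2) by simp
    next
      assume "v \<in> Poly_Mapping.keys (p' * q)"
      then obtain a b where ab: "v = a + b" "a \<in> Poly_Mapping.keys p'" "b \<in> Poly_Mapping.keys q"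
        using keys_mult[of p' q] by blast
      from ab(3) have "b = u \<or> b \<in> Poly_Mapping.keys q'"
        unfolding q'(1) using keys_add[of "pmon u" q'] keys_pmon[of u, where 'k = 'k] by blast
      then have "place_wt n b \<le> place_wt n u" using q'(2) by (auto intro: less_imp_le)
      then show ?thesis using ab(1) p'(2)[OF ab(2)] by simp
    qed
  qed
  moreover have "p * q = pmon (t + u) + (pmon t * q' + p' * q)"
    by (simp add: p'(1) q'(1) algebra_simps)
  ultimately show ?thesis unfolding leads_def by blast
qed

lemma lookup_leads:
  assumes "leads n p t" "place_wt n t \<le> place_wt n u"
  shows "Poly_Mapping.lookup p u = (if u = t then 1 else 0)"
proof -
  obtain q where q: "p = pmon t + q" "\<forall>u\<in>Poly_Mapping.keys q. place_wt n u < place_wt n t"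
    using assms(1) unfolding leads_def by blast
  have "u \<notin> Poly_Mapping.keys q" using q(2) assms(2) by auto
  then show ?thesis by (simp add: q(1) lookup_add pmon_def lookup_single in_keys_iff when_def)
qed

lemma prod_pmon: "(\<Prod>x\<in>X. pmon (f x)) = pmon (\<Sum>x\<in>X. f x)"
  by (simp add: pmon_def prod_single)

text \<open>J arises from 1..r by exchanging equally many places. The ones given up weigh at least n
  + 1 - r each, the new ones at most n - r.\<close>

lemma sum_initial_less:
  assumes "J \<subseteq> {1..n}" "card J = r" "J \<noteq> {1..r}" 
  shows "(\<Sum>j\<in>J. n + 1 - j) < (\<Sum>j=1..r. n + 1 - j)"
proof -
  let ?I = "{1..r}"
  have fin: "finite J" using assms(1) finite_subset by blast
  have card_eq: "card (J - ?I) = card (?I - J)"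
    using assms(2) fin card_Diff_subset_Int[of J ?I] card_Diff_subset_Int[of ?I J]
    by (simp add: Int_commute)
  have "?I - J \<noteq> {}"
  proof
    assume "?I - J = {}"
    then have "?I \<subseteq> J" by blast
    then have "?I = J" using fin assms(2) by (intro card_subset_eq) auto
    with assms(3) show False by simp
  qed
  then have pos: "card (?I - J) > 0" by (simp add: card_gt_0_iff)
  have rn: "r \<le> n" using assms(1,2) card_mono[of "{1..n}" J] by simp
  have "(\<Sum>j\<in>J - ?I. n + 1 - j) \<le> of_nat (card (J - ?I)) * (n - r)"
    by (rule sum_bounded_above) (use assms(1) in auto)
  also have "\<dots> < card (?I - J) * (n + 1 - r)" using card_eq pos rn by simp
  also have "\<dots> = of_nat (card (?I - J)) * (n + 1 - r)" by simp
  also have "\<dots> \<le> (\<Sum>j\<in>?I - J. n + 1 - j)"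
    by (rule sum_bounded_below) auto
  finally have "(\<Sum>j\<in>J - ?I. n + 1 - j) + (\<Sum>j\<in>J \<inter> ?I. n + 1 - j) <
      (\<Sum>j\<in>?I - J. n + 1 - j) + (\<Sum>j\<in>J \<inter> ?I. n + 1 - j)" by simp
  moreover have "(\<Sum>j\<in>J. n + 1 - j) = (\<Sum>j\<in>J - ?I. n + 1 - j) + (\<Sum>j\<in>J \<inter> ?I. n + 1 - j)"
    using sum.Int_Diff[OF fin, of "\<lambda>j. n + 1 - j" ?I] by simp
  moreover have "(\<Sum>j\<in>?I. n + 1 - j) = (\<Sum>j\<in>?I - J. n + 1 - j) + (\<Sum>j\<in>J \<inter> ?I. n + 1 - j)"
    using sum.Int_Diff[of ?I "\<lambda>j. n + 1 - j" J] by (simp add: Int_commute)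
  ultimately show ?thesis by simp
qed

lemma leads_sigma:
  assumes "r \<le> n" "w \<noteq> {#}"
  shows "leads n (sigma n r w :: (nat \<times> nat, 'k::comm_ring_1) mpoly) (\<Sum>j=1..r. place j w)"
proof -
  let ?\<J> = "{J. J \<subseteq> {1..n} \<and> card J = r}"
  let ?m = "\<lambda>J. \<Sum>j\<in>J. place j w"
  let ?q = "\<Sum>J\<in>?\<J> - {{1..r}}. pmon (?m J) :: (nat \<times> nat, 'k) mpoly"
  have fin: "finite ?\<J>" by (rule finite_subset[of _ "Pow {1..n}"]) auto
  have "{1..r} \<in> ?\<J>" using assms(1) by auto
  then have "sigma n r w = pmon (?m {1..r}) + ?q"
    unfolding sigma_def prod_pmon by (rule sum.remove[OF fin])
  moreover have "place_wt n u < place_wt n (?m {1..r})" if u_keys: "u \<in> Poly_Mapping.keys ?q" for u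
  proof -
    obtain J where J: "J \<in> ?\<J> - {{1..r}}" "Poly_Mapping.lookup (pmon (?m J) :: (nat \<times> nat, 'k) mpoly) u \<noteq> 0"
      using u_keys unfolding in_keys_iff lookup_sum by (rule sum.not_neutral_contains_not_neutral)
    then have u: "u = ?m J" by (auto simp: pmon_def lookup_single when_def split: if_splits)
    have "(\<Sum>j\<in>J. n + 1 - j) < (\<Sum>j=1..r. n + 1 - j)" using J by (intro sum_initial_less) auto
    moreover have "size w > 0" using assms(2) by (simp add: nonempty_has_size)
    ultimately show ?thesis
      unfolding u place_wt_sum place_wt_place sum_distrib_left[symmetric] by simp
  qed
  ultimately show ?thesis unfolding leads_def by blast
qed

text \<open>Read \<open>a\<close> as a partition: place j carries w to the power of the j-th part of
  the conjugate partition.\<close>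

definition lead :: "nat multiset \<Rightarrow> nat multiset \<Rightarrow> (nat \<times> nat) multiset" where
  "lead w a = (\<Sum>r\<in>#a. \<Sum>j=1..r. place j w)"

lemma leads_prod_sigma:
  assumes "set_mset a \<subseteq> {1..n}" "w \<noteq> {#}"
  shows "leads n (\<Prod>r\<in>#a. sigma n r w) (lead w a)"
  using assms(1)
proof (induction a)
  case empty
  then show ?case by (simp add: lead_def leads_one)
next
  case (add r a)
  then show ?case
    using leads_mult[OF leads_sigma[of r n w]] assms(2) by (simp add: lead_def)
qed

lemma count_place: "count (place j w) (i, j') = (if j = j' then count w i else 0)"
  by (induction w) (auto simp: place_def)

lemma count_lead: "1 \<le> j \<Longrightarrow> count (lead w a) (i, j) = count w i * size (filter_mset (\<lambda>r. j \<le> r) a)"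
proof (induction a)
  case (add r a)
  have "count (\<Sum>j=1..r. place j w) (i, j) = (if j \<le> r then count w i else 0)"
    using add.prems by (simp add: count_sum count_place)
  then show ?case using add by (simp add: lead_def)
qed (simp add: lead_def)

lemma count_eq_size_filter: "count a j = size (filter_mset (\<lambda>r. j \<le> r) a) - size (filter_mset (\<lambda>r. Suc j \<le> r) a)"
proof -
  have "size (filter_mset (\<lambda>r. j \<le> r) a) = count a j + size (filter_mset (\<lambda>r. Suc j \<le> r) a)"
    by (induction a) auto
  then show ?thesis by simp
qed

text \<open>A partition is determined by its conjugate, and any variable of w reveals the conjugate
  up to a known positive factor. The range of the parts excludes 0, which would leave no trace in
  \<open>lead\<close>.\<close>

lemma lead_inject:
  assumes "set_mset a \<subseteq> {1..n}" "set_mset b \<subseteq> {1..n}" "w \<noteq> {#}" "lead w a = lead w b"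
  shows "a = b"
proof (rule multiset_eqI)
  fix j
  obtain i where i: "i \<in># w" using assms(3) by blast
  have eq: "size (filter_mset (\<lambda>r. j \<le> r) a) = size (filter_mset (\<lambda>r. j \<le> r) b)" if "1 \<le> j" for j
    using count_lead[OF that, of w a i] count_lead[OF that, of w b i] assms(4) i
    by (simp add: count_eq_zero_iff)
  show "count a j = count b j"
  proof (cases "j = 0")
    case True
    then show ?thesis using assms(1,2) by (metis atLeastAtMost_iff not_in_iff not_one_le_zero subsetD)
  next
    case False
    then show ?thesis using eq[of j] eq[of "Suc j"] by (simp only: count_eq_size_filter[of _ j])
  qed
qed

text \<open>Distinct products of the \<open>\<sigma>\<^sub>r(w)\<close> have distinct leading monomials.\<close>

lemma sigma_independent:
  fixes f :: "('v, 'k::comm_ring_1) mpoly"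
  assumes w: "w \<noteq> {#}" and f: "pvars f \<subseteq> V" and idx: "inj_on idx V" "idx ` V \<subseteq> {1..n}"
    and zero: "peval pconst (\<lambda>v. sigma n (idx v) w) f = 0"
  shows "f = 0"
proof (rule ccontr)
  assume "f \<noteq> 0"
  then have ne: "Poly_Mapping.keys f \<noteq> {}" by simp
  let ?l = "\<lambda>a. lead w (image_mset idx a)"
  let ?p = "\<lambda>a. \<Prod>v\<in>#a. sigma n (idx v) w :: (nat \<times> nat, 'k) mpoly"
  have keys: "set_mset a \<subseteq> V" if "a \<in> Poly_Mapping.keys f" for a
    using f that by (auto simp: pvars_def)
  have leads: "leads n (?p a) (?l a)" if "a \<in> Poly_Mapping.keys f" for a
    using leads_prod_sigma[of "image_mset idx a" n w] keys[OF that] idx(2) w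
    by (auto simp: image_mset.compositionality comp_def)
  \<comment> \<open>The leading monomial of a heaviest product occurs in no lighter product and, by
    injectivity of \<open>lead\<close>, in no other product of the same weight; so the coefficient
    of f at a survives alone.\<close>
  obtain a where a: "a \<in> Poly_Mapping.keys f" "\<And>b. b \<in> Poly_Mapping.keys f \<Longrightarrow> place_wt n (?l b) \<le> place_wt n (?l a)"
  proof -
    let ?M = "Max ((\<lambda>b. place_wt n (?l b)) ` Poly_Mapping.keys f)"
    have "?M \<in> (\<lambda>b. place_wt n (?l b)) ` Poly_Mapping.keys f" using ne by (intro Max_in) auto
    then obtain a where "a \<in> Poly_Mapping.keys f" "place_wt n (?l a) = ?M" by auto
    moreover have "place_wt n (?l b) \<le> ?M" if "b \<in> Poly_Mapping.keys f" for b
      using that by (intro Max_ge) auto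
    ultimately show ?thesis using that by auto
  qed
  have "?l b = ?l a \<longleftrightarrow> b = a" if b: "b \<in> Poly_Mapping.keys f" for b
  proof
    assume "?l b = ?l a"
    then have "image_mset idx b = image_mset idx a"
      using keys[OF a(1)] keys[OF b] idx(2) w by (intro lead_inject[of _ n _ w]) auto
    then show "b = a"
      by (rule multiset.inj_map_strong[rotated])
        (use keys[OF a(1)] keys[OF b] idx(1) in \<open>auto dest: inj_onD\<close>)
  qed simp
  then have l: "Poly_Mapping.lookup (?p b) (?l a) = (if b = a then 1 else 0)"
    if "b \<in> Poly_Mapping.keys f" for b
    using lookup_leads[OF leads[OF that] a(2)[OF that]] that by (metis (full_types))
  have "0 = Poly_Mapping.lookup (peval pconst (\<lambda>v. sigma n (idx v) w) f) (?l a)" by (simp add: zero)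
  also have "\<dots> = (\<Sum>b\<in>Poly_Mapping.keys f. Poly_Mapping.lookup f b * Poly_Mapping.lookup (?p b) (?l a))"
    by (simp add: peval_def lookup_sum pconst_def lookup_times_const)
  also have "\<dots> = (\<Sum>b\<in>Poly_Mapping.keys f. if b = a then Poly_Mapping.lookup f b else 0)"
    by (rule sum.cong) (auto simp: l)
  also have "\<dots> = Poly_Mapping.lookup f a" using a(1) by simp
  finally show False using a(1) by (simp add: in_keys_iff)
qed

section \<open>Symmetric polynomials for m = 1 as polynomials in the elementary ones\<close>

lemma lookup_perm_act:
  fixes p :: "(nat \<times> nat, 'k::comm_ring_1) mpoly"
  assumes "\<pi> permutes {1..n}"
  shows "Poly_Mapping.lookup (perm_act \<pi> p) (image_mset (\<lambda>(i, j). (i, \<pi> j)) t) = Poly_Mapping.lookup p t"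
proof -
  let ?g = "\<lambda>(i, j). (i, \<pi> j) :: nat \<times> nat"
  have inj: "inj ?g" using permutes_inj[OF assms] by (auto simp: inj_def)
  have "pconst c * (\<Prod>(i, j)\<in>#u. pvar (i, \<pi> j)) = Poly_Mapping.single (image_mset ?g u) c" for u and c :: 'k
  proof -
    have "(\<Prod>(i, j)\<in>#u. pvar (i, \<pi> j)) = (\<Prod>v\<in>#u. pvar (?g v) :: (nat \<times> nat, 'k) mpoly)"
      by (rule arg_cong[where f = prod_mset], rule image_mset_cong) auto
    also have "\<dots> = pmon (image_mset ?g u)" by (rule prod_mset_pvar)
    finally show ?thesis by (simp add: pconst_def pmon_def mult_single)
  qed
  then have "perm_act \<pi> p = (\<Sum>u\<in>Poly_Mapping.keys p. Poly_Mapping.single (image_mset ?g u) (Poly_Mapping.lookup p u))"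
    by (simp add: perm_act_def peval_def)
  then have "Poly_Mapping.lookup (perm_act \<pi> p) (image_mset ?g t) =
     (\<Sum>u\<in>Poly_Mapping.keys p. if image_mset ?g u = image_mset ?g t then Poly_Mapping.lookup p u else 0)"
    by (simp add: lookup_sum lookup_single when_def)
  also have "\<dots> = (\<Sum>u\<in>Poly_Mapping.keys p. if u = t then Poly_Mapping.lookup p u else 0)"
    using multiset.inj_map[OF inj] by (intro sum.cong) (auto dest: injD)
  also have "\<dots> = Poly_Mapping.lookup p t" by (simp add: in_keys_iff)
  finally show ?thesis .
qed

text \<open>Each factor moved from place j to j + 1 loses weight 1 and each moved back gains 1; the
  additive form avoids truncated subtraction.\<close>

lemma place_wt_transpose:
  assumes "set_mset t \<subseteq> {1} \<times> {1..n}" "1 \<le> j" "j < n"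
  shows "place_wt n (image_mset (\<lambda>(i, k). (i, transpose j (Suc j) k)) t) + count t (1, j) = place_wt n t + count t (1, Suc j)"
  using assms(1)
proof (induction t)
  case (add x t)
  obtain k where x: "x = (1, k)" "k \<in> {1..n}" using add.prems by auto
  consider "k = j" | "k = Suc j" | "k \<noteq> j" "k \<noteq> Suc j" by blast
  then show ?case
    using add x assms(2,3) by cases (auto simp: transpose_def)
qed simp

text \<open>Swapping neighbouring places cannot raise the maximal weight, so the exponents of t
  decrease along the places. They form a partition, and \<open>a\<close> is its conjugate.\<close>

lemma symmetric_top_monomial:
  assumes p: "p \<in> carrier (inv_ring n 1)" and t: "t \<in> Poly_Mapping.keys p"
    and top: "\<And>u. u \<in> Poly_Mapping.keys p \<Longrightarrow> place_wt n u \<le> place_wt n t"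
  obtains a where "set_mset a \<subseteq> {1..n}" "t = lead {#1#} a"
proof -
  have pv: "set_mset t \<subseteq> {1} \<times> {1..n}"
    using p t by (auto simp: inv_ring_def poly_ring_def pvars_def)
  let ?c = "\<lambda>j. count t (1, j)"
  have step: "?c (Suc j) \<le> ?c j" if j: "1 \<le> j" "j < n" for j
  proof -
    let ?\<tau> = "transpose j (Suc j)"
    let ?t' = "image_mset (\<lambda>(i, k). (i, ?\<tau> k)) t"
    have \<tau>: "?\<tau> permutes {1..n}" using j by (intro permutes_swap_id) auto
    then have "perm_act ?\<tau> p = p" using p by (simp add: inv_ring_def)
    then have "?t' \<in> Poly_Mapping.keys p"
      using lookup_perm_act[OF \<tau>, of p t] t by (simp add: in_keys_iff)
    then have "place_wt n ?t' \<le> place_wt n t" by (rule top)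
    then show ?thesis using place_wt_transpose[OF pv j] by simp
  qed
  have c_gt: "?c (Suc n) = 0"
    using pv by (metis SigmaE2 Suc_n_not_le_n atLeastAtMost_iff not_in_iff subsetD)
  then have step': "?c (Suc j) \<le> ?c j" if "1 \<le> j" "j \<le> n" for j
    using step[of j] that by (cases "j = n") auto
  \<comment> \<open>In the conjugate partition the part r occurs as often as the exponents drop from
    place r to r + 1; the exponent 0 at place n + 1 closes the telescope.\<close>
  let ?a = "\<Sum>r=1..n. replicate_mset (?c r - ?c (Suc r)) r"
  have sub: "set_mset ?a \<subseteq> {1..n}"
    by (auto simp: set_mset_sum split: if_splits)
  have tele: "(\<Sum>r=j..n. ?c r - ?c (Suc r)) = ?c j" if "1 \<le> j" "j \<le> n" for j
    using that(2,1)
  proof (induction j rule: inc_induct)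
    case base
    then show ?case using c_gt by simp
  next
    case (step j)
    then have "(\<Sum>r=j..n. ?c r - ?c (Suc r)) = (?c j - ?c (Suc j)) + ?c (Suc j)"
      by (subst sum.atLeast_Suc_atMost) auto
    then show ?case using step'[of j] step by simp
  qed
  have filt: "filter_mset P (\<Sum>x\<in>X. f x) = (\<Sum>x\<in>X. filter_mset P (f x))" for P f and X :: "nat set"
    by (induction X rule: infinite_finite_induct) auto
  have size_filt: "size (filter_mset P (replicate_mset k x)) = (if P x then k else 0)" for P k and x :: nat
    by (induction k) auto
  have "t = lead {#1#} ?a"
  proof (rule multiset_eqI)
    fix x :: "nat \<times> nat"
    obtain i j where x: "x = (i, j)" by (cases x)
    show "count t x = count (lead {#1#} ?a) x"
    proof (cases "i = 1 \<and> j \<in> {1..n}")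
      case True
      then have "size (filter_mset (\<lambda>r. j \<le> r) ?a) = (\<Sum>r=1..n. if j \<le> r then ?c r - ?c (Suc r) else 0)"
        by (simp add: filt size_filt) (rule sum.cong, auto)
      also have "\<dots> = (\<Sum>r=j..n. ?c r - ?c (Suc r))"
        using True by (intro sum.mono_neutral_cong_right) auto
      finally show ?thesis using True x count_lead[of j "{#1#}" ?a i] tele[of j] by simp
    next
      case False
      then have "count t x = 0" using pv x by (auto simp: count_eq_zero_iff)
      moreover have "set_mset (lead {#1#} ?a) \<subseteq> {1} \<times> {1..n}"
        using sub by (fastforce simp: lead_def set_mset_sum place_def)
      then have "count (lead {#1#} ?a) x = 0" using False x by (auto simp: count_eq_zero_iff)
      ultimately show ?thesis by simp
    qed
  qed
  with sub show ?thesis by (rule that)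
qed

lemma inv_ring_mult_pconst_prod:
  fixes c :: "'k::comm_ring_1"
  shows "w \<in> Mon m \<Longrightarrow> pconst c * (\<Prod>r\<in>#a. sigma n r w) \<in> carrier (inv_ring n m)"
proof (induction a)
  case empty
  then show ?case using inv_ring_closed(1) by simp
next
  case (add r a)
  then have "sigma n r w * (pconst c * (\<Prod>r\<in>#a. sigma n r w)) \<in> carrier (inv_ring n m)"
    by (intro inv_ring_closed(3)[OF sigma_closed]) auto
  then show ?case by (simp add: mult.left_commute)
qed

text \<open>
  Fundamental theorem: the part of maximal weight of a symmetric polynomial consists of leading
  monomials of products of the \<open>\<sigma>\<^sub>r\<close>, so subtracting those products lowers the weight.
\<close>

lemma symmetric_in_sigma:
  fixes p :: "(nat \<times> nat, 'k::comm_ring_1) mpoly"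
  assumes "p \<in> carrier (inv_ring n 1)" "\<And>t. t \<in> Poly_Mapping.keys p \<Longrightarrow> place_wt n t < h"
  shows "\<exists>f. pvars f \<subseteq> {1..n} \<and> p = peval pconst (\<lambda>r. sigma n r {#1#}) f"
  using assms
proof (induction h arbitrary: p)
  case 0
  then have "p = 0" by (metis ex_in_conv keys_eq_empty less_nat_zero_code)
  then show ?case by (intro exI[of _ 0]) (simp add: pvars_def peval_def)
next
  case (Suc h)
  let ?x = "{#1#} :: nat multiset"
  let ?T = "{t \<in> Poly_Mapping.keys p. place_wt n t = h}"
  let ?P = "\<lambda>a. \<Prod>r\<in>#a. sigma n r ?x :: (nat \<times> nat, 'k) mpoly"
  have "\<forall>t\<in>?T. \<exists>a. set_mset a \<subseteq> {1..n} \<and> t = lead ?x a"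
  proof
    fix t assume t: "t \<in> ?T"
    then have "t \<in> Poly_Mapping.keys p" by simp
    moreover have "place_wt n u \<le> place_wt n t" if "u \<in> Poly_Mapping.keys p" for u
      using Suc.prems(2)[OF that] t by simp
    ultimately obtain a where "set_mset a \<subseteq> {1..n}" "t = lead ?x a"
      by (rule symmetric_top_monomial[OF Suc.prems(1)])
    then show "\<exists>a. set_mset a \<subseteq> {1..n} \<and> t = lead ?x a" by (intro exI conjI)
  qed
  from bchoice[OF this] obtain a where a': "\<forall>t\<in>?T. set_mset (a t) \<subseteq> {1..n} \<and> t = lead ?x (a t)" by (rule exE)
  then have a: "set_mset (a t) \<subseteq> {1..n}" "t = lead ?x (a t)" if "t \<in> ?T" for t
    using that by blast+
  let ?g = "\<Sum>t\<in>?T. pconst (Poly_Mapping.lookup p t) * ?P (a t)"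
  let ?f = "\<Sum>t\<in>?T. Poly_Mapping.single (a t) (Poly_Mapping.lookup p t)"
  have x: "?x \<in> Mon 1" by (simp add: Mon_def)
  have inv: "p - ?g \<in> carrier (inv_ring n 1)"
  proof -
    have "pconst (- c) = (- pconst c :: (nat \<times> nat, 'k) mpoly)" for c by (simp add: pconst_def single_uminus)
    then have eq: "p - ?g = p + (\<Sum>t\<in>?T. pconst (- Poly_Mapping.lookup p t) * ?P (a t))"
      by (simp add: sum_negf)
    show ?thesis unfolding eq
      by (rule inv_ring_closed(2)[OF Suc.prems(1) inv_ring_sum]) (rule inv_ring_mult_pconst_prod[OF x])
  qed
  have "place_wt n u < h" if u: "u \<in> Poly_Mapping.keys (p - ?g)" for u
  proof (rule ccontr)
    assume "\<not> place_wt n u < h"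
    then have "Poly_Mapping.lookup (?P (a t)) u = (if u = t then 1 else 0)" if "t \<in> ?T" for t
      using lookup_leads[OF leads_prod_sigma[OF a(1)[OF that]], of ?x u] a(2)[OF that] that by simp
    then have "Poly_Mapping.lookup ?g u = (\<Sum>t\<in>?T. if u = t then Poly_Mapping.lookup p t else 0)"
      unfolding lookup_sum pconst_def lookup_times_const by (intro sum.cong) simp_all
    also have "\<dots> = (if u \<in> ?T then Poly_Mapping.lookup p u else 0)" by simp
    also have "\<dots> = Poly_Mapping.lookup p u"
    proof (cases "u \<in> Poly_Mapping.keys p")
      case True
      then show ?thesis using Suc.prems(2)[of u] \<open>\<not> place_wt n u < h\<close> by simp
    qed (simp add: in_keys_iff)
    finally show False using u by (simp add: in_keys_iff lookup_minus)
  qed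
  then obtain f' where f': "pvars f' \<subseteq> {1..n}" "p - ?g = peval pconst (\<lambda>r. sigma n r ?x) f'"
    using Suc.IH[OF inv] by blast
  have "peval pconst (\<lambda>r. sigma n r ?x) (f' + ?f) = (p - ?g) + ?g"
    unfolding f'(2) by (simp add: peval_add peval_sum peval_single)
  then have "p = peval pconst (\<lambda>r. sigma n r ?x) (f' + ?f)" by simp
  moreover have "pvars (f' + ?f) \<subseteq> {1..n}"
  proof -
    have "pvars ?f \<subseteq> {1..n}"
      by (rule pvars_sum_le) (rule order_trans[OF pvars_single a(1)])
    then show ?thesis using f'(1) pvars_add[of f' ?f] by blast
  qed
  ultimately show ?case by blast
qed

text \<open>Justifies the definite description in \<open>f_poly\<close>: existence is the
  fundamental theorem, uniqueness the independence of the sigma_r(x).\<close>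

lemma f_poly_spec:
  assumes "k \<ge> 1"
  shows "pvars (f_poly n j k) \<subseteq> {1..n} \<and>
    sigma n j (repeat_mset k {#1#}) = peval pconst (\<lambda>r. sigma n r {#1#}) (f_poly n j k)"
proof -
  let ?ev = "peval pconst (\<lambda>r. sigma n r {#1#}) :: (nat, int) mpoly \<Rightarrow> (nat \<times> nat, int) mpoly"
  let ?s = "sigma n j (repeat_mset k {#1#}) :: (nat \<times> nat, int) mpoly"
  have "repeat_mset k {#1#} \<in> Mon 1" using assms by (auto simp: Mon_def)
  then have inv: "?s \<in> carrier (inv_ring n 1)" by (rule sigma_closed)
  \<comment> \<open>For a zero polynomial \<open>Max\<close> is taken over the empty set, but then
    there is no monomial to bound.\<close>
  let ?h = "Suc (Max (place_wt n ` Poly_Mapping.keys ?s))"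
  have "place_wt n t < ?h" if "t \<in> Poly_Mapping.keys ?s" for t
    using that by (simp add: less_Suc_eq_le)
  then obtain f where f: "pvars f \<subseteq> {1..n}" "?s = ?ev f"
    using symmetric_in_sigma[OF inv, of ?h] by blast
  have uniq: "g = f" if g: "pvars g \<subseteq> {1..n}" "?s = ?ev g" for g
  proof -
    have sub: "pvars (g - f) \<subseteq> {1..n}"
    proof -
      have "pvars (g - f) \<subseteq> pvars g \<union> pvars (- f)" using pvars_add[of g "- f"] by simp
      also have "pvars (- f) = pvars f" by (simp add: pvars_def)
      finally show ?thesis using g(1) f(1) by blast
    qed
    have "?ev (g - f) + ?ev f = ?ev g" by (simp flip: peval_add)
    then have "?ev (g - f) = 0" using f(2) g(2) by simp
    then have "g - f = 0"
      using sigma_independent[of "{#1#}" "g - f" "{1..n}" "\<lambda>r. r" n] sub by simp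
    then show ?thesis by simp
  qed
  have carr: "g \<in> carrier (poly_ring {1..n}) \<longleftrightarrow> pvars g \<subseteq> {1..n}" for g :: "(nat, int) mpoly"
    by (simp add: poly_ring_def)
  have "\<exists>!f. pvars f \<subseteq> {1..n} \<and> ?s = ?ev f"
  proof (rule ex1I)
    show "pvars f \<subseteq> {1..n} \<and> ?s = ?ev f" using f by (rule conjI)
    show "g = f" if "pvars g \<subseteq> {1..n} \<and> ?s = ?ev g" for g
      using that by (elim conjE) (rule uniq)
  qed
  from theI'[OF this] show ?thesis unfolding f_poly_def carr .
qed

section \<open>Leading terms and power relations\<close>

lemma cyc_class_eq: "(U, V) \<in> cyc_rel \<Longrightarrow> cyc_rel `` {U} = cyc_rel `` {V}"
  unfolding cyc_rel_iff by (metis rotate_class_eq)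

lemma reduced_replicate_same:
  assumes "reduced U" "U \<noteq> []" "set U \<subseteq> {a}"
  shows "U = [a]"
proof -
  have "U = concat (replicate (length U) [a])"
    using assms(3) by (induction U) auto
  with assms(1) reduced_power_le_1[of "length U" "[a]"] have "length U \<le> 1" by simp
  with assms show ?thesis by (cases U) auto
qed

text \<open>A proper power contains each letter a multiple of k >= 2 times, whereas 2 occurs
  once.\<close>

lemma reduced_ones_two: "reduced (replicate p 1 @ [2 :: nat])"
proof (rule ccontr)
  assume "\<not> reduced (replicate p 1 @ [2 :: nat])"
  then obtain U0 k where "2 \<le> k" "replicate p 1 @ [2 :: nat] = concat (replicate k U0)"
    unfolding reduced_def by blast
  from this(2) have "mset (replicate p 1 @ [2 :: nat]) = repeat_mset k (mset U0)"
    by (simp only: mset_concat_replicate)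
  from arg_cong[OF this, of "\<lambda>M. count M 2"] have "1 = k * count (mset U0) 2" by simp
  with \<open>2 \<le> k\<close> show False by simp
qed

text \<open>Rotating the single letter 2 to the end leaves only ones in front of it.\<close>

lemma class_ones_two:
  assumes "U \<in> W0 2" "spec U = add_mset 2 (replicate_mset p 1)"
  shows "U = cyc_rel `` {replicate p 1 @ [2]}"
proof -
  obtain V where V: "U = cyc_rel `` {V}" using assms(1) by (rule W0_E)
  then have m: "mset V = add_mset 2 (replicate_mset p 1)" using assms(2) by simp
  then have "2 \<in> set V" by (metis set_mset_mset union_single_eq_member)
  then obtain xs ys where xy: "V = xs @ 2 # ys" by (meson split_list)
  have m': "mset (ys @ xs) = replicate_mset p 1" using m xy by (simp add: union_commute)
  then have "set (ys @ xs) \<subseteq> {1}" by (metis set_mset_mset set_mset_replicate_mset_subset empty_subsetI subset_refl)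
  then have "ys @ xs = replicate (length (ys @ xs)) 1"
    by (intro replicate_eqI) auto
  moreover have "length (ys @ xs) = p" using m' by (metis size_mset size_replicate_mset)
  ultimately have "ys @ xs @ [2] = replicate p 1 @ [2]" by (metis append.assoc)
  moreover have "(V, ys @ xs @ [2]) \<in> cyc_rel"
    unfolding cyc_rel_def using xy
    by (intro CollectI case_prodI exI[of _ "xs @ [2]"] exI[of _ ys]) simp
  ultimately show ?thesis using V cyc_class_eq by metis
qed

lemma neck_msets_repeat_le:
  assumes "N \<in> neck_msets s A"
  shows "repeat_mset (count N U) (spec U) \<subseteq># A"
proof -
  have "repeat_mset (count N U) (spec U) \<subseteq># (\<Sum>U\<in>#N. spec U)"
  proof (cases "U \<in># N")
    case True
    have "(\<Sum>U\<in>#N. spec U) = repeat_mset (count N U) (spec U) +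
        (\<Sum>V\<in>set_mset N - {U}. repeat_mset (count N V) (spec V))"
      using True by (simp add: sum_mset_eq_sum_repeat[of "set_mset N"] sum.remove)
    then show ?thesis by simp
  qed (simp add: not_in_iff)
  then show ?thesis using assms by (simp add: neck_msets_def)
qed

lemma neck_msets_repeat_eq:
  assumes "N \<in> neck_msets s A" "repeat_mset (count N U) (spec U) = A"
  shows "N = replicate_mset (count N U) U"
proof -
  have "replicate_mset (count N U) U \<subseteq># N" by (simp add: count_le_replicate_mset_subset_eq flip: count_le_replicate_mset_subset_eq)
  then obtain N' where N': "N = replicate_mset (count N U) U + N'"
    using subset_mset.le_iff_add by blast
  have "(\<Sum>U\<in>#N. spec U) = repeat_mset (count N U) (spec U) + (\<Sum>U\<in>#N'. spec U)"
  proof -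
    have "(\<Sum>U\<in>#replicate_mset k V. spec U) = repeat_mset k (spec V)" for k V
      by (induction k) auto
    then show ?thesis by (subst N') simp
  qed
  then have "(\<Sum>U\<in>#N'. spec U) = {#}" using assms by (simp add: neck_msets_def)
  moreover have "set_mset N' \<subseteq> set_mset N" by (subst N') auto
  then have "size N' \<le> size (\<Sum>U\<in>#N'. spec U)"
    using assms(1) W0_spec_nonempty by (intro size_le_size_sum_mset) (auto simp: neck_msets_def)
  ultimately have "size N' = 0" by (simp only: size_empty le_zero_eq)
  then show ?thesis using N' by simp
qed

lemma subst_mon_const: "subst_mon (\<lambda>_. v) u = repeat_mset (size u) v"
  by (induction u) (auto simp: subst_mon_def)

text \<open>\<open>N0\<close> consists of one-letter necklaces; its size is \<open>size A\<close>,
  so its sign is +1. Necklaces have non-empty content, so N has \<open>size A\<close> members only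
  if each has length 1, and then N is \<open>N0\<close>.\<close>

lemma neck_S_main_term:
  assumes A: "set_mset A \<subseteq> {1..s}"
  defines "N0 \<equiv> image_mset (\<lambda>i. {[i]}) A"
  shows "neck_S n s A w = (\<Prod>i\<in>set_mset A. e n (count A i) (w i)) +
      (\<Sum>N\<in>neck_msets s A - {N0}. (-1) ^ (size A + size N) * neck_term n w N)"
    and "N \<in> neck_msets s A - {N0} \<Longrightarrow> size N < size A"
proof -
  have class1: "cyc_rel `` {[i]} = {[i]}" for i
    by (auto simp: cyc_class)
  have red1: "reduced [i]" for i
    by (auto simp: reduced_def)
  have W1: "{[i]} \<in> W0 s" if "i \<in> {1..s}" for i
    using W0_I[of "[i]" s] that red1 class1 by auto
  have spec1: "spec {[i]} = {#i#}" for i using spec_class[of "[i]"] class1 by simp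
  have N0: "N0 \<in> neck_msets s A"
    using A W1 by (auto simp: neck_msets_def N0_def image_mset.compositionality comp_def spec1)
  have inj: "inj (\<lambda>i. {[i]} :: nat list set)" by (auto simp: inj_def)
  have "neck_term n w N0 = (\<Prod>i\<in>set_mset A. e n (count A i) (w i))"
  proof -
    have "count N0 {[i]} = count A i" for i
      unfolding N0_def using inj by (induction A) (auto simp: inj_eq)
    moreover have "set_mset N0 = (\<lambda>i. {[i]}) ` set_mset A" by (simp add: N0_def)
    ultimately show ?thesis
      using inj_on_subset[OF inj subset_UNIV]
      by (simp add: neck_term_def prod.reindex spec1)
  qed
  moreover have "size N0 = size A" by (simp add: N0_def)
  ultimately show "neck_S n s A w = (\<Prod>i\<in>set_mset A. e n (count A i) (w i)) +
      (\<Sum>N\<in>neck_msets s A - {N0}. (-1) ^ (size A + size N) * neck_term n w N)"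
    unfolding neck_S_def by (subst sum.remove[OF finite_neck_msets N0]) simp
  show "size N < size A" if N: "N \<in> neck_msets s A - {N0}"
  proof (rule ccontr)
    assume "\<not> size N < size A"
    with N have sz: "size N = size A" using neck_msets_size[of N s A] by simp
    have A_eq: "A = (\<Sum>U\<in>#N. spec U)" and NW: "set_mset N \<subseteq> W0 s" using N by (auto simp: neck_msets_def)
    have one: "size (spec U) = 1" if U: "U \<in># N" for U
    proof (rule ccontr)
      assume "size (spec U) \<noteq> 1"
      moreover have "size (spec U) \<noteq> 0" using NW U W0_spec_nonempty by auto
      ultimately have U2: "size (spec U) \<ge> 2" by linarith
      have "size (N - {#U#}) \<le> size (\<Sum>U\<in>#N - {#U#}. spec U)"
      proof (rule size_le_size_sum_mset)
        fix x assume "x \<in># N - {#U#}"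
        then have "x \<in> W0 s" using NW in_diffD[of x N] by blast
        then show "spec x \<noteq> {#}" by (rule W0_spec_nonempty)
      qed
      moreover have "size A = size (spec U) + size (\<Sum>U\<in>#N - {#U#}. spec U)"
      proof -
        have "N = add_mset U (N - {#U#})" using U by simp
        then have "(\<Sum>U\<in>#N. spec U) = (\<Sum>U\<in>#add_mset U (N - {#U#}). spec U)" by (rule arg_cong)
        then have "A = spec U + (\<Sum>U\<in>#N - {#U#}. spec U)"
          unfolding A_eq image_mset_add_mset sum_mset.add_mset .
        then have "size A = size (spec U + (\<Sum>U\<in>#N - {#U#}. spec U))" by (rule arg_cong)
        then show ?thesis by (simp only: size_union)
      qed
      ultimately show False using U2 sz U by (simp add: size_Diff_singleton)
    qed
    have sing: "{#U#} = image_mset (\<lambda>i. {[i]}) (spec U)" if U: "U \<in># N" for U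
    proof -
      obtain V where V: "U = cyc_rel `` {V}" using NW U W0_E by blast
      then obtain i where "V = [i]" using one[OF U] by (auto simp: length_Suc_conv)
      then show ?thesis using V class1 by (simp add: spec1)
    qed
    have "N = (\<Sum>U\<in>#N. {#U#})" by simp
    also have "\<dots> = (\<Sum>U\<in>#N. image_mset (\<lambda>i. {[i]}) (spec U))"
      by (rule arg_cong[where f = sum_mset], rule image_mset_cong) (rule sing)
    also have "\<dots> = N0" unfolding N0_def A_eq by (induction N) auto
    finally show False using N by simp
  qed
qed

section \<open>Indeterminates occurring in the relations, and the image of Q\<close>

lemma carrier_e_ring: "p \<in> carrier (e_ring n m) \<longleftrightarrow> pvars p \<subseteq> {1..n} \<times> Mon m"
  by (simp add: e_ring_def poly_ring_def)

lemma of_nat_pconst: "of_nat c = pconst (of_nat c)"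
  by (simp add: pconst_def)

lemma of_int_pconst: "of_int c = pconst (of_int c)"
  by (simp add: pconst_def)

lemma pconst_uminus: "pconst (- c) = - pconst c"
  by (simp add: pconst_def single_uminus)

lemma subst_mon_Mon: "u \<in> Mon s \<Longrightarrow> (\<And>i. i \<in> {1..s} \<Longrightarrow> w i \<in> Mon m) \<Longrightarrow> subst_mon w u \<in> Mon m"
proof (induction u)
  case (add i u)
  then have "w i \<in> Mon m" by (auto simp: Mon_def)
  then show ?case using add by (cases "u = {#}") (auto simp: Mon_def subst_mon_def)
qed (simp add: Mon_def)

text \<open>A multiplicity above n kills the product through e_r = 0 for r > n. Otherwise each
  distinct necklace gives one indeterminate whose index is its multiplicity, and the multiplicities
  add up to \<open>size N\<close>.\<close>

lemma neck_term_cases: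
  assumes N: "N \<in> neck_msets s A" and w: "\<And>i. i \<in> {1..s} \<Longrightarrow> w i \<in> Mon m"
  obtains "neck_term n w N = 0"
  | u where "neck_term n w N = pmon u" "set_mset u \<subseteq> {1..n} \<times> Mon m" "(\<Sum>x\<in>#u. fst x) = size N"
proof (cases "\<forall>U\<in>#N. count N U \<le> n")
  case True
  let ?f = "\<lambda>U. (count N U, subst_mon w (spec U))"
  let ?u = "image_mset ?f (mset_set (set_mset N))"
  have "neck_term n w N = (\<Prod>U\<in>set_mset N. pvar (?f U))"
    unfolding neck_term_def using True by (intro prod.cong) (auto simp: e_def)
  also have "\<dots> = pmon ?u"
    by (simp add: prod_unfold_prod_mset prod_mset_pvar)
  finally have 1: "neck_term n w N = pmon ?u" .
  have 2: "set_mset ?u \<subseteq> {1..n} \<times> Mon m"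
  proof -
    have "spec U \<in> Mon s" if "U \<in># N" for U using that N by (auto simp: neck_msets_def intro: W0_spec)
    then have "subst_mon w (spec U) \<in> Mon m" if "U \<in># N" for U
      using that by (intro subst_mon_Mon[OF _ w])
    then show ?thesis using True by (auto simp: Suc_le_eq)
  qed
  have 3: "(\<Sum>x\<in>#?u. fst x) = size N"
    by (simp add: image_mset.compositionality comp_def size_multiset_overloaded_eq sum_unfold_sum_mset)
  from that(2)[OF 1 2 3] show ?thesis .
next
  case False
  then obtain U where "U \<in># N" "count N U > n" by (auto simp: not_le)
  then have "neck_term n w N = 0"
    unfolding neck_term_def by (intro prod_zero) (auto simp: e_def intro!: bexI[of _ U])
  then show ?thesis by (rule that(1))
qed

lemma pvars_times_le: "pvars p \<subseteq> V \<Longrightarrow> pvars q \<subseteq> V \<Longrightarrow> pvars (p * q) \<subseteq> V"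
  using pvars_mult[of p q] by auto

lemma pvars_plus_le: "pvars p \<subseteq> V \<Longrightarrow> pvars q \<subseteq> V \<Longrightarrow> pvars (p + q) \<subseteq> V"
  using pvars_add[of p q] by auto

lemma pvars_prod_mset_le: "(\<And>x. x \<in># X \<Longrightarrow> pvars (f x) \<subseteq> V) \<Longrightarrow> pvars (\<Prod>x\<in>#X. f x) \<subseteq> V"
proof (induction X)
  case (add x X)
  then have "pvars (f x) \<subseteq> V" "pvars (\<Prod>x\<in>#X. f x) \<subseteq> V" by simp_all
  then show ?case by (simp add: pvars_times_le)
qed (simp add: pvars_simps)

lemma neck_S_pvars:
  assumes "\<And>i. i \<in> {1..s} \<Longrightarrow> w i \<in> Mon m"
  shows "pvars (neck_S n s A w :: 'k::comm_ring_1 epoly) \<subseteq> {1..n} \<times> Mon m"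
  unfolding neck_S_def
proof (rule pvars_sum_le)
  fix N assume N: "N \<in> neck_msets s A"
  have "pvars (neck_term n w N :: 'k epoly) \<subseteq> {1..n} \<times> Mon m"
  proof (rule neck_term_cases[OF N assms, where n = n])
    fix u assume "neck_term n w N = (pmon u :: 'k epoly)" "set_mset u \<subseteq> {1..n} \<times> Mon m"
    then show ?thesis using pvars_simps(5)[of u, where 'k = 'k] by simp
  next
    assume "neck_term n w N = (0 :: 'k epoly)"
    then show ?thesis by (simp only: pvars_simps empty_subsetI)
  qed
  moreover have "pvars ((-1) ^ k :: 'k epoly) = {}" for k
    by (cases "even k") (auto simp: pvars_simps)
  ultimately show "pvars ((-1) ^ (size A + size N) * neck_term n w N :: 'k epoly) \<subseteq> {1..n} \<times> Mon m"
    by (intro pvars_times_le) auto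
qed

lemma e_pvars: "1 \<le> r \<Longrightarrow> pvars (e n r w) \<subseteq> {1..n} \<times> {w}"
  using pvars_simps(5)[of "{#(r, w)#}"] by (auto simp: e_def pvars_simps pvar_def)

lemma peval_f_poly_pvars:
  "pvars (peval of_int (\<lambda>r. e n r w) (f_poly n j k) :: 'k::comm_ring_1 epoly) \<subseteq> {1..n} \<times> {w}" if "k \<ge> 1"
  unfolding peval_def
proof (intro pvars_sum_le pvars_times_le)
  fix t assume t: "t \<in> Poly_Mapping.keys (f_poly n j k)"
  show "pvars (of_int (Poly_Mapping.lookup (f_poly n j k) t) :: 'k epoly) \<subseteq> {1..n} \<times> {w}"
    by (simp add: of_int_pconst pvars_simps)
  have "set_mset t \<subseteq> {1..n}" using f_poly_spec[OF that, of n j] t by (auto simp: pvars_def)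
  then show "pvars (\<Prod>r\<in>#t. e n r w :: 'k epoly) \<subseteq> {1..n} \<times> {w}"
    by (intro pvars_prod_mset_le e_pvars) auto
qed

lemma repeat_Mon: "k \<ge> 1 \<Longrightarrow> w \<in> Mon m \<Longrightarrow> repeat_mset k w \<in> Mon m"
proof -
  have "set_mset (repeat_mset k w) \<subseteq> set_mset w" by (auto simp flip: count_greater_zero_iff)
  then show "k \<ge> 1 \<Longrightarrow> w \<in> Mon m \<Longrightarrow> repeat_mset k w \<in> Mon m"
    by (auto simp: Mon_def repeat_mset_eq_empty_iff)
qed

lemma Q_pvars:
  assumes "k \<ge> 1" "1 \<le> r" "w \<in> Mon m"
  shows "pvars (Q n r k w :: 'k::comm_ring_1 epoly) \<subseteq> {1..n} \<times> Mon m"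
proof -
  have "pvars (e n r (repeat_mset k w) :: 'k epoly) \<subseteq> {1..n} \<times> Mon m"
    using e_pvars[OF assms(2), of n "repeat_mset k w"] repeat_Mon[OF assms(1,3)] by blast
  moreover have "pvars (- peval of_int (\<lambda>r. e n r w) (f_poly n r k) :: 'k epoly) \<subseteq> {1..n} \<times> Mon m"
    using peval_f_poly_pvars[OF assms(1), of n w r] assms(3) by (auto simp: pvars_simps)
  ultimately show ?thesis unfolding Q_def diff_conv_add_uminus by (rule pvars_plus_le)
qed

text \<open>Transport of the identity for \<open>x\<close> along the substitution \<open>x\<^sub>j \<mapsto> w\<^bsub>\<langle>j\<rangle>\<^esub>\<close>.\<close>

lemma sigma_power:
  assumes "k \<ge> 1"
  shows "sigma n j (repeat_mset k w) =
    peval of_int (\<lambda>r. sigma n r w :: (nat \<times> nat, 'k::comm_ring_1) mpoly) (f_poly n j k)"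
proof -
  let ?\<theta> = "peval of_int (\<lambda>(i, j). pmon (place j w)) :: (nat \<times> nat, int) mpoly \<Rightarrow> (nat \<times> nat, 'k) mpoly"
  have hom: "?\<theta> (p + q) = ?\<theta> p + ?\<theta> q" "?\<theta> (p * q) = ?\<theta> p * ?\<theta> q" "?\<theta> (pconst c) = of_int c" "?\<theta> 0 = 0" "?\<theta> 1 = 1"
    for p q c
  proof -
    show c: "?\<theta> (pconst c) = of_int c" for c by (simp add: pconst_def peval_single)
    show "?\<theta> 0 = 0" "?\<theta> 1 = 1" using c[of 0] c[of 1] by simp_all
  qed (simp_all add: peval_add peval_mult)
  have sum: "?\<theta> (sum g X) = (\<Sum>x\<in>X. ?\<theta> (g x))" for g and X :: "'x set"
    by (induction X rule: infinite_finite_induct) (simp_all add: hom)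
  have prod: "?\<theta> (prod g X) = (\<Prod>x\<in>X. ?\<theta> (g x))" for g and X :: "nat set"
    by (induction X rule: infinite_finite_induct) (simp_all add: hom)
  have prod_mset: "?\<theta> (\<Prod>x\<in>#X. g x) = (\<Prod>x\<in>#X. ?\<theta> (g x))" for g and X :: "nat multiset"
    by (induction X) (simp_all add: hom)
  have pl: "?\<theta> (pmon (place j (replicate_mset k 1))) = pmon (place j (repeat_mset k w))" for j k
    by (induction k) (simp_all add: hom, simp add: pmon_def place_def peval_single mult_single hom)
  have \<sigma>: "?\<theta> (sigma n r (replicate_mset k 1)) = sigma n r (repeat_mset k w)" for r k
    by (simp only: sigma_def sum prod pl)
  have \<sigma>1: "?\<theta> (sigma n r {#1#}) = sigma n r w" for r using \<sigma>[of r 1] by simp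
  have "sigma n j (repeat_mset k w) = ?\<theta> (peval pconst (\<lambda>r. sigma n r {#1#}) (f_poly n j k))"
    using f_poly_spec[OF assms, of n j] \<sigma>[of j k] by simp
  also have "\<dots> = peval of_int (\<lambda>r. sigma n r w) (f_poly n j k)"
    by (simp add: peval_def[of pconst] sum hom prod_mset \<sigma>1[simplified]) (simp add: peval_def)
  finally show ?thesis .
qed

lemma phi_Q:
  assumes "k \<ge> 1"
  shows "phi n (Q n r k w :: 'k::comm_ring_1 epoly) = 0"
proof -
  have "phi n (pconst c * p) = pconst c * phi n p" for c and p :: "'k epoly" by (simp add: phi_simps)
  then have "phi n (peval of_int (\<lambda>r. e n r w) (f_poly n r k) :: 'k epoly) =
      peval of_int (\<lambda>r. sigma n r w) (f_poly n r k)"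
    unfolding peval_def phi_hom of_int_pconst by (simp add: phi_hom phi_e_all)
  then show ?thesis
    using sigma_power[OF assms, of n r w, where 'k = 'k]
    by (simp add: Q_def diff_conv_add_uminus phi_simps phi_hom phi_e_all del: add_uminus_conv_diff)
qed

section \<open>Reduction modulo the relations\<close>

lemma prod_atLeast1_nth:
  fixes g :: "'a \<Rightarrow> 'b::comm_monoid_mult"
  shows "(\<Prod>i=1..length xs. g (xs ! (i - 1))) = (\<Prod>x\<in>#mset xs. g x)"
proof (induction xs rule: rev_induct)
  case (snoc x xs)
  have "(\<Prod>i=1..length xs. g ((xs @ [x]) ! (i - 1))) = (\<Prod>i=1..length xs. g (xs ! (i - 1)))"
    by (rule prod.cong) (auto simp: nth_append)
  with snoc show ?case by (simp add: mult.commute)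
qed simp

lemma sum_atLeast1_nth:
  fixes g :: "'a \<Rightarrow> 'b::comm_monoid_add"
  shows "(\<Sum>i=1..length xs. g (xs ! (i - 1))) = (\<Sum>x\<in>#mset xs. g x)"
proof (induction xs rule: rev_induct)
  case (snoc x xs)
  have "(\<Sum>i=1..length xs. g ((xs @ [x]) ! (i - 1))) = (\<Sum>i=1..length xs. g (xs ! (i - 1)))"
    by (rule sum.cong) (auto simp: nth_append)
  with snoc show ?case by (simp add: add.commute)
qed simp

text \<open>A submultiset of least size among those exceeding n satisfies the two inequalities
  demanded of \<alpha> in the generators S.\<close>

lemma minimal_submultiset_exceeding:
  assumes "(\<Sum>x\<in>#t. f x) > (n :: nat)"
  obtains t' where "t' \<subseteq># t" "(\<Sum>x\<in>#t'. f x) > n" "\<And>x. x \<in># t' \<Longrightarrow> (\<Sum>x\<in>#t' - {#x#}. f x) \<le> n"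
proof -
  let ?P = "\<lambda>t'. t' \<subseteq># t \<and> (\<Sum>x\<in>#t'. f x) > n"
  obtain t' where t': "?P t'" "\<And>u. ?P u \<Longrightarrow> size t' \<le> size u"
    using ex_has_least_nat[of ?P t size] assms by auto
  have "(\<Sum>x\<in>#t' - {#x#}. f x) \<le> n" if x: "x \<in># t'" for x
  proof (rule ccontr)
    assume "\<not> (\<Sum>x\<in>#t' - {#x#}. f x) \<le> n"
    moreover have "t' - {#x#} \<subseteq># t" using t'(1) by (meson diff_subset_eq_self subset_mset.order_trans)
    ultimately have "size t' \<le> size (t' - {#x#})" by (intro t'(2)) auto
    moreover have "size (t' - {#x#}) < size t'" using x by (rule size_Diff1_less)
    ultimately show False by simp
  qed
  with t'(1) show ?thesis by (intro that) auto
qed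

text \<open>Injectivity of \<open>snd\<close> on the support does not see a repeated indeterminate,
  hence the separate condition on \<open>count\<close>.\<close>

definition normal_mon :: "nat \<Rightarrow> nat \<Rightarrow> (nat \<times> nat multiset) multiset \<Rightarrow> bool" where
  "normal_mon n m t \<longleftrightarrow> set_mset t \<subseteq> {1..n} \<times> Mon m \<and> inj_on snd (set_mset t) \<and>
    (\<forall>x\<in>#t. count t x = 1) \<and> (\<Sum>x\<in>#t. fst x) \<le> n"

lemma not_distinct_snd:
  assumes "\<not> (inj_on snd (set_mset t) \<and> (\<forall>x\<in>#t. count t x = 1))"
  obtains a b v t' where "t = add_mset (a, v) (add_mset (b, v) t')"
proof -
  have "\<exists>x y. {#x, y#} \<subseteq># t \<and> snd x = snd y"
  proof (cases "inj_on snd (set_mset t)")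
    case True
    with assms obtain x where x: "x \<in># t" "count t x \<noteq> 1" by blast
    then have "2 \<le> count t x" by (metis One_nat_def Suc_1 count_greater_eq_one_iff le_antisym not_less_eq_eq)
    then have "replicate_mset 2 x \<subseteq># t" by (simp add: count_le_replicate_mset_subset_eq)
    then show ?thesis by (intro exI[of _ x]) (simp add: numeral_2_eq_2)
  next
    case False
    then obtain x y where xy: "x \<in># t" "y \<in># t" "snd x = snd y" "x \<noteq> y" by (auto simp: inj_on_def)
    then have "{#x, y#} \<subseteq># t" by (auto simp: insert_subset_eq_iff simp flip: count_greater_zero_iff)
    with xy show ?thesis by blast
  qed
  then obtain x y where xy: "{#x, y#} \<subseteq># t" "snd x = snd y" by blast
  then obtain u where "t = {#x, y#} + u" by (auto simp: mset_subset_eq_exists_conv)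
  moreover obtain a v where x: "x = (a, v)" by (cases x)
  moreover obtain b where "y = (b, v)" using xy(2) x by (cases y) auto
  ultimately have "t = add_mset (a, v) (add_mset (b, v) u)" by simp
  then show ?thesis by (rule that)
qed

text \<open>Collects what the reduction uses of the generated ideal, in the ordinary operations on
  polynomials instead of those of the ring record.\<close>

locale syzygy_ideal =
  fixes n m :: nat and I :: "'k::comm_ring_1 epoly set"
  assumes I_zero: "0 \<in> I"
    and I_add: "a \<in> I \<Longrightarrow> b \<in> I \<Longrightarrow> a + b \<in> I"
    and I_mult: "a \<in> I \<Longrightarrow> pvars x \<subseteq> {1..n} \<times> Mon m \<Longrightarrow> a * x \<in> I"
    and I_carrier: "a \<in> I \<Longrightarrow> pvars a \<subseteq> {1..n} \<times> Mon m"
    and I_phi: "a \<in> I \<Longrightarrow> phi n a = 0"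
    and S_mem: "s \<ge> 2 \<Longrightarrow> (\<And>i. i \<in> {1..s} \<Longrightarrow> w i \<in> Mon m) \<Longrightarrow> (\<Sum>i=1..s. \<alpha> i) > n \<Longrightarrow>
      (\<And>j. j \<in> {1..s} \<Longrightarrow> (\<Sum>i\<in>{1..s} - {j}. \<alpha> i) \<le> n) \<Longrightarrow> S n s \<alpha> w \<in> I"
    and Q_mem: "v \<in> Mon m \<Longrightarrow> r \<in> {1..n} \<Longrightarrow> k \<ge> 2 \<Longrightarrow> real k < 1 + real n / real r \<Longrightarrow> Q n r k v \<in> I"
begin

section \<open>Reduction of e_r(w^k) to polynomials in the e_i(w)\<close>

definition mod_I :: "'k epoly set \<Rightarrow> 'k epoly set" where
  "mod_I Z = {i + z | i z. i \<in> I \<and> z \<in> Z}"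

lemma mod_I_add:
  assumes "\<And>y z. y \<in> Z \<Longrightarrow> z \<in> Z \<Longrightarrow> y + z \<in> Z" "p \<in> mod_I Z" "q \<in> mod_I Z"
  shows "p + q \<in> mod_I Z"
proof -
  obtain i y j z where "p = i + y" "q = j + z" "i \<in> I" "j \<in> I" "y \<in> Z" "z \<in> Z"
    using assms(2,3) by (auto simp: mod_I_def)
  moreover from this have "p + q = (i + j) + (y + z)" by (simp add: algebra_simps)
  ultimately show ?thesis unfolding mod_I_def using assms(1) I_add by blast
qed

definition power_span :: "nat multiset \<Rightarrow> 'k epoly set" where
  "power_span w = mod_I {q. pvars q \<subseteq> {1..n} \<times> {w}}"

lemma power_span_base: "pvars q \<subseteq> {1..n} \<times> {w} \<Longrightarrow> q \<in> power_span w"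
  unfolding power_span_def mod_I_def using I_zero by (intro CollectI exI[of _ 0] exI[of _ q]) simp

lemma power_span_add: "p \<in> power_span w \<Longrightarrow> q \<in> power_span w \<Longrightarrow> p + q \<in> power_span w"
  unfolding power_span_def by (rule mod_I_add) (simp_all add: pvars_plus_le)

lemma power_span_I: "p \<in> I \<Longrightarrow> p \<in> power_span w"
  unfolding power_span_def mod_I_def by (intro CollectI exI[of _ p] exI[of _ 0]) (simp add: pvars_simps)

lemma power_span_mult:
  assumes "w \<in> Mon m" "p \<in> power_span w" "q \<in> power_span w"
  shows "p * q \<in> power_span w"
proof -
  obtain i y j z where eq: "p = i + y" "q = j + z" "i \<in> I" "j \<in> I"
    and y: "pvars y \<subseteq> {1..n} \<times> {w}" and z: "pvars z \<subseteq> {1..n} \<times> {w}"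
    using assms(2,3) by (auto simp: power_span_def mod_I_def)
  have sub: "{1..n} \<times> {w} \<subseteq> {1..n} \<times> Mon m" using assms(1) by auto
  have "i * (j + z) + j * y \<in> I"
    using eq y z sub I_carrier by (intro I_add I_mult pvars_plus_le) auto
  moreover have "pvars (y * z) \<subseteq> {1..n} \<times> {w}" using y z by (rule pvars_times_le)
  moreover have "p * q = (i * (j + z) + j * y) + y * z" by (simp add: eq algebra_simps)
  ultimately show ?thesis unfolding power_span_def mod_I_def by blast
qed

lemma power_span_const: "pconst c \<in> power_span w" "(-1) ^ k \<in> power_span w" "1 \<in> power_span w" "0 \<in> power_span w" "of_nat c' \<in> power_span w"
proof -
  show *: "pconst c \<in> power_span w" for c by (intro power_span_base) (simp add: pvars_simps)
  show "(-1) ^ k \<in> power_span w" using *[of 1] *[of "-1"] by (cases "even k") (auto simp: pconst_uminus)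
  show "1 \<in> power_span w" "0 \<in> power_span w" using *[of 1] *[of 0] by simp_all
  show "of_nat c' \<in> power_span w" unfolding of_nat_pconst by (rule *)
qed

lemma power_span_sum: "(\<And>x. x \<in> X \<Longrightarrow> f x \<in> power_span w) \<Longrightarrow> sum f X \<in> power_span w"
  by (induction X rule: infinite_finite_induct) (auto intro: power_span_add power_span_const)

lemma power_span_prod: "w \<in> Mon m \<Longrightarrow> (\<And>x. x \<in> X \<Longrightarrow> f x \<in> power_span w) \<Longrightarrow> prod f X \<in> power_span w"
  by (induction X rule: infinite_finite_induct) (auto intro: power_span_mult power_span_const)

lemma power_span_uminus: "w \<in> Mon m \<Longrightarrow> p \<in> power_span w \<Longrightarrow> - p \<in> power_span w"
  using power_span_mult[OF _ power_span_const(2)[of 1], of w p] by simp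

text \<open>Since \<open>\<phi>\<close> kills \<open>I\<close> and is injective on \<open>K[e\<^sub>1(w), \<dots>, e\<^sub>n(w)]\<close>, its kernel meets
  \<open>I + K[e\<^sub>1(w), \<dots>, e\<^sub>n(w)]\<close> in \<open>I\<close>.\<close>

lemma power_span_kernel:
  assumes w: "w \<in> Mon m" and p: "p \<in> power_span w" and zero: "phi n p = 0"
  shows "p \<in> I"
proof -
  obtain i q where iq: "p = i + q" "i \<in> I" "pvars q \<subseteq> {1..n} \<times> {w}"
    using p by (auto simp: power_span_def mod_I_def)
  have "(case v of (r, w') \<Rightarrow> sigma n r w') = sigma n (fst v) w"
    if "t \<in> Poly_Mapping.keys q" "v \<in># t" for t v
    using that iq(3) by (fastforce simp: pvars_def)
  then have "phi n q = peval pconst (\<lambda>v. sigma n (fst v) w) q"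
    unfolding phi_def peval_def
    by (intro sum.cong refl arg_cong2[where f = "(*)"] arg_cong[where f = prod_mset] image_mset_cong)
  moreover have "phi n q = 0" using zero iq I_phi by (simp add: phi_simps)
  ultimately have "q = 0"
    using w iq(3) by (intro sigma_independent[of w q "{1..n} \<times> {w}" fst n]) (auto simp: Mon_def inj_on_def)
  with iq show ?thesis by simp
qed

text \<open>
  If \<open>r (k - 1) \<ge> n\<close> and \<open>p = n div r\<close>, the relation \<open>S\<^bsup>(pr, r)\<^esup>(w, w\<^bsup>k-p\<^esup>)\<close> contains \<open>e\<^sub>r(w\<^sup>k)\<close> with
  coefficient \<open>\<plusminus>1\<close>, because \<open>Y\<^sub>1\<^sup>p Y\<^sub>2\<close> is the only cyclic word of its content; all its other
  factors are \<open>e\<^sub>i(w\<^sup>l)\<close> with \<open>(i, l)\<close> lexicographically smaller than \<open>(r, k)\<close>, or \<open>e\<^sub>i(w)\<close>.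
\<close>

lemma e_power_mem_step:
  assumes w: "w \<in> Mon m" and r: "r \<in> {1..n}" and k: "k \<ge> 2" "\<not> real k < 1 + real n / real r"
    and IH1: "\<And>r' l. 1 \<le> r' \<Longrightarrow> r' < r \<Longrightarrow> 1 \<le> l \<Longrightarrow> e n r' (repeat_mset l w) \<in> power_span w"
    and IH2: "\<And>l. 1 \<le> l \<Longrightarrow> l < k \<Longrightarrow> e n r (repeat_mset l w) \<in> power_span w"
  shows "e n r (repeat_mset k w) \<in> power_span w"
proof -
  define p where "p = n div r"
  define d where "d = k - p"
  \<comment> \<open>The failed bound on k amounts to r (k - 1) >= n. It makes p <= k - 1, hence d >=
    1, so w^d is an admissible monomial.\<close>
  have "real n / real r \<le> real (k - 1)" using k by simp
  then have "real n \<le> real (r * (k - 1))" using r by (simp add: field_simps)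
  then have "n \<le> r * (k - 1)" by (simp only: of_nat_le_iff)
  then have "p \<le> k - 1" unfolding p_def
    using r by (metis atLeastAtMost_iff div_le_mono nonzero_mult_div_cancel_left not_one_le_zero)
  then have d: "1 \<le> d" "p + d = k" using k unfolding d_def by auto
  \<comment> \<open>p is the largest factor with p * r <= n. So the multidegree (p r, r) has a total
    above n, while each of its two entries is at most n.\<close>
  have pr: "p * r \<le> n" "n < p * r + r"
    unfolding p_def using r dividend_less_div_times[of r n] by (auto simp: add.commute)
  define \<alpha> where "\<alpha> = (\<lambda>i :: nat. if i = 1 then p * r else r)"
  define v where "v = (\<lambda>i :: nat. if i = 1 then w else repeat_mset d w)"
  let ?A = "replicate_mset (p * r) 1 + replicate_mset r (2 :: nat)"
  have two: "{1..2} = {1, 2 :: nat}" by auto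
  have vM: "v i \<in> Mon m" for i unfolding v_def using w d repeat_Mon by simp
  have "S n 2 \<alpha> v \<in> I"
  proof (rule S_mem)
    show "(\<Sum>i=1..2. \<alpha> i) > n" unfolding two \<alpha>_def using pr by simp
    show "(\<Sum>i\<in>{1..2} - {j}. \<alpha> i) \<le> n" if "j \<in> {1..2}" for j
    proof -
      from that consider "j = 1" | "j = 2" unfolding two by blast
      then show ?thesis
      proof cases
        case 1
        then have "{1..2} - {j} = {2}" unfolding two by auto
        then show ?thesis using r by (simp add: \<alpha>_def)
      next
        case 2
        then have "{1..2} - {j} = {1}" unfolding two by auto
        then show ?thesis using pr by (simp add: \<alpha>_def)
      qed
    qed
  qed (simp_all add: vM)
  moreover have "(\<Sum>i=1..2. replicate_mset (\<alpha> i) i) = ?A" unfolding two \<alpha>_def by simp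
  ultimately have neck_S: "neck_S n 2 ?A v \<in> power_span w" by (simp add: S_eq_neck_S power_span_I)
  define U0 where "U0 = cyc_rel `` {replicate p 1 @ [2 :: nat]}"
  let ?N0 = "replicate_mset r U0"
  have U0: "U0 \<in> W0 2" "spec U0 = add_mset 2 (replicate_mset p 1)"
    unfolding U0_def using reduced_ones_two by (auto intro!: W0_I)
  have "(\<Sum>U\<in>#replicate_mset l U0. spec U) = repeat_mset l (spec U0)" for l
    by (induction l) auto
  moreover have rep: "repeat_mset r (replicate_mset p 1) = replicate_mset (p * r) (1 :: nat)"
    by (intro multiset_eqI) simp
  ultimately have "(\<Sum>U\<in>#?N0. spec U) = ?A" by (simp add: U0(2))
  then have N0: "?N0 \<in> neck_msets 2 ?A" using U0(1) by (auto simp: neck_msets_def)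
  have subst: "subst_mon v u = repeat_mset (count u 1 + d * count u 2) w" if "set_mset u \<subseteq> {1, 2}" for u
    using that
  proof (induction u)
    case (add i u)
    then show ?case by (auto simp: subst_mon_def v_def repeat_mset_distrib algebra_simps)
  qed (simp add: subst_mon_def)
  have term0: "neck_term n v ?N0 = e n r (repeat_mset k w)"
  proof -
    have "subst_mon v (spec U0) = repeat_mset (count (spec U0) 1 + d * count (spec U0) 2) w"
      unfolding U0(2) by (rule subst) auto
    then have "subst_mon v (spec U0) = repeat_mset k w" using d by (simp add: U0(2))
    then show ?thesis using r by (simp add: neck_term_def)
  qed
  have rest: "neck_term n v N \<in> power_span w" if N: "N \<in> neck_msets 2 ?A" "N \<noteq> ?N0" for N
    unfolding neck_term_def
  proof (rule power_span_prod[OF w])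
    fix U assume U: "U \<in> set_mset N"
    define c where "c = count N U"
    let ?u = "spec U"
    have c1: "1 \<le> c" using U by (simp add: c_def Suc_le_eq)
    have UW: "U \<in> W0 2" using N U by (auto simp: neck_msets_def)
    then have u: "set_mset ?u \<subseteq> {1, 2}" "?u \<noteq> {#}" using W0_spec[OF UW] unfolding Mon_def two by auto
    have le: "repeat_mset c ?u \<subseteq># ?A" unfolding c_def by (rule neck_msets_repeat_le[OF N(1)])
    have le1: "c * count ?u 1 \<le> p * r" and le2: "c * count ?u 2 \<le> r"
      using mset_subset_eq_count[OF le, of 1] mset_subset_eq_count[OF le, of 2] by simp_all
    \<comment> \<open>A necklace without the letter 2 is the single letter 1 and gives e_c(w).
      Otherwise each of its c copies uses one of the r available letters 2, so c <= r.\<close>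
    have goal: "e n c (repeat_mset (count ?u 1 + d * count ?u 2) w) \<in> power_span w"
    proof (cases "count ?u 2 = 0")
      case True
      obtain V where V: "U = cyc_rel `` {V}" "V \<noteq> []" "reduced V" using UW by (rule W0_E)
      then have "set V \<subseteq> {1, 2}" "2 \<notin> set V" using u True by (auto simp: count_eq_zero_iff)
      then have "set V \<subseteq> {1}" by blast
      then have "V = [1]" by (rule reduced_replicate_same[OF V(3,2)])
      then have "?u = {#1#}" using V by simp
      then show ?thesis using power_span_base[OF e_pvars[OF c1, of n w]] by simp
    next
      case False
      let ?l = "count ?u 1 + d * count ?u 2"
      have l1: "1 \<le> ?l" using False d by (simp add: Suc_le_eq)
      have "c * 1 \<le> c * count ?u 2" using False by (intro mult_le_mono) auto
      then have "c \<le> r" using le2 by linarith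
      then consider "c < r" | "c = r" by linarith
      then show ?thesis
      proof cases
        case 1
        then show ?thesis using IH1[OF c1 _ l1] by simp
      next
        \<comment> \<open>With c = r each copy has exactly one letter 2 and at most p ones. Exactly
          p ones would exhaust the content and make N the excluded multiset, so the exponent of w
          stays below p + d = k.\<close>
        case 2
        then have "r * count ?u 2 \<le> r * 1" using le2 by simp
        then have "count ?u 2 \<le> 1" using r by simp
        then have u2: "count ?u 2 = 1" using False by linarith
        have "r * count ?u 1 \<le> r * p" using le1 2 by (simp add: mult.commute)
        then have u1: "count ?u 1 \<le> p" using r by (simp only: mult_le_cancel1) auto
        have "count ?u 1 \<noteq> p"
        proof
          assume up: "count ?u 1 = p"
          have "?u = add_mset 2 (replicate_mset p 1)"
          proof (rule multiset_eqI)
            fix x :: nat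
            consider "x = 1" | "x = 2" | "x \<noteq> 1" "x \<noteq> 2" by blast
            then show "count ?u x = count (add_mset 2 (replicate_mset p 1)) x"
              using up u2 u(1) by cases (auto simp: count_eq_zero_iff)
          qed
          then have UU0: "U = U0" unfolding U0_def by (rule class_ones_two[OF UW])
          have "repeat_mset (count N U) (spec U) = ?A"
            using 2 c_def \<open>?u = add_mset 2 (replicate_mset p 1)\<close> rep by simp
          then have "N = replicate_mset (count N U) U" by (rule neck_msets_repeat_eq[OF N(1)])
          then show False using N(2) UU0 2 c_def by simp
        qed
        with u1 u2 d l1 have "?l < k" by simp
        then show ?thesis using IH2[OF l1] 2 by simp
      qed
    qed
    show "e n (count N U) (subst_mon v ?u) \<in> power_span w"
      using goal subst[OF u(1)] by (simp add: c_def)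
  qed
  let ?sg = "\<lambda>N. (-1) ^ (size ?A + size N) :: 'k epoly"
  let ?R = "\<Sum>N\<in>neck_msets 2 ?A - {?N0}. ?sg N * neck_term n v N"
  have "neck_S n 2 ?A v = ?sg ?N0 * neck_term n v ?N0 + ?R"
    unfolding neck_S_def by (rule sum.remove[OF finite_neck_msets N0])
  \<comment> \<open>The sign is its own inverse, so e_r(w^k) is isolated without division.\<close>
  then have "?sg ?N0 * (neck_S n 2 ?A v + - ?R) = (?sg ?N0 * ?sg ?N0) * neck_term n v ?N0"
    by (simp add: algebra_simps)
  moreover have "?sg ?N0 * ?sg ?N0 = 1" by (simp add: power_add[symmetric])
  ultimately have "e n r (repeat_mset k w) = ?sg ?N0 * (neck_S n 2 ?A v + - ?R)" by (simp add: term0)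
  moreover have "?R \<in> power_span w" using rest by (intro power_span_sum power_span_mult[OF w] power_span_const) auto
  ultimately show ?thesis
    using neck_S by (simp only:) (intro power_span_mult[OF w] power_span_add power_span_uminus[OF w] power_span_const)
qed

text \<open>Lexicographic induction on (r, k). The generators Q serve for k below 1 + n/r, the
  relations S with two arguments for k from there on.\<close>

lemma e_power_mem:
  assumes w: "w \<in> Mon m"
  shows "1 \<le> r \<Longrightarrow> 1 \<le> k \<Longrightarrow> e n r (repeat_mset k w) \<in> power_span w"
proof (induction r arbitrary: k rule: less_induct)
  case (less r)
  note IH1 = less.IH and r = less.prems(1)
  show ?case using less.prems(2)
  proof (induction k rule: less_induct)
    case (less k)
    consider "r > n" | "k = 1" | "r \<in> {1..n}" "k \<ge> 2" "real k < 1 + real n / real r"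
      | "r \<in> {1..n}" "k \<ge> 2" "\<not> real k < 1 + real n / real r"
      using r less.prems by fastforce
    then show ?case
    proof cases
      case 1
      then show ?thesis by (simp add: e_def power_span_const)
    next
      case 2
      then show ?thesis using power_span_base[OF e_pvars[OF r, of n w]] by simp
    next
      case 3
      have "e n r (repeat_mset k w) = Q n r k w + peval of_int (\<lambda>r. e n r w) (f_poly n r k)"
        by (simp add: Q_def)
      also have "\<dots> \<in> power_span w"
        using Q_mem[OF w 3] peval_f_poly_pvars[of k n w r] less.prems
        by (intro power_span_add power_span_I power_span_base)
      finally show ?thesis .
    next
      case 4
      show ?thesis
      proof (rule e_power_mem_step[OF w 4])
        show "e n r' (repeat_mset l w) \<in> power_span w" if "1 \<le> r'" "r' < r" "1 \<le> l" for r' l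
          by (rule IH1[OF that(2,1,3)])
        show "e n r (repeat_mset l w) \<in> power_span w" if "1 \<le> l" "l < k" for l
          by (rule less.IH[OF that(2,1)])
      qed
    qed
  qed
qed

text \<open>Only powers of v are substituted, so both terms lie in I + K[e_1(v), ..., e_n(v)], where
  an element killed by \<phi> is already in I. It thus suffices to compare images under
  \<phi>.\<close>

lemma neck_S_same_mod:
  assumes v: "v \<in> Mon m" and ab: "1 \<le> a" "1 \<le> b"
  shows "neck_S n 2 (replicate_mset a 1 + replicate_mset b 2) (\<lambda>_. v) - of_nat ((a + b) choose a) * e n (a + b) v \<in> I"
proof (rule power_span_kernel[OF v])
  let ?A = "replicate_mset a 1 + replicate_mset b (2 :: nat)"
  show "phi n (neck_S n 2 ?A (\<lambda>_. v) - of_nat ((a + b) choose a) * e n (a + b) v) = 0"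
    unfolding diff_conv_add_uminus
    by (simp add: phi_simps phi_hom phi_neck_S_same[simplified] phi_e_all del: add_uminus_conv_diff) 
  have mem: "neck_term n (\<lambda>_. v) N \<in> power_span v" if N: "N \<in> neck_msets 2 ?A" for N
    unfolding neck_term_def subst_mon_const
  proof (intro power_span_prod[OF v] e_power_mem[OF v])
    fix U assume "U \<in> set_mset N"
    moreover from this have "spec U \<noteq> {#}" using N by (intro W0_spec_nonempty) (auto simp: neck_msets_def)
    ultimately show "1 \<le> count N U" "1 \<le> size (spec U)" by (auto simp: Suc_le_eq nonempty_has_size)
  qed
  have "neck_S n 2 ?A (\<lambda>_. v) \<in> power_span v"
    unfolding neck_S_def using mem by (intro power_span_sum power_span_mult[OF v] power_span_const)
  moreover have "- (of_nat ((a + b) choose a) * e n (a + b) v) \<in> power_span v"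
    using e_pvars[of "a + b" n v] ab by (intro power_span_uminus[OF v] power_span_mult[OF v] power_span_const power_span_base) auto
  ultimately show "neck_S n 2 ?A (\<lambda>_. v) - of_nat ((a + b) choose a) * e n (a + b) v \<in> power_span v"
    unfolding diff_conv_add_uminus by (rule power_span_add)
qed

section \<open>Reduction of arbitrary products to normal monomials\<close>

definition normal_span :: "'k epoly set" where
  "normal_span = mod_I {q. \<forall>t\<in>Poly_Mapping.keys q. normal_mon n m t}"

lemma normal_span_add: "p \<in> normal_span \<Longrightarrow> q \<in> normal_span \<Longrightarrow> p + q \<in> normal_span"
  unfolding normal_span_def
proof (rule mod_I_add)
  fix y z :: "'k epoly"
  assume "y \<in> {q. \<forall>t\<in>Poly_Mapping.keys q. normal_mon n m t}" "z \<in> {q. \<forall>t\<in>Poly_Mapping.keys q. normal_mon n m t}"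
  then show "y + z \<in> {q. \<forall>t\<in>Poly_Mapping.keys q. normal_mon n m t}" using keys_add[of y z] by auto
qed

lemma normal_span_I: "p \<in> I \<Longrightarrow> p \<in> normal_span"
  unfolding normal_span_def mod_I_def by (intro CollectI exI[of _ p] exI[of _ 0]) simp

lemma normal_span_sum: "(\<And>x. x \<in> X \<Longrightarrow> f x \<in> normal_span) \<Longrightarrow> sum f X \<in> normal_span"
  by (induction X rule: infinite_finite_induct) (auto intro: normal_span_add normal_span_I I_zero)

lemma normal_span_normal: "normal_mon n m t \<Longrightarrow> pmon t \<in> normal_span"
  unfolding normal_span_def mod_I_def using I_zero keys_pmon[of t, where 'k = 'k]
  by (intro CollectI exI[of _ 0] exI[of _ "pmon t"]) auto

lemma normal_span_const_mult: 
  assumes "p \<in> normal_span" shows "pconst c * p \<in> normal_span"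
proof -
  obtain i q where iq: "p = i + q" "i \<in> I" "\<forall>t\<in>Poly_Mapping.keys q. normal_mon n m t"
    using assms by (auto simp: normal_span_def mod_I_def)
  have "i * pconst c \<in> I" using iq(2) by (intro I_mult) (simp_all add: pvars_simps)
  moreover have "Poly_Mapping.keys (pconst c * q) \<subseteq> Poly_Mapping.keys q"
    by (auto simp: in_keys_iff pconst_def lookup_times_const)
  moreover have "pconst c * p = i * pconst c + pconst c * q" by (simp add: iq(1) algebra_simps)
  ultimately show ?thesis unfolding normal_span_def mod_I_def using iq(3) by blast
qed

lemma sign_pconst: "(-1) ^ k = pconst ((-1) ^ k)"
  by (cases "even k") (simp_all add: pconst_uminus)

text \<open>The step shared by both reductions. \<open>neck_S\<close> differs from its main term
  \<open>pmon t1\<close> by products of smaller total index, which remain smaller after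
  multiplication by \<open>pmon t2\<close> and fall under the induction hypothesis; only the
  multiple of \<open>neck_S\<close> itself must be treated separately.\<close>

lemma normal_span_via_neck_S:
  assumes A: "set_mset A \<subseteq> {1..s}" and w: "\<And>i. i \<in> {1..s} \<Longrightarrow> w i \<in> Mon m"
    and main: "(\<Prod>i\<in>set_mset A. e n (count A i) (w i)) = (pmon t1 :: 'k epoly)" and sz: "size A = (\<Sum>x\<in>#t1. fst x)"
    and t2: "set_mset t2 \<subseteq> {1..n} \<times> Mon m"
    and neck_S: "neck_S n s A w * pmon t2 \<in> normal_span"
    and IH: "\<And>u. set_mset u \<subseteq> {1..n} \<times> Mon m \<Longrightarrow> (\<Sum>x\<in>#u. fst x) < (\<Sum>x\<in>#t1 + t2. fst x) \<Longrightarrow> pmon u \<in> normal_span"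
  shows "pmon (t1 + t2) \<in> normal_span"
proof -
  let ?X = "neck_msets s A - {image_mset (\<lambda>i. {[i]}) A}"
  let ?sg = "\<lambda>N. (-1) ^ (size A + size N) :: 'k epoly"
  have "neck_S n s A w = pmon t1 + (\<Sum>N\<in>?X. ?sg N * neck_term n w N)"
    using neck_S_main_term(1)[OF A, of n w, where 'a = 'k] unfolding main .
  then have "pmon (t1 + t2) = neck_S n s A w * pmon t2 + (\<Sum>N\<in>?X. pconst (-1) * (?sg N * (neck_term n w N * pmon t2)))"
    by (simp add: algebra_simps sum_distrib_left sum_negf pconst_uminus)
  also have "\<dots> \<in> normal_span"
  proof (intro normal_span_add neck_S normal_span_sum)
    fix N assume N: "N \<in> ?X"
    have "neck_term n w N * pmon t2 \<in> normal_span"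
    proof (rule neck_term_cases[of N s A w m n, where 'a = 'k])
      show "N \<in> neck_msets s A" using N by simp
      show "w i \<in> Mon m" if "i \<in> {1..s}" for i using w that .
    next
      assume "neck_term n w N = (0 :: 'k epoly)"
      then show ?thesis by (simp add: normal_span_I I_zero)
    next
      fix u assume u: "neck_term n w N = (pmon u :: 'k epoly)" "set_mset u \<subseteq> {1..n} \<times> Mon m" "(\<Sum>x\<in>#u. fst x) = size N"
      have "size N < size A" using neck_S_main_term(2)[OF A N] .
      then have "pmon (u + t2) \<in> normal_span" using u t2 sz by (intro IH) auto
      then show ?thesis using u(1) by simp
    qed
    then show "pconst (-1) * (?sg N * (neck_term n w N * pmon t2)) \<in> normal_span"
      unfolding sign_pconst by (intro normal_span_const_mult)
  qed
  finally show ?thesis .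
qed

text \<open>The measure is the total index, then the number of factors. If the total exceeds n, a
  generator S is used. If it does not but some w is repeated, e_a(w) e_b(w) is traded for a multiple
  of e_{a+b}(w), which keeps the total and saves a factor.\<close>

lemma pmon_mem_normal_span: "set_mset t \<subseteq> {1..n} \<times> Mon m \<Longrightarrow> pmon t \<in> normal_span"
proof (induction t rule: wf_induct_rule[OF wf_measures[of "[\<lambda>t. \<Sum>x\<in>#t. fst x, size]"]])
  case (1 t)
  note t = "1.prems"
  have IH: "pmon u \<in> normal_span" if "set_mset u \<subseteq> {1..n} \<times> Mon m"
    "(\<Sum>x\<in>#u. fst x) < (\<Sum>x\<in>#t. fst x) \<or> (\<Sum>x\<in>#u. fst x) = (\<Sum>x\<in>#t. fst x) \<and> size u < size t" for u
    using "1.IH"[of u] that by auto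
  consider "(\<Sum>x\<in>#t. fst x) > n" | "(\<Sum>x\<in>#t. fst x) \<le> n" "\<not> normal_mon n m t" | "normal_mon n m t"
    by linarith
  then show ?case
  proof cases
    case 1
    \<comment> \<open>The relation is applied to a minimal part \<open>t1\<close>, since all of
      \<open>t\<close> need not satisfy the upper bounds on the partial sums.\<close>
    then obtain t1 where t1: "t1 \<subseteq># t" "(\<Sum>x\<in>#t1. fst x) > n"
      "\<And>x. x \<in># t1 \<Longrightarrow> (\<Sum>x\<in>#t1 - {#x#}. fst x) \<le> n"
      by (rule minimal_submultiset_exceeding) blast
    define t2 where "t2 = t - t1"
    have tt: "t = t1 + t2" using t1(1) by (simp add: t2_def)
    have t1s: "set_mset t1 \<subseteq> {1..n} \<times> Mon m" and t2s: "set_mset t2 \<subseteq> {1..n} \<times> Mon m"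
      using t tt by auto
    obtain xs where xs: "mset xs = t1" using ex_mset by blast
    let ?s = "length xs"
    define \<alpha> where "\<alpha> i = fst (xs ! (i - 1))" for i
    define w where "w i = snd (xs ! (i - 1))" for i
    have nth: "xs ! (i - 1) \<in># t1" if "i \<in> {1..?s}" for i
      using that xs by (auto simp: in_multiset_in_set nth_mem simp flip: xs)
    have \<alpha>: "\<alpha> i \<in> {1..n}" and w: "w i \<in> Mon m" if "i \<in> {1..?s}" for i
      using nth[OF that] t1s by (auto simp: \<alpha>_def w_def)
    have sum_\<alpha>: "(\<Sum>i=1..?s. \<alpha> i) = (\<Sum>x\<in>#t1. fst x)"
      unfolding \<alpha>_def sum_atLeast1_nth xs ..
    let ?A = "\<Sum>i=1..?s. replicate_mset (\<alpha> i) i"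
    have cA: "count ?A i = (if i \<in> {1..?s} then \<alpha> i else 0)" for i by (simp add: count_sum)
    have setA: "set_mset ?A = {1..?s}"
    proof (rule Set.set_eqI)
      fix i
      have "i \<in># ?A \<longleftrightarrow> count ?A i \<noteq> 0" by (simp only: count_eq_zero_iff not_not)
      then show "i \<in># ?A \<longleftrightarrow> i \<in> {1..?s}" unfolding cA using \<alpha>[of i] by auto
    qed
    have "S n ?s \<alpha> w \<in> I"
    proof (rule S_mem)
      show "(\<Sum>i=1..?s. \<alpha> i) > n" using sum_\<alpha> t1(2) by simp
      show "w i \<in> Mon m" if "i \<in> {1..?s}" for i using w that .
      show "(\<Sum>i\<in>{1..?s} - {j}. \<alpha> i) \<le> n" if j: "j \<in> {1..?s}" for j
      proof -
        have "(\<Sum>i=1..?s. \<alpha> i) = \<alpha> j + (\<Sum>i\<in>{1..?s} - {j}. \<alpha> i)" using j by (intro sum.remove) auto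
        moreover have "(\<Sum>x\<in>#t1. fst x) = \<alpha> j + (\<Sum>x\<in>#t1 - {#xs ! (j - 1)#}. fst x)"
        proof -
          have "t1 = add_mset (xs ! (j - 1)) (t1 - {#xs ! (j - 1)#})" using nth[OF j] by simp
          then have "(\<Sum>x\<in>#t1. fst x) = (\<Sum>x\<in>#add_mset (xs ! (j - 1)) (t1 - {#xs ! (j - 1)#}). fst x)"
            by (rule arg_cong)
          then show ?thesis unfolding image_mset_add_mset sum_mset.add_mset \<alpha>_def .
        qed
        ultimately show ?thesis using t1(3)[OF nth[OF j]] sum_\<alpha> by simp
      qed
      \<comment> \<open>A single factor has index at most n and cannot exceed n by itself.\<close>
      show "2 \<le> ?s"
      proof (rule ccontr)
        assume "\<not> 2 \<le> ?s"
        then have "?s = 0 \<or> ?s = 1" by linarith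
        then show False using sum_\<alpha> t1(2) \<alpha>[of 1] xs by auto
      qed
    qed
    then have "neck_S n ?s ?A w * pmon t2 \<in> I"
      unfolding S_eq_neck_S using t2s pvars_simps(5)[of t2, where 'k = 'k] by (intro I_mult) auto
    then have neck_S: "neck_S n ?s ?A w * pmon t2 \<in> normal_span" by (rule normal_span_I)
    have main: "(\<Prod>i\<in>set_mset ?A. e n (count ?A i) (w i)) = (pmon t1 :: 'k epoly)"
    proof -
      have "(\<Prod>i\<in>set_mset ?A. e n (count ?A i) (w i)) = (\<Prod>i=1..?s. pvar (xs ! (i - 1)) :: 'k epoly)"
        unfolding setA
      proof (rule prod.cong[OF refl])
        fix i assume i: "i \<in> {1..?s}"
        have "count ?A i = \<alpha> i" unfolding cA using i by simp
        then show "e n (count ?A i) (w i) = (pvar (xs ! (i - 1)) :: 'k epoly)"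
          using \<alpha>[OF i] by (simp add: e_def \<alpha>_def w_def)
      qed
      also have "\<dots> = pmon t1" using prod_mset_pvar[of "\<lambda>x. x" t1] unfolding prod_atLeast1_nth xs by simp
      finally show ?thesis .
    qed
    have "size ?A = (\<Sum>x\<in>#t1. fst x)" using sum_\<alpha> by simp
    then show ?thesis unfolding tt
      using setA w main neck_S t2s IH by (intro normal_span_via_neck_S[of ?A ?s w]) (auto simp: tt)
  next
    case 2
    then have "\<not> (inj_on snd (set_mset t) \<and> (\<forall>x\<in>#t. count t x = 1))"
      using t by (auto simp: normal_mon_def)
    then obtain a b v t2 where "t = add_mset (a, v) (add_mset (b, v) t2)" by (rule not_distinct_snd)
    then have tt: "t = {#(a, v), (b, v)#} + t2" by simp
    have ab: "a \<in> {1..n}" "b \<in> {1..n}" and v: "v \<in> Mon m" and t2s: "set_mset t2 \<subseteq> {1..n} \<times> Mon m"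
      using t tt by auto
    have abn: "a + b \<le> n" using 2(1) tt by simp
    let ?A = "replicate_mset a 1 + replicate_mset b (2 :: nat)"
    let ?c = "(a + b) choose a"
    have setA: "set_mset ?A = {1, 2}" using ab by auto
    have main: "(\<Prod>i\<in>set_mset ?A. e n (count ?A i) ((\<lambda>_. v) i)) = (pmon {#(a, v), (b, v)#} :: 'k epoly)"
      unfolding setA using ab by (simp add: e_def pvar_def add_mset_commute flip: pmon_simps(2))
    have "(neck_S n 2 ?A (\<lambda>_. v) - of_nat ?c * e n (a + b) v) * pmon t2 \<in> I"
      using neck_S_same_mod[OF v, of a b] ab t2s pvars_simps(5)[of t2, where 'k = 'k] by (intro I_mult) auto
    then have 1: "(neck_S n 2 ?A (\<lambda>_. v) - of_nat ?c * e n (a + b) v) * pmon t2 \<in> normal_span" by (rule normal_span_I)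
    \<comment> \<open>The merged product has the same total index, so the second component of the
      measure decides here.\<close>
    have "pmon (add_mset (a + b, v) t2) \<in> normal_span"
      using ab v t2s abn by (intro IH) (auto simp: tt)
    then have "pconst (of_nat ?c) * pmon (add_mset (a + b, v) t2) \<in> normal_span" by (rule normal_span_const_mult)
    moreover have "pmon (add_mset (a + b, v) t2) = (e n (a + b) v * pmon t2 :: 'k epoly)"
      using abn by (simp add: e_def pvar_def flip: pmon_simps(2))
    ultimately have 2: "pconst (of_nat ?c) * (e n (a + b) v * pmon t2) \<in> normal_span" by simp
    have "(neck_S n 2 ?A (\<lambda>_. v) * pmon t2 :: 'k epoly) =
        (neck_S n 2 ?A (\<lambda>_. v) - of_nat ?c * e n (a + b) v) * pmon t2 + pconst (of_nat ?c) * (e n (a + b) v * pmon t2)"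
      by (simp add: algebra_simps flip: of_nat_pconst)
    then have "neck_S n 2 ?A (\<lambda>_. v) * pmon t2 \<in> normal_span" using normal_span_add[OF 1 2] by (simp only:)
    then show ?thesis unfolding tt
      using main v t2s IH setA by (intro normal_span_via_neck_S[of ?A 2 "\<lambda>_. v"]) (auto simp: tt)
  next
    case 3
    then show ?thesis by (rule normal_span_normal)
  qed
qed

lemma carrier_normal_span:
  assumes "pvars p \<subseteq> {1..n} \<times> Mon m"
  shows "p \<in> normal_span"
proof -
  have "p = (\<Sum>t\<in>Poly_Mapping.keys p. pconst (Poly_Mapping.lookup p t) * pmon t)"
    using mpoly_sum_single[of p] by (simp add: pconst_def pmon_def mult_single)
  also have "\<dots> \<in> normal_span"
    using assms by (intro normal_span_sum normal_span_const_mult pmon_mem_normal_span) (auto simp: pvars_def)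
  finally show ?thesis .
qed

end

section \<open>Independence of the normal monomials\<close>

definition slot :: "nat \<Rightarrow> (nat \<times> nat) multiset \<Rightarrow> nat multiset" where
  "slot j t = image_mset fst (filter_mset (\<lambda>x. snd x = j) t)"

lemma slot_sum: "slot j (\<Sum>x\<in>X. f x) = (\<Sum>x\<in>X. slot j (f x))"
  by (induction X rule: infinite_finite_induct) (auto simp: slot_def)

lemma slot_place: "slot j (place j' w) = (if j = j' then w else {#})"
  by (induction w) (auto simp: slot_def place_def)

text \<open>A general monomial in the product of the sigma_r(w) over the pairs (r, w) in T: for each
  pair, a copy of w is put on every place of the chosen set.\<close>

definition placed :: "(nat \<times> nat multiset) set \<Rightarrow> (nat \<times> nat multiset \<Rightarrow> nat set) \<Rightarrow> (nat \<times> nat) multiset" where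
  "placed T g = (\<Sum>x\<in>T. \<Sum>j\<in>g x. place j (snd x))"

lemma slot_placed:
  assumes "\<And>x. x \<in> T \<Longrightarrow> finite (g x)"
  shows "slot j (placed T g) = (\<Sum>x\<in>T. if j \<in> g x then snd x else {#})"
  unfolding placed_def slot_sum slot_place using assms by (intro sum.cong) auto

lemma slot_placed_nonempty:
  assumes "finite T" "\<And>x. x \<in> T \<Longrightarrow> finite (g x) \<and> snd x \<noteq> {#}"
  shows "slot j (placed T g) \<noteq> {#} \<longleftrightarrow> j \<in> (\<Union>x\<in>T. g x)"
  using assms by (subst slot_placed) (auto simp: sum_eq_empty_iff)

lemma slot_placed_disjoint:
  assumes "finite T" "\<And>x. x \<in> T \<Longrightarrow> finite (g x)"
    and "\<And>x y. x \<in> T \<Longrightarrow> y \<in> T \<Longrightarrow> x \<noteq> y \<Longrightarrow> g x \<inter> g y = {}"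
    and "x \<in> T" "j \<in> g x"
  shows "slot j (placed T g) = snd x"
proof -
  have "slot j (placed T g) = (\<Sum>y\<in>T. if j \<in> g y then snd y else {#})"
    by (rule slot_placed) (rule assms(2))
  also have "\<dots> = (\<Sum>y\<in>T. if y = x then snd x else {#})"
  proof (rule sum.cong[OF refl])
    fix y assume "y \<in> T"
    then have "j \<in> g y \<longleftrightarrow> y = x" using assms(3)[of y x] assms(4,5) by blast
    then show "(if j \<in> g y then snd y else {#}) = (if y = x then snd x else {#})" by simp
  qed
  finally have "slot j (placed T g) = (\<Sum>y\<in>T. if y = x then snd x else {#})" .
  then show ?thesis using assms(1,4) by simp
qed

text \<open>A common point would be counted twice, making the union strictly smaller than the sum of
  the sizes.\<close>

lemma disjoint_of_card_Union:
  assumes "finite T" "\<And>x. x \<in> T \<Longrightarrow> finite (g x)" "(\<Sum>x\<in>T. card (g x)) \<le> card (\<Union>x\<in>T. g x)"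
    and xy: "x \<in> T" "y \<in> T" "x \<noteq> y"
  shows "g x \<inter> g y = {}"
proof (rule ccontr)
  assume "g x \<inter> g y \<noteq> {}"
  then obtain j where j: "j \<in> g x" "j \<in> g y" by blast
  have "(\<Union>x\<in>T. g x) = (\<Union>z\<in>T - {x}. g z) \<union> (g x - {j})" using xy j by blast
  then have "card (\<Union>x\<in>T. g x) \<le> card (\<Union>z\<in>T - {x}. g z) + card (g x - {j})"
    by (simp add: card_Un_le)
  also have "\<dots> \<le> (\<Sum>z\<in>T - {x}. card (g z)) + card (g x - {j})"
    using assms(1) by (intro add_right_mono card_UN_le) auto
  also have "\<dots> < (\<Sum>z\<in>T - {x}. card (g z)) + card (g x)"
    using j(1) assms(2)[OF xy(1)] by (intro add_strict_left_mono card_Diff1_less) auto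
  also have "\<dots> = (\<Sum>x\<in>T. card (g x))"
    using assms(1) xy(1) by (simp add: sum.remove)
  finally show False using assms(3) by simp
qed

text \<open>The monomial shows which places are occupied. As T has no larger total index than T0,
  covering the same places forces the sets \<open>g x\<close> to be disjoint as well. Then each
  place shows a single w, the w within T and within T0 are distinct, and so \<open>g x\<close> is
  the set of places showing \<open>snd x\<close>.\<close>

lemma placed_inject:
  assumes fin: "finite T" "finite T0"
    and T: "\<And>x. x \<in> T \<Longrightarrow> finite (g x) \<and> card (g x) = fst x \<and> 1 \<le> fst x \<and> snd x \<noteq> {#}"
    and T0: "\<And>x. x \<in> T0 \<Longrightarrow> finite (g0 x) \<and> card (g0 x) = fst x \<and> 1 \<le> fst x \<and> snd x \<noteq> {#}"
    and inj: "inj_on snd T" "inj_on snd T0"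
    and disj0: "\<And>x y. x \<in> T0 \<Longrightarrow> y \<in> T0 \<Longrightarrow> x \<noteq> y \<Longrightarrow> g0 x \<inter> g0 y = {}"
    and le: "(\<Sum>x\<in>T. fst x) \<le> (\<Sum>x\<in>T0. fst x)"
    and eq: "placed T g = placed T0 g0"
  shows "T = T0 \<and> (\<forall>x\<in>T0. g x = g0 x)"
proof -
  have U: "(\<Union>x\<in>T. g x) = (\<Union>x\<in>T0. g0 x)"
  proof (rule Set.set_eqI)
    fix j
    have "j \<in> (\<Union>x\<in>T. g x) \<longleftrightarrow> slot j (placed T g) \<noteq> {#}"
      using T by (intro slot_placed_nonempty[symmetric] fin) simp
    moreover have "j \<in> (\<Union>x\<in>T0. g0 x) \<longleftrightarrow> slot j (placed T0 g0) \<noteq> {#}"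
      using T0 by (intro slot_placed_nonempty[symmetric] fin) simp
    ultimately show "j \<in> (\<Union>x\<in>T. g x) \<longleftrightarrow> j \<in> (\<Union>x\<in>T0. g0 x)" unfolding eq by simp
  qed
  have "(\<Sum>x\<in>T. card (g x)) = (\<Sum>x\<in>T. fst x)" using T by (intro sum.cong) auto
  also have "\<dots> \<le> (\<Sum>x\<in>T0. fst x)" by (rule le)
  also have "\<dots> = (\<Sum>x\<in>T0. card (g0 x))" using T0 by (intro sum.cong) auto
  also have "\<dots> = card (\<Union>x\<in>T0. g0 x)" using fin(2) T0 disj0 by (intro card_UN_disjoint[symmetric]) auto
  finally have disj: "g x \<inter> g y = {}" if "x \<in> T" "y \<in> T" "x \<noteq> y" for x y
    using that T fin(1) U by (intro disjoint_of_card_Union[of T]) auto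
  have slot: "slot j (placed T g) = snd x" if "x \<in> T" "j \<in> g x" for x j
    using that T disj fin(1) by (intro slot_placed_disjoint) auto
  have slot0: "slot j (placed T0 g0) = snd x" if "x \<in> T0" "j \<in> g0 x" for x j
    using that T0 disj0 fin(2) by (intro slot_placed_disjoint) auto
  have snd_eq: "snd x = snd y" if "x \<in> T" "j \<in> g x" "y \<in> T0" "j \<in> g0 y" for x y j
    using slot[of x j] slot0[of y j] that eq by simp
  have match: "x = y \<and> g x = g0 y" if xy: "x \<in> T" "y \<in> T0" "j \<in> g x" "j \<in> g0 y" for x y j
  proof -
    have sxy: "snd x = snd y" using snd_eq[of x j y] xy by simp
    have "i \<in> g0 y" if i: "i \<in> g x" for i
    proof -
      obtain y' where y': "y' \<in> T0" "i \<in> g0 y'" using U xy(1) i by blast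
      then have "snd y' = snd y" using snd_eq[of x i y'] xy i sxy by simp
      then have "y' = y" using inj(2) y'(1) xy(2) by (auto dest: inj_onD)
      with y' show ?thesis by simp
    qed
    moreover have "i \<in> g x" if i: "i \<in> g0 y" for i
    proof -
      obtain x' where x': "x' \<in> T" "i \<in> g x'" using U xy(2) i by blast
      then have "snd x' = snd x" using snd_eq[of x' i y] xy i sxy by simp
      then have "x' = x" using inj(1) x'(1) xy(1) by (auto dest: inj_onD)
      with x' show ?thesis by simp
    qed
    ultimately have "g x = g0 y" by blast
    moreover from this have "fst x = fst y" using T[OF xy(1)] T0[OF xy(2)] by simp
    ultimately show ?thesis using sxy by (simp add: prod_eq_iff)
  qed
  have "\<exists>j. j \<in> g x" if "x \<in> T" for x using T[OF that] by (metis card.empty ex_in_conv not_one_le_zero)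
  then have 1: "x \<in> T0 \<and> g x = g0 x" if "x \<in> T" for x
    using match that U by (metis UN_E UN_I)
  have "\<exists>j. j \<in> g0 x" if "x \<in> T0" for x using T0[OF that] by (metis card.empty ex_in_conv not_one_le_zero)
  then have "x \<in> T" if "x \<in> T0" for x
    using match that U by (metis UN_E UN_I)
  with 1 show ?thesis by blast
qed

text \<open>Each new set is chosen outside the places already taken. This is the point where the
  bound n on the total index of a normal monomial enters.\<close>

lemma disjoint_placement_exists:
  assumes "finite T" "(\<Sum>x\<in>T. f x) \<le> (n :: nat)"
  shows "\<exists>g. (\<forall>x\<in>T. g x \<subseteq> {1..n} \<and> card (g x) = f x) \<and> (\<forall>x\<in>T. \<forall>y\<in>T. x \<noteq> y \<longrightarrow> g x \<inter> g y = {})"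
  using assms
proof (induction T)
  case (insert a T)
  then obtain g where g: "\<forall>x\<in>T. g x \<subseteq> {1..n} \<and> card (g x) = f x"
    "\<forall>x\<in>T. \<forall>y\<in>T. x \<noteq> y \<longrightarrow> g x \<inter> g y = {}" by auto
  let ?U = "\<Union>x\<in>T. g x"
  have "card ?U \<le> (\<Sum>x\<in>T. card (g x))" using insert.hyps by (intro card_UN_le)
  also have "\<dots> = (\<Sum>x\<in>T. f x)" using g by (intro sum.cong) auto
  finally have "card ?U + f a \<le> n" using insert by simp
  moreover have "?U \<subseteq> {1..n}" using g by blast
  then have "card ({1..n} - ?U) = n - card ?U" by (subst card_Diff_subset) (auto intro: finite_subset)
  ultimately have "f a \<le> card ({1..n} - ?U)" by simp
  then obtain J where J: "J \<subseteq> {1..n} - ?U" "card J = f a" by (rule obtain_subset_with_card_n) 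
  show ?case
    using g J insert.hyps by (intro exI[of _ "g(a := J)"]) (auto 0 3)
qed simp

lemma prod_sigma_expand:
  assumes "finite T"
  shows "(\<Prod>x\<in>T. sigma n (fst x) (snd x)) =
    (\<Sum>g\<in>PiE T (\<lambda>x. {J. J \<subseteq> {1..n} \<and> card J = fst x}). pmon (placed T g))"
proof -
  have "finite {J. J \<subseteq> {1..n} \<and> card J = r}" for r
    by (rule finite_subset[of _ "Pow {1..n}"]) auto
  then have "(\<Prod>x\<in>T. sigma n (fst x) (snd x)) =
    (\<Sum>g\<in>PiE T (\<lambda>x. {J. J \<subseteq> {1..n} \<and> card J = fst x}). \<Prod>x\<in>T. \<Prod>j\<in>g x. pmon (place j (snd x)))"
    unfolding sigma_def by (intro prod_sum_PiE assms)
  then show ?thesis by (simp only: prod_pmon placed_def)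
qed

lemma normal_mon_eq: "normal_mon n m t \<Longrightarrow> t = mset_set (set_mset t)"
  by (intro multiset_eqI) (auto simp: normal_mon_def count_mset_set' not_in_iff)

text \<open>
  Among the \<open>\<phi>(pmon t)\<close> with \<open>t\<close> normal of maximal degree, a monomial placing the factors of
  \<open>t\<close> on disjoint sets of places occurs in no other one.
\<close>

lemma normal_independent:
  assumes q: "\<And>t. t \<in> Poly_Mapping.keys q \<Longrightarrow> normal_mon n m t"
    and zero: "phi n q = (0 :: (nat \<times> nat, 'k::comm_ring_1) mpoly)"
  shows "q = 0"
proof (rule ccontr)
  assume "q \<noteq> 0"
  then have ne: "Poly_Mapping.keys q \<noteq> {}" by simp
  let ?d = "\<lambda>t :: (nat \<times> nat multiset) multiset. \<Sum>x\<in>set_mset t. fst x"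
  let ?p = "\<lambda>t. \<Prod>x\<in>set_mset t. sigma n (fst x) (snd x) :: (nat \<times> nat, 'k) mpoly"
  \<comment> \<open>Maximality of the total index supplies the inequality required by
    \<open>placed_inject\<close>.\<close>
  obtain t0 where t0: "t0 \<in> Poly_Mapping.keys q" "\<And>t. t \<in> Poly_Mapping.keys q \<Longrightarrow> ?d t \<le> ?d t0"
  proof -
    let ?M = "Max (?d ` Poly_Mapping.keys q)"
    have "?M \<in> ?d ` Poly_Mapping.keys q" using ne by (intro Max_in) auto
    then obtain a where "a \<in> Poly_Mapping.keys q" "?d a = ?M" by auto
    moreover have "?d b \<le> ?M" if "b \<in> Poly_Mapping.keys q" for b
      using that by (intro Max_ge) auto
    ultimately show ?thesis using that by auto
  qed
  have n0: "normal_mon n m t0" using q t0 by blast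
  have d: "?d t = (\<Sum>x\<in>#t. fst x)" if "normal_mon n m t" for t
    using arg_cong[OF normal_mon_eq[OF that], of "\<lambda>t. \<Sum>x\<in>#t. fst x"] by (simp add: sum_unfold_sum_mset)
  have ph: "(\<Prod>v\<in>#t. case v of (r, w) \<Rightarrow> sigma n r w) = ?p t" if "normal_mon n m t" for t
    using arg_cong[OF normal_mon_eq[OF that], of "\<lambda>t. \<Prod>x\<in>#t. sigma n (fst x) (snd x) :: (nat \<times> nat, 'k) mpoly"]
    by (simp add: prod_unfold_prod_mset split_beta)
  have "?d t0 \<le> n" using d[OF n0] n0 by (simp add: normal_mon_def)
  then have "\<exists>g. (\<forall>x\<in>set_mset t0. g x \<subseteq> {1..n} \<and> card (g x) = fst x) \<and>
      (\<forall>x\<in>set_mset t0. \<forall>y\<in>set_mset t0. x \<noteq> y \<longrightarrow> g x \<inter> g y = {})"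
    by (rule disjoint_placement_exists[OF finite_set_mset])
  then obtain g0 where g0': "(\<forall>x\<in>set_mset t0. g0 x \<subseteq> {1..n} \<and> card (g0 x) = fst x) \<and>
      (\<forall>x\<in>set_mset t0. \<forall>y\<in>set_mset t0. x \<noteq> y \<longrightarrow> g0 x \<inter> g0 y = {})"
    by (rule exE)
  then have g0: "\<And>x. x \<in># t0 \<Longrightarrow> g0 x \<subseteq> {1..n} \<and> card (g0 x) = fst x"
    "\<And>x y. x \<in># t0 \<Longrightarrow> y \<in># t0 \<Longrightarrow> x \<noteq> y \<Longrightarrow> g0 x \<inter> g0 y = {}"
    by blast+
  let ?\<tau> = "placed (set_mset t0) g0"
  let ?G = "\<lambda>t. PiE (set_mset t) (\<lambda>x. {J. J \<subseteq> {1..n} \<and> card J = fst x})"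
  have finG: "finite (?G t)" for t
    by (intro finite_PiE) (auto intro: finite_subset[of _ "Pow {1..n}"])
  have inj: "set_mset t = set_mset t0 \<and> (\<forall>x\<in>#t0. g x = g0 x)"
    if t: "t \<in> Poly_Mapping.keys q" and g: "g \<in> ?G t" and eq: "placed (set_mset t) g = ?\<tau>" for t g
  proof (rule placed_inject)
    have nt: "normal_mon n m t" using q t by blast
    have gx: "g x \<subseteq> {1..n} \<and> card (g x) = fst x" if "x \<in># t" for x using g that by (auto simp: PiE_iff)
    show "finite (g x) \<and> card (g x) = fst x \<and> 1 \<le> fst x \<and> snd x \<noteq> {#}" if "x \<in> set_mset t" for x
      using gx[OF that] nt that by (auto simp: normal_mon_def Mon_def intro: finite_subset)
    show "finite (g0 x) \<and> card (g0 x) = fst x \<and> 1 \<le> fst x \<and> snd x \<noteq> {#}" if "x \<in> set_mset t0" for x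
      using g0(1)[OF that] n0 that by (auto simp: normal_mon_def Mon_def intro: finite_subset)
    show "inj_on snd (set_mset t)" "inj_on snd (set_mset t0)" using nt n0 by (simp_all add: normal_mon_def)
  qed (use g0 t0 t eq in auto)
  \<comment> \<open>The disjoint placement is the only one producing this monomial, so its
    coefficient is exactly 1 and the argument works over every K.\<close>
  have l: "Poly_Mapping.lookup (?p t) ?\<tau> = (if t = t0 then 1 else 0)" if t: "t \<in> Poly_Mapping.keys q" for t
  proof -
    have "Poly_Mapping.lookup (?p t) ?\<tau> = (\<Sum>g\<in>?G t. if placed (set_mset t) g = ?\<tau> then 1 else 0)"
      by (simp add: prod_sigma_expand lookup_sum pmon_def lookup_single when_def)
    also have "\<dots> = (\<Sum>g\<in>?G t. if t = t0 \<and> g = restrict g0 (set_mset t0) then 1 else 0)"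
    proof (rule sum.cong[OF refl])
      fix g assume g: "g \<in> ?G t"
      have "placed (set_mset t) g = ?\<tau> \<longleftrightarrow> t = t0 \<and> g = restrict g0 (set_mset t0)"
      proof
        assume eq: "placed (set_mset t) g = ?\<tau>"
        have 1: "set_mset t = set_mset t0" "\<forall>x\<in>#t0. g x = g0 x" using inj[OF t g eq] by auto
        then have "t = t0" using normal_mon_eq q t n0 by metis
        moreover have "g = restrict g0 (set_mset t0)"
        proof (rule extensionalityI[of _ "set_mset t0"])
          show "g \<in> extensional (set_mset t0)" using g 1(1) by (simp add: PiE_iff)
        qed (use 1(2) in auto)
        ultimately show "t = t0 \<and> g = restrict g0 (set_mset t0)" by simp
      qed (auto simp: placed_def)
      then show "(if placed (set_mset t) g = ?\<tau> then 1 else 0) =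
        (if t = t0 \<and> g = restrict g0 (set_mset t0) then 1 else 0 :: 'k)" by simp
    qed
    also have "\<dots> = (if t = t0 then 1 else 0)"
    proof (cases "t = t0")
      case True
      have "restrict g0 (set_mset t0) \<in> ?G t0" using g0(1) by auto
      then have "(\<Sum>g\<in>?G t0. if g = restrict g0 (set_mset t0) then 1 else 0) = (1 :: 'k)"
        unfolding sum.delta[OF finG] by (simp only: if_True)
      then show ?thesis using True by (simp only: simp_thms if_True)
    qed simp
    finally show ?thesis .
  qed
  have "phi n q = (\<Sum>t\<in>Poly_Mapping.keys q. pconst (Poly_Mapping.lookup q t) * ?p t)"
    unfolding phi_def peval_def by (intro sum.cong refl) (simp add: ph q)
  then have "0 = Poly_Mapping.lookup (\<Sum>t\<in>Poly_Mapping.keys q. pconst (Poly_Mapping.lookup q t) * ?p t) ?\<tau>"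
    using zero by simp
  also have "\<dots> = (\<Sum>t\<in>Poly_Mapping.keys q. Poly_Mapping.lookup q t * Poly_Mapping.lookup (?p t) ?\<tau>)"
    unfolding lookup_sum pconst_def lookup_times_const ..
  also have "\<dots> = (\<Sum>t\<in>Poly_Mapping.keys q. if t = t0 then Poly_Mapping.lookup q t else 0)"
    by (rule sum.cong) (auto simp: l)
  also have "\<dots> = Poly_Mapping.lookup q t0" using t0(1) by simp
  finally show False using t0(1) by (simp add: in_keys_iff)
qed

lemma (in syzygy_ideal) kernel_subset:
  assumes "pvars p \<subseteq> {1..n} \<times> Mon m" "phi n p = 0"
  shows "p \<in> I"
proof -
  obtain i q where iq: "p = i + q" "i \<in> I" "\<And>t. t \<in> Poly_Mapping.keys q \<Longrightarrow> normal_mon n m t"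
    using carrier_normal_span[OF assms(1)] by (auto simp: normal_span_def mod_I_def)
  have "phi n q = 0" using assms(2) iq(1) I_phi[OF iq(2)] by (simp add: phi_simps)
  then have "q = 0" by (intro normal_independent[of q n m] iq(3))
  with iq show ?thesis by simp
qed

section \<open>The kernel as an ideal\<close>

lemma poly_ring_cring: "cring (poly_ring X :: ('v, 'k::comm_ring_1) mpoly ring)"
proof (rule cringI)
  show "abelian_group (poly_ring X :: ('v, 'k) mpoly ring)"
  proof (rule abelian_groupI)
    fix p assume "p \<in> carrier (poly_ring X :: ('v, 'k) mpoly ring)"
    then show "\<exists>q\<in>carrier (poly_ring X). q \<oplus>\<^bsub>poly_ring X\<^esub> p = \<zero>\<^bsub>poly_ring X\<^esub>"
      by (intro bexI[of _ "- p"]) (simp_all add: poly_ring_def pvars_simps)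
  qed (simp_all add: poly_ring_def pvars_plus_le pvars_simps add_ac)
  show "Group.comm_monoid (poly_ring X :: ('v, 'k) mpoly ring)"
    by (rule comm_monoidI) (simp_all add: poly_ring_def pvars_times_le pvars_simps mult_ac)
qed (simp add: poly_ring_def distrib_right)

lemma kernel_eq:
  "a_kernel (e_ring n m :: 'k::comm_ring_1 epoly ring) (inv_ring n m) (phi n) =
    {p. pvars p \<subseteq> {1..n} \<times> Mon m \<and> phi n p = 0}"
  by (auto simp: a_kernel_def' carrier_e_ring inv_ring_def poly_ring_def)

text \<open>With this, by minimality of the generated ideal, only the generators have to be checked
  for membership in the kernel.\<close>

lemma kernel_ideal:
  "ideal {p :: 'k::comm_ring_1 epoly. pvars p \<subseteq> {1..n} \<times> Mon m \<and> phi n p = 0} (e_ring n m)"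
    (is "ideal ?K ?R")
proof -
  interpret cring ?R unfolding e_ring_def by (rule poly_ring_cring)
  have ops: "x \<oplus>\<^bsub>?R\<^esub> y = x + y" "x \<otimes>\<^bsub>?R\<^esub> y = x * y" "\<zero>\<^bsub>?R\<^esub> = 0" for x y :: "'k epoly"
    by (simp_all add: e_ring_def poly_ring_def)
  have "subgroup ?K (add_monoid ?R)"
  proof (rule add.subgroupI)
    show "?K \<subseteq> carrier ?R" by (auto simp: carrier_e_ring)
    have "0 \<in> ?K" by (simp add: pvars_simps phi_hom)
    then show "?K \<noteq> {}" by blast
    fix a assume a: "a \<in> ?K"
    have "\<ominus>\<^bsub>?R\<^esub> a = - a"
      using a by (intro minus_equality[symmetric] minus_equality) (auto simp: carrier_e_ring ops pvars_simps)
    then show "\<ominus>\<^bsub>?R\<^esub> a \<in> ?K" using a by (simp add: pvars_simps phi_hom)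
    fix b assume "b \<in> ?K"
    then show "a \<oplus>\<^bsub>?R\<^esub> b \<in> ?K" using a by (simp add: ops pvars_plus_le phi_simps)
  qed
  then show ?thesis
    by (intro idealI ring_axioms) (simp_all add: ops carrier_e_ring phi_simps pvars_times_le)
qed

theorem theorem5p5:
  fixes n m :: nat
  assumes "n \<ge> 1" and "m \<ge> 1"
  shows "a_kernel (e_ring n m :: 'k::comm_ring_1 epoly ring) (inv_ring n m) (phi n) =
    Idl\<^bsub>e_ring n m\<^esub>
      ({S n s \<alpha> w | s \<alpha> w.
          s \<ge> 2 \<and> (\<forall>i\<in>{1..s}. w i \<in> Mon m) \<and>
          (\<Sum>i=1..s. \<alpha> i) > n \<and> (\<forall>j\<in>{1..s}. (\<Sum>i\<in>{1..s} - {j}. \<alpha> i) \<le> n)} \<union>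
       {Q n r k w | r k w.
          w \<in> Mon m \<and> r \<in> {1..n} \<and> k \<ge> 2 \<and> real k < 1 + real n / real r})"
    (is "_ = Idl\<^bsub>?R\<^esub> ?G")
proof -
  interpret R: cring ?R unfolding e_ring_def by (rule poly_ring_cring)
  have ops: "x \<oplus>\<^bsub>?R\<^esub> y = x + y" "x \<otimes>\<^bsub>?R\<^esub> y = x * y" "\<zero>\<^bsub>?R\<^esub> = 0" for x y :: "'k epoly"
    by (simp_all add: e_ring_def poly_ring_def)
  let ?K = "{p :: 'k epoly. pvars p \<subseteq> {1..n} \<times> Mon m \<and> phi n p = 0}"
  have G: "?G \<subseteq> ?K"
  proof
    fix p assume "p \<in> ?G"
    then consider (S) s \<alpha> w where "p = S n s \<alpha> w" "\<forall>i\<in>{1..s}. w i \<in> Mon m" "(\<Sum>i=1..s. \<alpha> i) > n"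
      | (Q) r k w where "p = Q n r k w" "w \<in> Mon m" "r \<in> {1..n}" "k \<ge> 2" by blast
    then show "p \<in> ?K"
    proof cases
      case S
      let ?A = "\<Sum>i=1..s. replicate_mset (\<alpha> i) i"
      have "phi n (neck_S n s ?A w :: 'k epoly) = 0"
        by (rule phi_neck_S_eq_0) (use S(3) in \<open>auto simp: set_mset_sum split: if_splits\<close>)
      then show ?thesis using S neck_S_pvars[of s w m n ?A] by (simp add: S_eq_neck_S)
    next
      case Q
      then show ?thesis using Q_pvars[of k r w m n] phi_Q[of k n r w] by simp
    qed
  qed
  have "?K \<subseteq> carrier ?R" by (auto simp: carrier_e_ring)
  with G have GR: "?G \<subseteq> carrier ?R" by (rule subset_trans)
  let ?I = "Idl\<^bsub>?R\<^esub> ?G"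
  interpret I: ideal ?I ?R by (rule R.genideal_ideal[OF GR])
  \<comment> \<open>This inclusion comes before the reduction because the locale assumptions
    \<open>I_carrier\<close> and \<open>I_phi\<close> rest on it.\<close>
  have IK: "?I \<subseteq> ?K" by (rule R.genideal_minimal[OF kernel_ideal G])
  have GI: "?G \<subseteq> ?I" by (rule R.genideal_self[OF GR])
  interpret syzygy_ideal n m ?I
  proof unfold_locales
    show "0 \<in> ?I" using I.zero_closed by (simp add: ops)
    show "a + b \<in> ?I" if "a \<in> ?I" "b \<in> ?I" for a b using I.a_closed[OF that] by (simp add: ops)
    show "a * x \<in> ?I" if "a \<in> ?I" "pvars x \<subseteq> {1..n} \<times> Mon m" for a x
      using I.I_r_closed[OF that(1), of x] that(2) by (simp add: ops carrier_e_ring)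
    show "pvars a \<subseteq> {1..n} \<times> Mon m" "phi n a = 0" if "a \<in> ?I" for a using that IK by blast+
    show "S n s \<alpha> w \<in> ?I" if "s \<ge> 2" "\<And>i. i \<in> {1..s} \<Longrightarrow> w i \<in> Mon m" "(\<Sum>i=1..s. \<alpha> i) > n"
      "\<And>j. j \<in> {1..s} \<Longrightarrow> (\<Sum>i\<in>{1..s} - {j}. \<alpha> i) \<le> n" for s w \<alpha>
      using that by (intro subsetD[OF GI]) blast
    show "Q n r k w \<in> ?I" if "w \<in> Mon m" "r \<in> {1..n}" "k \<ge> 2" "real k < 1 + real n / real r" for w r k
      using that by (intro subsetD[OF GI]) blast
  qed
  show ?thesis unfolding kernel_eq using IK kernel_subset by blast
qed

end
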